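(* For all integers $d \ge 2$ and $m \ge d$, the constant $c(m,d)$ satisfies \[ d^{-50d^3}m^{-d^2} \le c(m,d) \le d^d m^{-d}. \]
   Context: A family of finite sets $X_1,\dots,X_m\subseteq\mathbb{R}^d$ is said to be in general position if the sets are pairwise disjoint and their union is a set of points in general position. Sets $Y_1,\dots,Y_{d+1}\subseteq\mathbb{R}^d$ have the same-type property if for every choice $y_1\in Y_1,\dots,y_{d+1}\in Y_{d+1}$ the orientation of the $(d+1)$-tuple $(y_1,\dots,y_{d+1})$ (the sign of the determinant of the affine coordinates) is the same; sets $Y_1,\dots,Y_m$ have the same-type property if every $d+1$ of them do. For a family $X_1,\dots,X_m$ of nonempty finite sets in general position, $c(X_1,\dots,X_m)$ denotes the largest $c$ such that there exist $Y_1\subseteq X_1,\dots,Y_m\subseteq X_m$ with the same-type property and $|Y_i|\ge c|X_i|$ for all $i$. The constant $c(m,d)$ is the infimum of $c(X_1,\dots,X_m)$ over all such families of $m$ finite sets in $\mathbb{R}^d$. *)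

theory Defs
  imports "HOL-Analysis.Analysis"
begin

text \<open>Points of R^d are vectors of type real^'n with d = CARD('n).
Orientation of the (d+1)-tuple (y0, y_k)_{k in 'n}: sign of the determinant of
the affine coordinate matrix, which equals the determinant of the d x d matrix
with rows y_k - y0.\<close>

definition orient :: "real^'n \<Rightarrow> ('n::finite \<Rightarrow> real^'n) \<Rightarrow> real" where
  "orient y0 y = sgn (det (\<chi> i k. (y i - y0) $ k))"

definition gen_pos :: "(real^'n::finite) set \<Rightarrow> bool" where
  "gen_pos P \<longleftrightarrow> (\<forall>S \<subseteq> P. card S \<le> CARD('n) + 1 \<longrightarrow> \<not> affine_dependent S)"

definition family_gen_pos :: "nat \<Rightarrow> (nat \<Rightarrow> (real^'n::finite) set) \<Rightarrow> bool" where
  "family_gen_pos m X \<longleftrightarrow>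
     (\<forall>i<m. finite (X i)) \<and>
     (\<forall>i<m. \<forall>j<m. i \<noteq> j \<longrightarrow> X i \<inter> X j = {}) \<and>
     gen_pos (\<Union>i<m. X i)"

definition same_type :: "nat \<Rightarrow> (nat \<Rightarrow> (real^'n::finite) set) \<Rightarrow> bool" where
  "same_type m Y \<longleftrightarrow>
     (\<forall>j0 (j::'n \<Rightarrow> nat). j0 < m \<and> (\<forall>k. j k < m) \<and> inj j \<and> j0 \<notin> range j \<longrightarrow>
       (\<forall>y0 y z0 z. y0 \<in> Y j0 \<and> (\<forall>k. y k \<in> Y (j k)) \<and>
                    z0 \<in> Y j0 \<and> (\<forall>k. z k \<in> Y (j k)) \<longrightarrow>
                    orient y0 y = orient z0 z))"

definition c_fam :: "nat \<Rightarrow> (nat \<Rightarrow> (real^'n::finite) set) \<Rightarrow> real" where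
  "c_fam m X = Sup {c. \<exists>Y. (\<forall>i<m. Y i \<subseteq> X i) \<and> same_type m Y \<and>
                         (\<forall>i<m. real (card (Y i)) \<ge> c * real (card (X i)))}"

definition c_md :: "nat \<Rightarrow> 'n::finite itself \<Rightarrow> real" where
  "c_md m _ = Inf {c_fam m X | X :: nat \<Rightarrow> (real^'n) set.
                   family_gen_pos m X \<and> (\<forall>i<m. X i \<noteq> {})}"

end

theory Submission
  imports Defs
begin

text \<open>
  Upper bound: let every \<open>X\<^sub>i\<close> have one generic point in each cell of an \<open>N \<times> \<dots> \<times> N\<close> grid. The orientation is
  affine in each point, so a hyperplane cannot meet the convex hulls of \<open>d + 1\<close> of the sets \<open>Y\<^sub>i\<close>. Applied to the
  axis-parallel grid hyperplanes this bounds the total width of the \<open>Y\<^sub>i\<close> in every coordinate direction by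
  about \<open>d N\<close>, and the inequality of arithmetic and geometric means gives \<open>c \<le> (d / m + 1 / N)\<^sup>d\<close>.

  Lower bound: for each \<open>X\<^sub>i\<close> there is a finite family of simplices, each containing a fraction of order \<open>r\<^sup>-\<^sup>d\<close> of
  \<open>X\<^sub>i\<close>, such that every hyperplane touches a fraction of order at most \<open>1 / r\<close> of them. By multiplicative
  weights it suffices to find, for any finite weighted set of hyperplanes, one such simplex that is crossed by a
  fraction of order \<open>1 / r\<close> of the weight; a simplex of the arrangement of \<open>r\<close> random hyperplanes
  works by the backward analysis of Clarkson and Shor. Now choose one simplex per index. A choice fails for \<open>d + 1\<close>
  indices only if a hyperplane spanned by vertices of \<open>d\<close> of the simplices touches the remaining one, which
  happens for a fraction of order \<open>1 / r\<close> of the choices. A local lemma argument with \<open>r\<close> of order \<open>m\<^sup>d\<close> finds a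
  choice that never fails, and the points of \<open>X\<^sub>i\<close> in the chosen simplices have the same-type property.
\<close>

section \<open>Orientations of point tuples\<close>

text \<open>The exponent \<open>d\<^sup>2\<close> of the lower bound comes from the choice of r. An
  index occurs in at most (d + 1) m^d tuples of d + 1 indices, and the local lemma wants a failure
  rate below the inverse of that number, up to factors depending on d; hence r is of order m^d, and
  r^-d becomes m^(-d^2). Two obstacles shape the lower bound. Sampling controls only strict
  crossings by finitely many hyperplanes in general position, whereas the hyperplanes spanned by
  vertices are not known in advance and may pass through further vertices. So the sampling is run on
  a generic perturbation of a finite net of hyperplanes, and the simplices are translated by short
  vectors. The translated simplices contain translates of the points of \<open>X\<^sub>i\<close>;
  general position makes all orientations survive a short enough translation. Moreover, the faces of
  an arrangement may be unbounded, so 2 d hyperplanes that bound a perturbed cube are added to every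
  sample.\<close>

definition tdet :: "('n::finite option \<Rightarrow> real^'n) \<Rightarrow> real" where
  "tdet y = det (\<chi> i. y (Some i) - y None)"

text \<open>The type \<open>'n option\<close> has d + 1 elements, with \<open>None\<close> for the
  base point. Tuples indexed by it can be updated and permuted uniformly, which the separate
  argument \<open>y0\<close> of \<open>orient\<close> does not allow.\<close>

lemma orient_eq_sgn_tdet: "orient y0 y = sgn (tdet (case_option y0 y))"
proof -
  have "(\<chi> i k. (y i - y0) $ k) = (\<chi> i. y i - y0)" by (simp add: vec_eq_iff)
  then show ?thesis unfolding orient_def tdet_def by simp
qed

lemma det_subtract_row:
  fixes A :: "real^'n^'n"
  assumes "finite S" "k \<notin> S"
  shows "det (\<chi> i. if i \<in> S then A $ i - A $ k else A $ i) = det A"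
  using assms
proof (induction S rule: finite_induct)
  case empty
  have "(\<chi> i. A $ i) = A" by (simp add: vec_eq_iff)
  then show ?case by simp
next
  case (insert s S)
  let ?B = "\<chi> i. if i \<in> S then A $ i - A $ k else A $ i"
  have "(\<chi> i. if i \<in> insert s S then A $ i - A $ k else A $ i)
      = (\<chi> i. if i = s then row s ?B + (-1) *s row k ?B else row i ?B)"
    using insert by (auto simp: vec_eq_iff row_def)
  also have "det \<dots> = det ?B" using insert by (intro det_row_operation) auto
  finally show ?case using insert by simp
qed

text \<open>Subtracting row \<open>k\<close> from all other rows turns differences to
  \<open>y None\<close> into differences to \<open>y (Some k)\<close> and keeps the determinant;
  only row \<open>k\<close> itself then has the wrong sign.\<close>

lemma tdet_swap:
  fixes y :: "'n::finite option \<Rightarrow> real^'n"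
  shows "tdet (y(None := y (Some k), Some k := y None)) = - tdet y"
proof -
  let ?A = "\<chi> i. y (Some i) - y None"
  let ?B = "\<chi> i. if i \<in> - {k} then ?A $ i - ?A $ k else ?A $ i"
  have 1: "det ?B = det ?A" by (rule det_subtract_row) auto
  have "(\<chi> i. (y(None := y (Some k), Some k := y None)) (Some i) - (y(None := y (Some k), Some k := y None)) None)
     = (\<chi> i. if i = k then (-1) *s ?A $ k else ?B $ i)"
    by (auto simp: vec_eq_iff)
  then have "tdet (y(None := y (Some k), Some k := y None)) = det (\<chi> i. if i = k then (-1) *s ?A $ k else ?B $ i)"
    by (simp add: tdet_def)
  also have "\<dots> = (-1) * det (\<chi> i. if i = k then ?A $ k else ?B $ i)" by (rule det_row_mul)
  also have "(\<chi> i. if i = k then ?A $ k else ?B $ i) = ?B" by (auto simp: vec_eq_iff)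
  also have "(-1) * det ?B = - det ?A" using 1 by simp
  finally show ?thesis unfolding tdet_def[of y] .
qed

lemma tdet_upd_Some:
  fixes y :: "'n::finite option \<Rightarrow> real^'n"
  shows "\<exists>a b. \<forall>p. tdet (y(Some k := p)) = a \<bullet> p + b"
proof -
  let ?M = "\<lambda>q. \<chi> i. if i = k then q else y (Some i) - y None"
  have lin: "linear (\<lambda>q. det (?M q))"
  proof (rule linearI)
    show "det (?M (p + q)) = det (?M p) + det (?M q)" for p q by (rule det_row_add)
    show "det (?M (r *\<^sub>R q)) = r *\<^sub>R det (?M q)" for r q
      using det_row_mul[of k r "\<lambda>_. q" "\<lambda>i. y (Some i) - y None"]
      unfolding scalar_mult_eq_scaleR by simp
  qed
  have eq: "tdet (y(Some k := p)) = det (?M (p - y None))" for p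
    unfolding tdet_def by (rule arg_cong[where f=det]) (auto simp: vec_eq_iff)
  \<comment> \<open>The adjoint of a linear functional, applied to 1, is the vector that represents
    it.\<close>
  define a where "a = adjoint (\<lambda>q. det (?M q)) 1"
  have "det (?M q) = a \<bullet> q" for q
    using adjoint_works[OF lin, of q 1] by (simp add: a_def inner_commute)
  then have "tdet (y(Some k := p)) = a \<bullet> p + (- (a \<bullet> y None))" for p
    by (simp add: eq inner_diff_right)
  then show ?thesis by blast
qed

text \<open>Moving the base point changes every row at once, so its affine effect is not visible in
  the matrix; exchanging it with another point reduces this case to a change of a single
  row.\<close>

lemma tdet_upd_affine:
  fixes y :: "'n::finite option \<Rightarrow> real^'n"
  shows "\<exists>a b. \<forall>p. tdet (y(k := p)) = a \<bullet> p + b"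
proof (cases k)
  case (Some i) then show ?thesis using tdet_upd_Some by blast
next
  case None
  obtain k :: 'n where True by simp
  let ?z = "y(None := y (Some k))"
  obtain a b where ab: "\<And>p. tdet (?z(Some k := p)) = a \<bullet> p + b" using tdet_upd_Some by blast
  have "tdet (y(None := p)) = (-a) \<bullet> p + (-b)" for p
  proof -
    have "y(None := p) = (?z(Some k := p))(None := (?z(Some k := p)) (Some k), Some k := (?z(Some k := p)) None)"
      by auto
    then have "tdet (y(None := p)) = - tdet (?z(Some k := p))" by (metis tdet_swap)
    then show ?thesis using ab by simp
  qed
  then show ?thesis unfolding None by blast
qed

text \<open>A kernel vector of the matrix of differences is a normal on which all points of the
  tuple have the same value.\<close>

lemma tdet_eq_0_iff_hyperplane:
  fixes y :: "'n::finite option \<Rightarrow> real^'n"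
  shows "tdet y = 0 \<longleftrightarrow> (\<exists>a b. a \<noteq> 0 \<and> (\<forall>k. a \<bullet> y k + b = 0))"
proof -
  let ?A = "\<chi> i. y (Some i) - y None"
  have "tdet y = 0 \<longleftrightarrow> \<not> invertible ?A" by (simp add: tdet_def invertible_det_nz)
  also have "\<dots> \<longleftrightarrow> (\<exists>a. a \<noteq> 0 \<and> ?A *v a = 0)"
    by (metis invertible_left_inverse matrix_left_invertible_ker)
  also have "\<dots> \<longleftrightarrow> (\<exists>a b. a \<noteq> 0 \<and> (\<forall>k. a \<bullet> y k + b = 0))"
  proof safe
    fix a assume a: "a \<noteq> 0" "?A *v a = 0"
    have "(y (Some i) - y None) \<bullet> a = 0" for i
      using a(2) by (auto simp: vec_eq_iff matrix_vector_mult_def inner_vec_def)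
    then have "a \<bullet> y k + (- (a \<bullet> y None)) = 0" for k
      by (cases k) (auto simp: inner_diff_left inner_commute[of a])
    then show "\<exists>a b. a \<noteq> 0 \<and> (\<forall>k. a \<bullet> y k + b = 0)" using a(1) by blast
  next
    fix a b assume a: "a \<noteq> 0" "\<forall>k. a \<bullet> y k + b = 0"
    have "(y (Some i) - y None) \<bullet> a = 0" for i
      using a(2)[rule_format, of "Some i"] a(2)[rule_format, of None]
      by (simp add: inner_diff_right inner_commute[of _ a])
    then have "?A *v a = 0" by (auto simp: vec_eq_iff matrix_vector_mult_def inner_vec_def)
    then show "\<exists>a. a \<noteq> 0 \<and> ?A *v a = 0" using a(1) by blast
  qed
  finally show ?thesis .
qed

text \<open>A vanishing determinant also gives a linear relation between the rows. A point with
  nonzero coefficient in it is an affine combination of the other points, so affine functions that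
  vanish at those vanish there too.\<close>

lemma tdet_eq_0_imp_determined:
  fixes y :: "'n::finite option \<Rightarrow> real^'n"
  assumes "tdet y = 0"
  shows "\<exists>k. \<forall>a b. (\<forall>l. l \<noteq> k \<longrightarrow> a \<bullet> y l + b = 0) \<longrightarrow> a \<bullet> y k + b = 0"
proof -
  let ?A = "\<chi> i. y (Some i) - y None"
  have "\<not> invertible (transpose ?A)" using assms by (simp add: tdet_def invertible_det_nz)
  then obtain c where c: "c \<noteq> 0" "transpose ?A *v c = 0"
    by (metis invertible_left_inverse matrix_left_invertible_ker)
  then have s: "(\<Sum>i\<in>UNIV. c $ i *\<^sub>R (y (Some i) - y None)) = 0"
    by (auto simp: vec_eq_iff matrix_vector_mult_def transpose_def mult.commute)
  from c obtain k where k: "c $ k \<noteq> 0" by (auto simp: vec_eq_iff)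
  show ?thesis
  proof (intro exI[of _ "Some k"] allI impI)
    fix a b assume h: "\<forall>l. l \<noteq> Some k \<longrightarrow> a \<bullet> y l + b = 0"
    have z: "a \<bullet> (y (Some i) - y None) = 0" if "i \<noteq> k" for i
      using h[rule_format, of "Some i"] h[rule_format, of None] that by (simp add: inner_diff_right)
    have "0 = (\<Sum>i\<in>UNIV. c $ i * (a \<bullet> (y (Some i) - y None)))"
      using arg_cong[OF s, of "inner a"] by (simp add: inner_sum_right)
    also have "\<dots> = c $ k * (a \<bullet> (y (Some k) - y None))"
      by (subst sum.remove[of _ k]) (auto simp: z)
    finally have "a \<bullet> (y (Some k) - y None) = 0" using k by simp
    then show "a \<bullet> y (Some k) + b = 0" using h[rule_format, of None] by (simp add: inner_diff_right)
  qed
qed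

section \<open>Orientations on convex hulls\<close>

lemma convex_affine_sgn:
  fixes a :: "'a::real_inner"
  shows "convex {p. sgn (a \<bullet> p + b) = (s::real)}"
proof (cases "s = 1 \<or> s = -1 \<or> s = 0")
  case True
  have "convex {p. a \<bullet> p < -b}" "convex {p. a \<bullet> p > -b}" "convex {p. a \<bullet> p = -b}"
    by (simp_all add: convex_halfspace_lt convex_halfspace_gt convex_hyperplane)
  moreover have "{p. sgn (a \<bullet> p + b) = s} = (if s = 1 then {p. a \<bullet> p > -b} else if s = -1 then {p. a \<bullet> p < -b} else {p. a \<bullet> p = -b})"
    using True by (auto simp: sgn_real_def split: if_splits)
  ultimately show ?thesis by simp
next
  case False
  then have "{p. sgn (a \<bullet> p + b) = s} = {}" by (auto simp: sgn_real_def)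
  then show ?thesis by (metis convex_empty)
qed

text \<open>Enlarge \<open>V k\<close> to its hull one index at a time: with the other points fixed,
  \<open>tdet\<close> is affine in the \<open>k\<close>-th point, and an affine function has a given
  sign on a convex set.\<close>

lemma sgn_tdet_convex_hull:
  fixes V :: "'n::finite option \<Rightarrow> (real^'n) set"
  assumes s: "\<And>y. (\<And>k. y k \<in> V k) \<Longrightarrow> sgn (tdet y) = s"
    and y: "\<And>k. y k \<in> convex hull V k"
  shows "sgn (tdet y) = s"
proof -
  have "\<forall>y. (\<forall>k\<in>S. y k \<in> convex hull V k) \<longrightarrow> (\<forall>k. k \<notin> S \<longrightarrow> y k \<in> V k) \<longrightarrow> sgn (tdet y) = s" if "finite S" for S
    using that
  proof (induction S)
    case empty then show ?case using s by auto
  next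
    case (insert k S)
    show ?case
    proof (intro allI impI)
      fix y assume y1: "\<forall>l\<in>insert k S. y l \<in> convex hull V l" and y2: "\<forall>l. l \<notin> insert k S \<longrightarrow> y l \<in> V l"
      obtain a b where ab: "\<And>p. tdet (y(k := p)) = a \<bullet> p + b" using tdet_upd_affine by blast
      have "V k \<subseteq> {p. sgn (a \<bullet> p + b) = s}"
      proof
        fix p assume "p \<in> V k"
        then have "sgn (tdet (y(k := p))) = s" using insert y1 y2 by auto
        then show "p \<in> {p. sgn (a \<bullet> p + b) = s}" using ab by simp
      qed
      then have "convex hull V k \<subseteq> {p. sgn (a \<bullet> p + b) = s}"
        by (intro hull_minimal convex_affine_sgn)
      then have "sgn (a \<bullet> y k + b) = s" using y1 by auto
      then have "sgn (tdet (y(k := y k))) = s" by (simp only: ab)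
      then show "sgn (tdet y) = s" by simp
    qed
  qed
  from this[of UNIV] y show ?thesis by auto
qed

section \<open>Hyperplanes through all points of a tuple but one\<close>

lemma tdet_repeated:
  fixes y :: "'n::finite option \<Rightarrow> real^'n"
  assumes "k \<noteq> l" "y k = y l" shows "tdet y = 0"
proof -
  have hyp: "tdet z = 0" if "z None = z (Some i)" for z :: "'n::finite option \<Rightarrow> real^'n" and i
    unfolding tdet_def by (rule det_zero_row(1)[of i]) (use that in \<open>auto simp: row_def vec_eq_iff\<close>)
  show ?thesis
  proof (cases k)
    case None then show ?thesis using assms hyp by (cases l) auto
  next
    case (Some i)
    show ?thesis
    proof (cases l)
      case None then show ?thesis using assms Some hyp[of y i] by auto
    next
      case (Some j)
      with \<open>k = Some i\<close> show ?thesis unfolding tdet_def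
        using assms by (intro det_identical_rows[of i j]) (auto simp: row_def vec_eq_iff)
    qed
  qed
qed

text \<open>If some \<open>p\<close> makes the determinant nonzero, the determinant as a function of
  the \<open>k\<close>-th point is itself the affine function wanted: it vanishes at each other
  \<open>y l\<close> because a point is repeated. Otherwise slot \<open>k\<close> is filled with a
  copy of another point, and the vanishing determinant supplies some hyperplane.\<close>

lemma hyperplane_through:
  fixes y :: "'n::finite option \<Rightarrow> real^'n"
  shows "\<exists>a b. a \<noteq> 0 \<and> (\<forall>l. l \<noteq> k \<longrightarrow> a \<bullet> y l + b = 0) \<and>
           ((\<exists>p. tdet (y(k := p)) \<noteq> 0) \<longrightarrow> (\<forall>p. tdet (y(k := p)) = a \<bullet> p + b))"
proof (cases "\<exists>p. tdet (y(k := p)) \<noteq> 0")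
  case True
  then obtain p where p: "tdet (y(k := p)) \<noteq> 0" by blast
  obtain a b where ab: "\<And>p. tdet (y(k := p)) = a \<bullet> p + b" using tdet_upd_affine by blast
  have z: "a \<bullet> y l + b = 0" if "l \<noteq> k" for l
    using tdet_repeated[of k l "y(k := y l)"] that ab by simp
  have "\<exists>l. l \<noteq> k" by (cases k) auto
  then have "a \<noteq> 0" using z p ab by force
  then show ?thesis using ab z by blast
next
  case False
  obtain l where l: "l \<noteq> k" by (cases k) auto
  have "tdet (y(k := y l)) = 0" using tdet_repeated[of k l "y(k := y l)"] l by simp
  then obtain a b where "a \<noteq> 0" "\<forall>i. a \<bullet> (y(k := y l)) i + b = 0"
    unfolding tdet_eq_0_iff_hyperplane by blast
  then show ?thesis using False by (metis fun_upd_other)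
qed

definition ev :: "'a::real_inner \<times> real \<Rightarrow> 'a \<Rightarrow> real" where
  "ev h x = fst h \<bullet> x + snd h"

text \<open>The negation of strict separation, so passing through a single vertex counts. For
  nonempty \<open>V\<close> it means that the zero set of \<open>h\<close> meets the convex hull of
  \<open>V\<close>.\<close>

definition touches :: "'a::real_inner \<times> real \<Rightarrow> 'a set \<Rightarrow> bool" where
  "touches h V \<longleftrightarrow> \<not> ((\<forall>v\<in>V. ev h v > 0) \<or> (\<forall>v\<in>V. ev h v < 0))"

text \<open>A hyperplane through the points \<open>y l\<close> with \<open>l \<noteq> k\<close>. If these points are affinely dependent, it is an
  arbitrary one; otherwise it is normalised so that it agrees with the orientation as a function of the \<open>k\<close>-th point.\<close>
definition opp_hyp :: "'n::finite option \<Rightarrow> ('n option \<Rightarrow> real^'n) \<Rightarrow> (real^'n) \<times> real" where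
  "opp_hyp k y = (SOME h. fst h \<noteq> 0 \<and> (\<forall>l. l \<noteq> k \<longrightarrow> fst h \<bullet> y l + snd h = 0) \<and>
           ((\<exists>p. tdet (y(k := p)) \<noteq> 0) \<longrightarrow> (\<forall>p. tdet (y(k := p)) = fst h \<bullet> p + snd h)))"

lemma opp_hyp:
  fixes y :: "'n::finite option \<Rightarrow> real^'n"
  shows "fst (opp_hyp k y) \<noteq> 0"
    and "l \<noteq> k \<Longrightarrow> fst (opp_hyp k y) \<bullet> y l + snd (opp_hyp k y) = 0"
    and "tdet (y(k := q)) \<noteq> 0 \<Longrightarrow> tdet (y(k := p)) = fst (opp_hyp k y) \<bullet> p + snd (opp_hyp k y)"
proof -
  have "\<exists>h. fst h \<noteq> 0 \<and> (\<forall>l. l \<noteq> k \<longrightarrow> fst h \<bullet> y l + snd h = 0) \<and>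
           ((\<exists>p. tdet (y(k := p)) \<noteq> 0) \<longrightarrow> (\<forall>p. tdet (y(k := p)) = fst h \<bullet> p + snd h))"
    using hyperplane_through[of k y] by simp
  from someI_ex[OF this] show "fst (opp_hyp k y) \<noteq> 0"
    and "l \<noteq> k \<Longrightarrow> fst (opp_hyp k y) \<bullet> y l + snd (opp_hyp k y) = 0"
    and "tdet (y(k := q)) \<noteq> 0 \<Longrightarrow> tdet (y(k := p)) = fst (opp_hyp k y) \<bullet> p + snd (opp_hyp k y)"
    unfolding opp_hyp_def[symmetric] by blast+
qed

text \<open>The predicate under \<open>SOME\<close> does not see \<open>y k\<close>. Hence the
  hyperplane stays fixed while the simplex chosen for slot \<open>k\<close> varies, which the count
  of bad choices relies on.\<close>

lemma opp_hyp_upd: "opp_hyp k (y(k := p)) = opp_hyp k y"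
proof -
  have *: "(l \<noteq> k \<longrightarrow> fst h \<bullet> (y(k := p)) l + snd h = 0) = (l \<noteq> k \<longrightarrow> fst h \<bullet> y l + snd h = 0)" for l h by auto
  show ?thesis unfolding opp_hyp_def * by (simp only: fun_upd_upd)
qed

text \<open>No selection is degenerate: a vanishing determinant puts some \<open>y k\<close> on
  every hyperplane through the others, which then touches \<open>V k\<close>. Replacing one point at
  a time stays on one side of the hyperplane through the others, so the sign never changes.\<close>

lemma const_sgn_tdet_if_not_touches:
  fixes V :: "'n::finite option \<Rightarrow> (real^'n) set"
  assumes nt: "\<And>k y. (\<And>l. y l \<in> V l) \<Longrightarrow> \<not> touches (opp_hyp k y) (V k)"
    and y: "\<And>k. y k \<in> V k" and z: "\<And>k. z k \<in> V k"
  shows "sgn (tdet y) = sgn (tdet z)"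
proof -
  have nz: "tdet y \<noteq> 0" if "\<And>k. y k \<in> V k" for y
  proof
    assume "tdet y = 0"
    then obtain k where "\<And>a b. (\<forall>l. l \<noteq> k \<longrightarrow> a \<bullet> y l + b = 0) \<Longrightarrow> a \<bullet> y k + b = 0"
      using tdet_eq_0_imp_determined by blast
    then have "fst (opp_hyp k y) \<bullet> y k + snd (opp_hyp k y) = 0" using opp_hyp(2) by blast
    then have "touches (opp_hyp k y) (V k)" using that[of k] unfolding touches_def ev_def by force
    then show False using nt that by blast
  qed
  have step: "sgn (tdet (y(k := p))) = sgn (tdet y)" if "\<And>k. y k \<in> V k" "p \<in> V k" for y k p
  proof -
    have n: "tdet (y(k := y k)) \<noteq> 0" using nz that by simp
    have "\<not> touches (opp_hyp k y) (V k)" using nt that by blast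
    then have "sgn (fst (opp_hyp k y) \<bullet> p + snd (opp_hyp k y)) = sgn (fst (opp_hyp k y) \<bullet> y k + snd (opp_hyp k y))"
      using that(1)[of k] that(2) unfolding touches_def ev_def by auto
    then show ?thesis using opp_hyp(3)[OF n, of p] opp_hyp(3)[OF n, of "y k"] by simp
  qed
  have "sgn (tdet (\<lambda>k. if k \<in> S then z k else y k)) = sgn (tdet y)" if "finite S" for S
    using that
  proof (induction S)
    case (insert k S)
    let ?w = "\<lambda>k. if k \<in> S then z k else y k"
    have "(\<lambda>l. if l \<in> insert k S then z l else y l) = ?w(k := z k)" by auto
    then show ?case using step[of ?w "z k" k] y z insert by simp
  qed simp
  from this[of UNIV] show ?thesis by simp
qed

section \<open>Points in general position\<close>

text \<open>General position in any Euclidean space, since it is applied both to points and to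
  hyperplanes regarded as points of \<open>'a \<times> real\<close>.\<close>

definition affine_generic :: "'a::euclidean_space set \<Rightarrow> bool" where
  "affine_generic P \<longleftrightarrow> (\<forall>S\<subseteq>P. card S \<le> DIM('a) + 1 \<longrightarrow> \<not> affine_dependent S)"

lemma negligible_affine_hull:
  fixes S :: "'a::euclidean_space set"
  assumes "finite S" "card S \<le> DIM('a)"
  shows "negligible (affine hull S)"
proof -
  have "aff_dim S < int DIM('a)" using aff_dim_le_card[OF assms(1)] assms(2) by linarith
  then obtain a b where "a \<noteq> 0" "affine hull S \<subseteq> {x. a \<bullet> x = b}"
    using aff_lowdim_subset_hyperplane[of "affine hull S"] by auto
  then show ?thesis using negligible_hyperplane negligible_subset by blast
qed

text \<open>A new point only has to avoid the affine hulls of small sets of earlier points; these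
  are null sets and cannot cover a nonempty open set. The seed \<open>P0\<close> is empty for points
  and \<open>{0}\<close> for hyperplanes, where it turns affine into linear independence.\<close>

lemma generic_points:
  fixes U :: "'i \<Rightarrow> 'a::euclidean_space set"
  assumes "finite I" "\<And>i. i \<in> I \<Longrightarrow> open (U i)" "\<And>i. i \<in> I \<Longrightarrow> U i \<noteq> {}"
    and P0: "finite P0" "affine_generic P0"
  shows "\<exists>p. inj_on p I \<and> (\<forall>i\<in>I. p i \<in> U i) \<and> p ` I \<inter> P0 = {} \<and> affine_generic (P0 \<union> p ` I)"
  using assms(1-3)
proof (induction I)
  case empty then show ?case using P0 by auto
next
  case (insert j I)
  then obtain p where p: "inj_on p I" "\<forall>i\<in>I. p i \<in> U i" "p ` I \<inter> P0 = {}" "affine_generic (P0 \<union> p ` I)" by auto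
  let ?P = "P0 \<union> p ` I"
  let ?F = "{S. S \<subseteq> ?P \<and> card S \<le> DIM('a)}"
  have finP: "finite ?P" using P0 insert by auto
  have "negligible (\<Union>((\<lambda>S. affine hull S) ` ?F))"
  proof (rule negligible_Union)
    show "finite ((\<lambda>S. affine hull S) ` ?F)" using finP by auto
    show "negligible T" if "T \<in> (\<lambda>S. affine hull S) ` ?F" for T
      using that finP negligible_affine_hull by (auto intro: finite_subset)
  qed
  moreover have "\<not> negligible (U j)" using insert.prems open_not_negligible by blast
  ultimately have "\<not> U j \<subseteq> \<Union>((\<lambda>S. affine hull S) ` ?F)" by (metis negligible_subset)
  then obtain q where q: "q \<in> U j" "\<And>S. S \<subseteq> ?P \<Longrightarrow> card S \<le> DIM('a) \<Longrightarrow> q \<notin> affine hull S"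
    by auto
  have qP: "q \<notin> ?P"
  proof
    assume "q \<in> ?P"
    moreover have "1 \<le> DIM('a)" using DIM_positive by (metis less_eq_Suc_le One_nat_def)
    ultimately show False using q(2)[of "{q}"] by auto
  qed
  have gen: "affine_generic (insert q ?P)"
    unfolding affine_generic_def
  proof (intro allI impI)
    fix S assume S: "S \<subseteq> insert q ?P" "card S \<le> DIM('a) + 1"
    show "\<not> affine_dependent S"
    proof (cases "q \<in> S")
      case False then show ?thesis using S p(4) unfolding affine_generic_def by blast
    next
      case True
      define T where "T = S - {q}"
      have fS: "finite S" using S finP finite_subset by blast
      have T: "S = insert q T" "T \<subseteq> ?P" "card T \<le> DIM('a)" "q \<notin> T"
        using True S fS by (auto simp: T_def)
      have "\<not> affine_dependent T" using T p(4) unfolding affine_generic_def by auto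
      then show ?thesis using affine_dependent_choose[of T q] q(2)[OF T(2,3)] T(1) by simp
    qed
  qed
  let ?p = "p(j := q)"
  have im: "?p ` I = p ` I" using insert.hyps by auto
  have "inj_on ?p (insert j I)" using p(1) qP insert.hyps by (auto simp: inj_on_def)
  moreover have "\<forall>i\<in>insert j I. ?p i \<in> U i" using p(2) q insert.hyps by auto
  moreover have "?p ` insert j I \<inter> P0 = {}" using p(3) qP im by auto
  moreover have "P0 \<union> ?p ` insert j I = insert q ?P" using im by auto
  ultimately show ?case using gen by metis
qed

section \<open>Families with small same-type constant\<close>

lemma option_enum:
  assumes "card S = CARD('n::finite) + 1"
  shows "\<exists>J::'n option \<Rightarrow> 'b. inj J \<and> range J = S"
proof -
  have "finite S" using assms card.infinite by fastforce
  moreover have "CARD('n option) = card S" using assms by simp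
  ultimately obtain J where "bij_betw J (UNIV::'n option set) S"
    using finite_same_card_bij[of "UNIV::'n option set" S] by auto
  then show ?thesis unfolding bij_betw_def by blast
qed

lemma same_type_iff:
  fixes Y :: "nat \<Rightarrow> (real^'n::finite) set"
  shows "same_type m Y \<longleftrightarrow> (\<forall>J::'n option \<Rightarrow> nat. inj J \<and> range J \<subseteq> {..<m} \<longrightarrow>
     (\<forall>y z. (\<forall>k. y k \<in> Y (J k)) \<and> (\<forall>k. z k \<in> Y (J k)) \<longrightarrow> sgn (tdet y) = sgn (tdet z)))"
    (is "?L \<longleftrightarrow> ?R")
proof
  assume L: ?L
  show ?R
  proof (intro allI impI, elim conjE)
    fix J :: "'n option \<Rightarrow> nat" and y z
    assume J: "inj J" "range J \<subseteq> {..<m}" and yz: "\<forall>k. y k \<in> Y (J k)" "\<forall>k. z k \<in> Y (J k)"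
    have "orient (y None) (\<lambda>k. y (Some k)) = orient (z None) (\<lambda>k. z (Some k))"
    proof (rule L[unfolded same_type_def, rule_format, of "J None" "\<lambda>k. J (Some k)"])
      have "inj (\<lambda>k. J (Some k))" using J(1) unfolding inj_def by blast
      moreover have "J None \<notin> range (\<lambda>k. J (Some k))" using J(1) by (auto simp: inj_eq)
      ultimately show "J None < m \<and> (\<forall>k. J (Some k) < m) \<and> inj (\<lambda>k. J (Some k)) \<and> J None \<notin> range (\<lambda>k. J (Some k))"
        using J(2) by blast
    qed (use yz in blast)
    moreover have "case_option (w None) (\<lambda>k. w (Some k)) = w" for w :: "'n option \<Rightarrow> real^'n"
      by (auto split: option.split)
    ultimately show "sgn (tdet y) = sgn (tdet z)" by (simp add: orient_eq_sgn_tdet)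
  qed
next
  assume R: ?R
  show ?L unfolding same_type_def
  proof (intro allI impI, elim conjE)
    fix j0 and j :: "'n \<Rightarrow> nat" and y0 y z0 z
    assume "j0 < m" "\<forall>k. j k < m" "inj j" "j0 \<notin> range j" "y0 \<in> Y j0" "\<forall>k. y k \<in> Y (j k)"
      "z0 \<in> Y j0" "\<forall>k. z k \<in> Y (j k)"
    note a = this
    have inj: "inj (case_option j0 j)"
    proof (rule injI)
      fix k l assume "case_option j0 j k = case_option j0 j l"
      then show "k = l" using a(3,4) by (cases k; cases l) (auto simp: inj_eq)
    qed
    have ran: "range (case_option j0 j) \<subseteq> {..<m}"
      using a(1,2) by (auto split: option.split)
    have "\<forall>k. case_option y0 y k \<in> Y (case_option j0 j k)" "\<forall>k. case_option z0 z k \<in> Y (case_option j0 j k)"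
      using a(5-8) by (auto split: option.split)
    then show "orient y0 y = orient z0 z" unfolding orient_eq_sgn_tdet
      using R inj ran by blast
  qed
qed

lemma gen_pos_tdet_nz:
  fixes y :: "'n::finite option \<Rightarrow> real^'n"
  assumes "gen_pos P" "inj y" "range y \<subseteq> P"
  shows "tdet y \<noteq> 0"
proof
  assume "tdet y = 0"
  then obtain a b where ab: "a \<noteq> 0" "\<And>k. a \<bullet> y k + b = 0" unfolding tdet_eq_0_iff_hyperplane by blast
  have c: "card (range y) = CARD('n) + 1" using assms(2) by (simp add: card_image)
  then have "\<not> affine_dependent (range y)" using assms unfolding gen_pos_def by simp
  then have "aff_dim (range y) = int CARD('n)" using c unfolding affine_independent_iff_card by simp
  moreover have "aff_dim (range y) \<le> aff_dim {x. a \<bullet> x = -b}"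
    using ab(2) by (intro aff_dim_subset) (auto simp: add_eq_0_iff2)
  ultimately show False using ab(1) by (simp add: aff_dim_hyperplane)
qed

lemma same_type_hyperplane_crossings:
  fixes Y :: "nat \<Rightarrow> (real^'n::finite) set"
  assumes st: "same_type m Y" and gp: "gen_pos (\<Union>i<m. X i)"
    and sub: "\<And>i. i < m \<Longrightarrow> Y i \<subseteq> X i"
    and disj: "\<And>i j. i < m \<Longrightarrow> j < m \<Longrightarrow> i \<noteq> j \<Longrightarrow> X i \<inter> X j = {}"
    and a: "a \<noteq> 0"
  shows "card {i. i < m \<and> (\<exists>p\<in>Y i. \<exists>q\<in>Y i. a \<bullet> p \<le> b \<and> b \<le> a \<bullet> q)} \<le> CARD('n)" (is "card ?S \<le> _")
proof (rule ccontr)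
  assume "\<not> ?thesis"
  then have "CARD('n) + 1 \<le> card ?S" by linarith
  then obtain T where T: "T \<subseteq> ?S" "card T = CARD('n) + 1"
    by (rule obtain_subset_with_card_n)
  then obtain J :: "'n option \<Rightarrow> nat" where J: "inj J" "range J = T" using option_enum by metis
  have JS: "J k \<in> ?S" for k using J T by auto
  then have "\<forall>k. \<exists>p q. p \<in> Y (J k) \<and> q \<in> Y (J k) \<and> a \<bullet> p \<le> b \<and> b \<le> a \<bullet> q" by blast
  then obtain p q where pq: "\<And>k. p k \<in> Y (J k)" "\<And>k. q k \<in> Y (J k)" "\<And>k. a \<bullet> p k \<le> b" "\<And>k. b \<le> a \<bullet> q k"
    by metis
  have "\<exists>z. z \<in> closed_segment (p k) (q k) \<and> a \<bullet> z = b" for k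
  proof -
    have "connected (closed_segment (p k) (q k))" by simp
    from connected_ivt_hyperplane[OF this _ _ pq(3)[of k] pq(4)[of k]] show ?thesis by auto
  qed
  then obtain z where z: "\<And>k. z k \<in> convex hull {p k, q k}" "\<And>k. a \<bullet> z k = b"
    unfolding segment_convex_hull by metis
  have Jm: "J k < m" for k using JS[of k] by blast
  have nz: "tdet p \<noteq> 0"
  proof (rule gen_pos_tdet_nz[OF gp])
    show "range p \<subseteq> (\<Union>i<m. X i)" using pq(1) sub Jm by blast
    show "inj p"
    proof (rule injI)
      fix k l assume "p k = p l"
      then have "X (J k) \<inter> X (J l) \<noteq> {}" using pq(1)[of k] pq(1)[of l] sub[OF Jm[of k]] sub[OF Jm[of l]] by (metis IntI empty_iff subsetD)
      then have "J k = J l" using disj Jm by blast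
      then show "k = l" using J(1) by (simp add: inj_eq)
    qed
  qed
  \<comment> \<open>The points \<open>z\<close> lie on one hyperplane, so their determinant
    vanishes; but they lie in the hulls of the pairs \<open>{p k, q k}\<close> and so inherit the
    nonzero orientation of \<open>p\<close>.\<close>
  have "sgn (tdet z) = sgn (tdet p)"
  proof (rule sgn_tdet_convex_hull[OF _ z(1)])
    fix y assume "\<And>k. y k \<in> {p k, q k}"
    then have "\<forall>k. y k \<in> Y (J k)" using pq(1,2) by (metis insertE singletonD)
    then show "sgn (tdet y) = sgn (tdet p)"
      using st[unfolded same_type_iff, rule_format, of J y p] pq(1) J(1) Jm by blast
  qed
  moreover have "tdet z = 0" unfolding tdet_eq_0_iff_hyperplane
    using a z(2) by (intro exI[of _ a] exI[of _ "-b"]) simp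
  ultimately show False using nz by (simp add: sgn_zero_iff)
qed

section \<open>Generic points in the cells of a grid\<close>

lemma card_le_prod_card_image:
  fixes A :: "('n::finite \<Rightarrow> nat) set"
  assumes "finite A"
  shows "card A \<le> (\<Prod>j\<in>UNIV. card ((\<lambda>a. a j) ` A))"
proof -
  have "A \<subseteq> PiE UNIV (\<lambda>j. (\<lambda>a. a j) ` A)" by auto
  moreover have "finite (PiE UNIV (\<lambda>j. (\<lambda>a. a j) ` A))" using assms by (intro finite_PiE) auto
  ultimately have "card A \<le> card (PiE UNIV (\<lambda>j. (\<lambda>a. a j) ` A))" by (rule card_mono[rotated])
  then show ?thesis by (simp add: card_PiE)
qed

text \<open>The number \<open>t\<close> stands for the grid hyperplane between the layers
  \<open>t - 1\<close> and \<open>t\<close>, which is why only the left inequality is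
  strict.\<close>

definition gaps :: "nat set \<Rightarrow> nat set" where
  "gaps W = {t. \<exists>w\<in>W. \<exists>w'\<in>W. w < t \<and> t \<le> w'}"

text \<open>Every element of \<open>W\<close> except the smallest is itself a gap.\<close>

lemma card_le_gaps:
  assumes "finite W"
  shows "card W \<le> card (gaps W) + 1"
proof (cases "W = {}")
  case False
  have "W - {Min W} \<subseteq> gaps W"
  proof
    fix w assume w: "w \<in> W - {Min W}"
    then have "Min W < w" using Min_le[OF assms, of w] by (simp add: order_less_le)
    then show "w \<in> gaps W" using w Min_in[OF assms False] unfolding gaps_def by auto
  qed
  moreover have "finite (gaps W)"
    by (rule finite_subset[of _ "{..Max W}"]) (use assms in \<open>auto simp: gaps_def intro: order.trans[OF _ Max_ge]\<close>)
  ultimately have "card (W - {Min W}) \<le> card (gaps W)" by (intro card_mono)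
  then show ?thesis using assms False by (simp add: card_Diff_singleton)
qed auto

lemma grid_family_exists:
  fixes m N :: nat
  shows "\<exists>p :: nat \<Rightarrow> ('n::finite \<Rightarrow> nat) \<Rightarrow> real^'n.
    (\<forall>i<m. inj_on (p i) {a. \<forall>j. a j < N}) \<and>
    (\<forall>i<m. \<forall>a. (\<forall>j. a j < N) \<longrightarrow> (\<forall>j. real (a j) < p i a $ j \<and> p i a $ j < real (a j) + 1)) \<and>
    family_gen_pos m (\<lambda>i. p i ` {a. \<forall>j. a j < N})"
proof -
  let ?A = "{a::'n \<Rightarrow> nat. \<forall>j. a j < N}"
  let ?I = "{..<m} \<times> ?A"
  let ?U = "\<lambda>(i::nat, a::'n\<Rightarrow>nat). box (\<chi> j. real (a j)) (\<chi> j. real (a j) + 1) :: (real^'n) set"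
  have A: "?A = PiE UNIV (\<lambda>_. {..<N})" by auto
  have finA: "finite ?A" unfolding A by (intro finite_PiE) auto
  have "\<exists>q. inj_on q ?I \<and> (\<forall>x\<in>?I. q x \<in> ?U x) \<and> q ` ?I \<inter> {} = {} \<and> affine_generic ({} \<union> q ` ?I)"
  proof (rule generic_points)
    show "finite ?I" using finA by auto
    show "open (?U x)" for x by (auto split: prod.split)
    show "?U x \<noteq> {}" for x by (auto split: prod.split simp: box_eq_empty Basis_vec_def inner_axis)
    show "affine_generic ({}::(real^'n) set)" by (auto simp: affine_generic_def)
  qed auto
  then obtain q where q: "inj_on q ?I" "\<forall>x\<in>?I. q x \<in> ?U x" "affine_generic (q ` ?I)" by auto
  define p where "p = (\<lambda>i a. q (i, a))"
  have "\<forall>i<m. inj_on (p i) ?A" using q(1) unfolding p_def inj_on_def by auto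
  moreover have "\<forall>i<m. \<forall>a. (\<forall>j. a j < N) \<longrightarrow> (\<forall>j. real (a j) < p i a $ j \<and> p i a $ j < real (a j) + 1)"
    using q(2) unfolding p_def by (auto simp: mem_box_cart)
  moreover have "family_gen_pos m (\<lambda>i. p i ` ?A)"
    unfolding family_gen_pos_def
  proof (intro conjI allI impI)
    show "finite (p i ` ?A)" for i using finA by auto
    show "p i ` ?A \<inter> p j ` ?A = {}" if "i < m" "j < m" "i \<noteq> j" for i j
      using q(1) that unfolding p_def inj_on_def by blast
    have "(\<Union>i<m. p i ` ?A) = q ` ?I" unfolding p_def by auto
    then show "gen_pos (\<Union>i<m. p i ` ?A)" using q(3) unfolding gen_pos_def affine_generic_def by simp
  qed
  ultimately show ?thesis by blast
qed

lemma grid_family_bound: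
  fixes p :: "nat \<Rightarrow> ('n::finite \<Rightarrow> nat) \<Rightarrow> real^'n" and m N :: nat
  defines "A \<equiv> {a::'n \<Rightarrow> nat. \<forall>j. a j < N}"
  assumes inj: "\<And>i. i < m \<Longrightarrow> inj_on (p i) A"
    and cell: "\<And>i a j. i < m \<Longrightarrow> a \<in> A \<Longrightarrow> real (a j) < p i a $ j \<and> p i a $ j < real (a j) + 1"
    and fgp: "family_gen_pos m (\<lambda>i. p i ` A)"
    and N: "N \<ge> 1" and m: "m \<ge> 1"
    and Y: "\<And>i. i < m \<Longrightarrow> Y i \<subseteq> p i ` A" and st: "same_type m Y"
    and c: "\<And>i. i < m \<Longrightarrow> real (card (Y i)) \<ge> c * real (card (p i ` A))"
  shows "c \<le> (real CARD('n) / real m + 1 / real N) ^ CARD('n)"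
proof (cases "c > 0")
  case False
  moreover have "0 \<le> (real CARD('n) / real m + 1 / real N) ^ CARD('n)" by simp
  ultimately show ?thesis by linarith
next
  case True
  let ?d = "CARD('n)"
  have APi: "A = PiE UNIV (\<lambda>_. {..<N})" unfolding A_def by auto
  have finA: "finite A" unfolding APi by (intro finite_PiE) auto
  have cardA: "card A = N ^ ?d" unfolding APi by (simp add: card_PiE)
  define B where "B i = {a\<in>A. p i a \<in> Y i}" for i
  define L where "L i j = gaps ((\<lambda>a. a j) ` B i)" for i and j :: 'n
  have finB: "finite (B i)" for i using finA unfolding B_def by simp
  have YB: "card (Y i) = card (B i)" if "i < m" for i
  proof -
    have "Y i = p i ` B i" using Y[OF that] unfolding B_def by auto
    moreover have "inj_on (p i) (B i)" using inj[OF that] unfolding B_def by (auto intro: inj_on_subset)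
    ultimately show ?thesis by (simp add: card_image)
  qed
  have LN: "L i j \<subseteq> {1..N}" for i j
    unfolding L_def gaps_def B_def A_def by auto (meson le_trans less_imp_le)
  have cross: "card {i. i < m \<and> t \<in> L i j} \<le> ?d" for t j
  proof -
    \<comment> \<open>The test hyperplane is the grid hyperplane where coordinate \<open>j\<close>
      equals \<open>t\<close>.\<close>
    let ?S = "{i. i < m \<and> (\<exists>x\<in>Y i. \<exists>y\<in>Y i. axis j 1 \<bullet> x \<le> real t \<and> real t \<le> axis j 1 \<bullet> y)}"
    have "{i. i < m \<and> t \<in> L i j} \<subseteq> ?S"
    proof safe
      fix i assume i: "i < m" "t \<in> L i j"
      then obtain a a' where a: "a \<in> B i" "a' \<in> B i" "a j < t" "t \<le> a' j" unfolding L_def gaps_def by auto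
      have "p i a $ j < real (a j) + 1" "real (a' j) < p i a' $ j"
        using cell[OF i(1)] a unfolding B_def by auto
      then have "p i a $ j \<le> real t" "real t \<le> p i a' $ j" using a by linarith+
      then show "\<exists>x\<in>Y i. \<exists>y\<in>Y i. axis j 1 \<bullet> x \<le> real t \<and> real t \<le> axis j 1 \<bullet> y"
        using a(1,2) unfolding B_def by (auto simp: inner_axis inner_commute[of "axis j 1"])
    qed
    then have "card {i. i < m \<and> t \<in> L i j} \<le> card ?S" by (intro card_mono) auto
    also have "\<dots> \<le> ?d"
      using fgp by (intro same_type_hyperplane_crossings[OF st, of "\<lambda>i. p i ` A"] Y)
        (auto simp: family_gen_pos_def)
    finally show ?thesis .
  qed
  have sumL: "(\<Sum>i<m. card (L i j)) \<le> ?d * N" for j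
  proof -
    have "(\<Sum>i<m. card (L i j)) = (\<Sum>i<m. \<Sum>t\<in>{1..N}. if t \<in> L i j then 1 else 0)"
    proof (rule sum.cong[OF refl])
      fix i
      have "{1..N} \<inter> L i j = L i j" using LN by blast
      then show "card (L i j) = (\<Sum>t\<in>{1..N}. if t \<in> L i j then 1 else 0)"
        by (simp add: sum.If_cases)
    qed
    also have "\<dots> = (\<Sum>t\<in>{1..N}. \<Sum>i<m. if t \<in> L i j then 1 else 0)" by (rule sum.swap)
    also have "\<dots> = (\<Sum>t\<in>{1..N}. card {i. i < m \<and> t \<in> L i j})"
      by (intro sum.cong refl) (simp add: sum.If_cases Int_def conj_commute)
    also have "\<dots> \<le> (\<Sum>t\<in>{1..N}. ?d)" using cross by (intro sum_mono) auto
    finally show ?thesis by (simp add: mult.commute)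
  qed
  \<comment> \<open>In terms of the \<open>d\<close>-th root of \<open>c\<close> the inequality of
    arithmetic and geometric means is linear and can be summed over \<open>i\<close>.\<close>
  define g where "g = c powr (1 / real ?d)"
  have gpos: "g > 0" using True by (simp add: g_def)
  have gd: "g ^ ?d = c"
  proof -
    have "g ^ ?d = g powr real ?d" using gpos by (rule powr_realpow[symmetric])
    also have "\<dots> = c powr (1 / real ?d * real ?d)" unfolding g_def by (rule powr_powr)
    also have "\<dots> = c" using True by simp
    finally show ?thesis .
  qed
  have g0: "g \<ge> 0" unfolding g_def by simp
  have row: "g * real N * real ?d \<le> (\<Sum>j\<in>UNIV. real (card (L i j)) + 1)" if i: "i < m" for i
  proof -
    have "card (B i) \<le> (\<Prod>j\<in>UNIV. card (L i j) + 1)"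
    proof -
      have "card (B i) \<le> (\<Prod>j\<in>UNIV. card ((\<lambda>a. a j) ` B i))" by (rule card_le_prod_card_image[OF finB])
      also have "\<dots> \<le> (\<Prod>j\<in>UNIV. card (L i j) + 1)"
        unfolding L_def using finB by (intro prod_mono conjI card_le_gaps) auto
      finally show ?thesis .
    qed
    then have "real (card (B i)) \<le> real (\<Prod>j\<in>UNIV. card (L i j) + 1)" by linarith
    then have "c * real N ^ ?d \<le> (\<Prod>j\<in>UNIV. real (card (L i j)) + 1)"
      using c[OF i] YB[OF i] inj[OF i] cardA by (simp add: card_image add.commute)
    then have "(g * real N) ^ ?d \<le> (\<Prod>j\<in>UNIV. real (card (L i j)) + 1)" using gd by (simp add: power_mult_distrib)
    then have "((g * real N) ^ ?d) powr (1 / real ?d) \<le> (\<Prod>j\<in>UNIV. real (card (L i j)) + 1) powr (1 / real ?d)"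
      using g0 by (intro powr_mono2) auto
    also have "\<dots> \<le> (\<Sum>j\<in>UNIV. (real (card (L i j)) + 1) / real ?d)"
      by (rule arith_geom_mean) auto
    also have "\<dots> = (\<Sum>j\<in>UNIV. real (card (L i j)) + 1) / real ?d" by (simp add: sum_divide_distrib)
    also have "((g * real N) ^ ?d) powr (1 / real ?d) = g * real N"
    proof -
      have pos: "g * real N > 0" using gpos N by simp
      have "((g * real N) ^ ?d) powr (1 / real ?d) = ((g * real N) powr real ?d) powr (1 / real ?d)"
        using powr_realpow[OF pos, of ?d] by simp
      also have "\<dots> = (g * real N) powr (real ?d * (1 / real ?d))" by (rule powr_powr)
      also have "\<dots> = g * real N" using pos by simp
      finally show ?thesis .
    qed
    finally show ?thesis by (simp add: field_simps)
  qed
  have "real m * (g * real N * real ?d) \<le> (\<Sum>i<m. \<Sum>j\<in>(UNIV::'n set). real (card (L i j)) + 1)"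
    using sum_mono[of "{..<m}" "\<lambda>_. g * real N * real ?d" "\<lambda>i. \<Sum>j\<in>UNIV. real (card (L i j)) + 1"] row by simp
  also have "\<dots> = (\<Sum>j\<in>(UNIV::'n set). \<Sum>i<m. real (card (L i j)) + 1)" by (rule sum.swap)
  also have "\<dots> = (\<Sum>j\<in>(UNIV::'n set). real (\<Sum>i<m. card (L i j)) + real m)" by (simp add: sum.distrib)
  also have "\<dots> \<le> (\<Sum>j\<in>(UNIV::'n set). real (?d * N) + real m)"
    using sumL by (intro sum_mono add_mono of_nat_mono) auto
  finally have "real m * (g * real N * real ?d) \<le> real ?d * (real ?d * real N + real m)" by simp
  then have "real ?d * (g * (real m * real N)) \<le> real ?d * (real ?d * real N + real m)" by (simp add: algebra_simps)
  then have "g * (real m * real N) \<le> real ?d * real N + real m"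
    by (rule mult_left_le_imp_le) simp
  then have "g \<le> (real ?d * real N + real m) / (real m * real N)"
    using N m by (subst pos_le_divide_eq) auto
  also have "\<dots> = real ?d / real m + 1 / real N" using N m by (simp add: add_divide_distrib)
  finally have "g \<le> real ?d / real m + 1 / real N" .
  then have "g ^ ?d \<le> (real ?d / real m + 1 / real N) ^ ?d" using g0 by (intro power_mono)
  then show ?thesis using gd by simp
qed

section \<open>Simplices in hyperplane arrangements\<close>

text \<open>Strict on both sides, unlike \<open>touches\<close>: a hyperplane of \<open>R\<close>
  may support or contain a simplex inside a face of \<open>R\<close>, but never crosses it.\<close>

definition crosses :: "'a::real_inner \<times> real \<Rightarrow> 'a set \<Rightarrow> bool" where
  "crosses h V \<longleftrightarrow> (\<exists>v\<in>V. \<exists>w\<in>V. ev h v < 0 \<and> ev h w > 0)"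

definition side :: "'a::real_inner \<times> real \<Rightarrow> 'a \<Rightarrow> 'a set" where
  "side h x = {y. (ev h x = 0 \<longrightarrow> ev h y = 0) \<and> (ev h x > 0 \<longrightarrow> ev h y \<ge> 0) \<and> (ev h x < 0 \<longrightarrow> ev h y \<le> 0)}"

text \<open>The closed face of the arrangement \<open>R\<close> that has \<open>x\<close> in its relative interior.\<close>
definition face :: "('a::real_inner \<times> real) set \<Rightarrow> 'a \<Rightarrow> 'a set" where
  "face R x = (\<Inter>h\<in>R. side h x)"

definition zer :: "('a::real_inner \<times> real) set \<Rightarrow> 'a \<Rightarrow> ('a \<times> real) set" where
  "zer R x = {h\<in>R. ev h x = 0}"

text \<open>The simplex of \<open>x\<close> in the arrangement \<open>R\<close> is a variant of the bottom vertex triangulation, described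
  from the point of view of \<open>x\<close>: shoot a ray from the point of the face of \<open>x\<close> nearest to the origin through
  \<open>x\<close>, and continue in the same way with the point where the ray leaves the face. The vertices of the simplex
  are the starting points of the rays.\<close>
definition foot :: "('a::euclidean_space \<times> real) set \<Rightarrow> 'a \<Rightarrow> 'a" where
  "foot R x = closest_point (face R x) 0"

definition is_exit :: "('a::euclidean_space \<times> real) set \<Rightarrow> 'a \<Rightarrow> 'a \<Rightarrow> real \<Rightarrow> bool" where
  "is_exit R x v t \<longleftrightarrow> v + t *\<^sub>R (x - v) \<in> face R x \<and> (\<forall>s>t. v + s *\<^sub>R (x - v) \<notin> face R x)"

text \<open>A point that is its own foot defines no ray; keeping it makes the chain stationary, so
  that a fixed number of vertices can always be taken.\<close>

definition exit :: "('a::euclidean_space \<times> real) set \<Rightarrow> 'a \<Rightarrow> 'a" where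
  "exit R x = (if foot R x = x then x else foot R x + (THE t. is_exit R x (foot R x) t) *\<^sub>R (x - foot R x))"

definition pt :: "('a::euclidean_space \<times> real) set \<Rightarrow> 'a \<Rightarrow> nat \<Rightarrow> 'a" where
  "pt R x k = (exit R ^^ k) x"

definition vert :: "('a::euclidean_space \<times> real) set \<Rightarrow> 'a \<Rightarrow> nat \<Rightarrow> 'a" where
  "vert R x k = foot R (pt R x k)"

section \<open>Faces, feet and exit points\<close>

lemma ev_line: "ev h (v + t *\<^sub>R (x - v)) = ev h v + t * (ev h x - ev h v)"
  by (simp add: ev_def inner_add_right inner_diff_right algebra_simps)

lemma convex_closed_side: "convex (side h x)" "closed (side h x)"
proof -
  have *: "side h x = (if ev h x = 0 then {y. fst h \<bullet> y = - snd h} else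
     if ev h x > 0 then {y. fst h \<bullet> y \<ge> - snd h} else {y. fst h \<bullet> y \<le> - snd h})"
    unfolding side_def ev_def by auto
  show "convex (side h x)" unfolding * by (simp add: convex_hyperplane convex_halfspace_ge convex_halfspace_le)
  show "closed (side h x)" unfolding * by (simp add: closed_hyperplane closed_halfspace_ge closed_halfspace_le)
qed

lemma convex_face: "convex (face R x)" and closed_face: "closed (face R x)"
  unfolding face_def by (auto intro: convex_INT closed_INT convex_closed_side)

lemma self_in_face: "x \<in> face R x" unfolding face_def side_def by auto

lemma face_mono: "Q \<subseteq> R \<Longrightarrow> face R x \<subseteq> face Q x" unfolding face_def by auto

lemma side_subset:
  assumes "y \<in> side h x"
  shows "side h y \<subseteq> side h x"
proof
  fix z assume "z \<in> side h y"
  then show "z \<in> side h x" using assms unfolding side_def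
    by (cases "ev h y" "0::real" rule: linorder_cases) auto
qed

lemma face_subset: "y \<in> face R x \<Longrightarrow> face R y \<subseteq> face R x"
  unfolding face_def using side_subset by blast

lemma foot_in_face: "foot R x \<in> face R x"
  unfolding foot_def using self_in_face[of x R] by (intro closest_point_in_set closed_face) blast

lemma norm_foot_le: "y \<in> face R x \<Longrightarrow> norm (foot R x) \<le> norm y"
  unfolding foot_def using closest_point_le[OF closed_face, of y R x 0] by simp

lemma foot_eqI:
  assumes "v \<in> face R x" "\<And>y. y \<in> face R x \<Longrightarrow> norm v \<le> norm y"
  shows "foot R x = v"
  unfolding foot_def using assms closest_point_unique[OF convex_face closed_face, of v R x 0] by simp

text \<open>The open ball around the origin with the foot on its boundary and the sides have no
  common point, so by Helly at most \<open>d + 1\<close> of these convex sets have none. The ball is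
  among them, since all sides contain the foot; the at most \<open>d\<close> sides that remain
  already exclude points of smaller norm.\<close>

lemma foot_local:
  fixes R :: "('a::euclidean_space \<times> real) set"
  assumes "finite R"
  shows "\<exists>B\<subseteq>R. card B \<le> DIM('a) \<and> (\<forall>Q. B \<subseteq> Q \<longrightarrow> Q \<subseteq> R \<longrightarrow> foot Q x = foot R x)"
proof -
  define v where "v = foot R x"
  define U where "U = ball (0::'a) (norm v)"
  let ?f = "insert U ((\<lambda>h. side h x) ` R)"
  have fin: "finite ?f" using assms by simp
  have emp: "\<Inter>?f = {}"
  proof (rule ccontr)
    assume "\<Inter>?f \<noteq> {}"
    then obtain y where "y \<in> U" "y \<in> face R x" unfolding face_def by auto
    then show False using norm_foot_le[of y R x] unfolding U_def v_def by auto
  qed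
  have "\<exists>t\<subseteq>?f. card t \<le> DIM('a) + 1 \<and> \<Inter>t = {}"
  proof (cases "card ?f \<le> DIM('a) + 1")
    case True then show ?thesis using emp by blast
  next
    case False
    have conv: "\<forall>s\<in>?f. convex s" unfolding U_def using convex_closed_side by auto
    show ?thesis
    proof (rule ccontr)
      assume a: "\<not> ?thesis"
      have "\<Inter>?f \<noteq> {}"
      proof (rule Helly)
        show "DIM('a) + 1 \<le> card ?f" using False by linarith
        show "\<forall>s\<in>?f. convex s" by (rule conv)
        show "\<Inter>t \<noteq> {}" if "t \<subseteq> ?f" "card t = DIM('a) + 1" for t
          using a that by (metis order_refl)
      qed
      then show False using emp by blast
    qed
  qed
  then obtain t where t: "t \<subseteq> ?f" "card t \<le> DIM('a) + 1" "\<Inter>t = {}" by blast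
  have vin: "v \<in> face R x" unfolding v_def by (rule foot_in_face)
  have Ut: "U \<in> t"
  proof (rule ccontr)
    assume "U \<notin> t"
    then have "t \<subseteq> (\<lambda>h. side h x) ` R" using t(1) by blast
    then have "v \<in> \<Inter>t" using vin unfolding face_def by blast
    then show False using t(3) by blast
  qed
  have "t - {U} \<subseteq> (\<lambda>h. side h x) ` R" using t(1) by blast
  \<comment> \<open>Different hyperplanes may have the same side; \<open>B\<close> takes one
    hyperplane for each side that occurs.\<close>
  then obtain B where B: "B \<subseteq> R" "inj_on (\<lambda>h. side h x) B" "t - {U} = (\<lambda>h. side h x) ` B"
    unfolding subset_image_inj by blast
  have fint: "finite t" using t(1) fin finite_subset by blast
  have "card B = card (t - {U})" using B(2,3) by (simp add: card_image)
  also have "\<dots> \<le> DIM('a)" using Ut fint t(2) by (simp add: card_Diff_singleton)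
  finally have cB: "card B \<le> DIM('a)" .
  have tB: "\<Inter>t = U \<inter> face B x"
  proof -
    have "\<Inter>t = U \<inter> \<Inter>(t - {U})" using Ut by blast
    then show ?thesis unfolding B(3) face_def .
  qed
  have "foot Q x = foot R x" if Q: "B \<subseteq> Q" "Q \<subseteq> R" for Q
    unfolding v_def[symmetric]
  proof (rule foot_eqI)
    show "v \<in> face Q x" using vin face_mono[OF Q(2)] by blast
    fix y assume "y \<in> face Q x"
    then have "y \<in> face B x" using face_mono[OF Q(1)] by blast
    then have "y \<notin> U" using tB t(3) by blast
    then show "norm v \<le> norm y" unfolding U_def by simp
  qed
  then show ?thesis using B(1) cB by blast
qed

lemma is_exit_unique: "is_exit R x v t \<Longrightarrow> is_exit R x v s \<Longrightarrow> s = t"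
  unfolding is_exit_def by (cases s t rule: linorder_cases) auto

text \<open>The parameters for which the line stays in the face form a compact set; take the
  largest. If no hyperplane that misses \<open>x\<close> vanished there, all side conditions would
  persist slightly beyond it.\<close>

lemma is_exit_exists:
  fixes R :: "('a::euclidean_space \<times> real) set"
  assumes fin: "finite R" and bdd: "bounded (face R x)" and v: "v \<in> face R x" "v \<noteq> x"
  shows "\<exists>t h. is_exit R x v t \<and> 1 \<le> t \<and> h \<in> R \<and> ev h x \<noteq> 0 \<and> ev h (v + t *\<^sub>R (x - v)) = 0"
proof -
  let ?l = "\<lambda>t. v + t *\<^sub>R (x - v)"
  let ?K = "{t. ?l t \<in> face R x}"
  have cl: "closed ?K"
  proof -
    have "continuous_on UNIV ?l" by (intro continuous_intros)
    moreover have "?K = ?l -` face R x" by auto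
    ultimately show ?thesis using closed_face continuous_closed_vimage[of "face R x" ?l]
      by (metis continuous_on_eq_continuous_at open_UNIV UNIV_I)
  qed
  obtain M where M: "\<And>y. y \<in> face R x \<Longrightarrow> norm y \<le> M" using bdd unfolding bounded_iff by blast
  have "bounded ?K"
    unfolding bounded_iff
  proof (intro exI ballI)
    fix t assume "t \<in> ?K"
    then have "norm (t *\<^sub>R (x - v)) \<le> norm (?l t) + norm v"
      by (metis add_diff_cancel_left' norm_triangle_ineq4)
    also have "\<dots> \<le> M + M" using M \<open>t \<in> ?K\<close> v(1) by (intro add_mono) auto
    finally have "\<bar>t\<bar> * norm (x - v) \<le> M + M" by simp
    then show "norm t \<le> (M + M) / norm (x - v)" using v(2) by (simp add: pos_le_divide_eq)
  qed
  then have "compact ?K" using cl compact_eq_bounded_closed by blast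
  moreover have "1 \<in> ?K" using self_in_face[of x R] by simp
  ultimately obtain t where t: "t \<in> ?K" "\<And>s. s \<in> ?K \<Longrightarrow> s \<le> t"
    using compact_attains_sup[of ?K] by blast
  have ex: "is_exit R x v t" unfolding is_exit_def using t by fastforce
  have t1: "1 \<le> t" using t(2) \<open>1 \<in> ?K\<close> by blast
  have "\<exists>h\<in>R. ev h x \<noteq> 0 \<and> ev h (?l t) = 0"
  proof (rule ccontr)
    assume "\<not> ?thesis"
    then have nz: "ev h (?l t) \<noteq> 0" if "h \<in> R" "ev h x \<noteq> 0" for h using that by blast
    have "eventually (\<lambda>s. \<forall>h\<in>R. ?l s \<in> side h x) (at_right t)"
    proof (rule eventually_ball_finite[OF fin], intro ballI)
      fix h assume h: "h \<in> R"
      have vs: "v \<in> side h x" "?l t \<in> side h x" using v(1) t(1) h unfolding face_def by auto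
      show "eventually (\<lambda>s. ?l s \<in> side h x) (at_right t)"
      proof (cases "ev h x = 0")
        case True
        then have "ev h (?l s) = 0" for s using vs(1) unfolding ev_line side_def by simp
        then show ?thesis unfolding side_def using True by simp
      next
        case False
        have "isCont (\<lambda>s. ev h (?l s)) t" unfolding ev_line by (intro continuous_intros)
        then have lim: "((\<lambda>s. ev h (?l s)) \<longlongrightarrow> ev h (?l t)) (at_right t)"
          using filterlim_at_split isCont_def by blast
        show ?thesis
        proof (cases "ev h x > 0")
          case True
          then have "ev h (?l t) > 0" using vs(2) nz[OF h False] unfolding side_def by auto
          from order_tendstoD(1)[OF lim this] show ?thesis
            by (rule eventually_mono) (use True in \<open>auto simp: side_def\<close>)
        next
          case neg: False
          then have "ev h (?l t) < 0" using vs(2) nz[OF h False] False unfolding side_def by auto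
          from order_tendstoD(2)[OF lim this] show ?thesis
            by (rule eventually_mono) (use neg False in \<open>auto simp: side_def\<close>)
        qed
      qed
    qed
    then have "eventually (\<lambda>s. s \<in> ?K \<and> s > t) (at_right t)"
      unfolding face_def using eventually_at_right_less[of t] by (auto elim: eventually_elim2)
    then obtain s where "s \<in> ?K" "s > t" using eventually_happens'[of "at_right t"] by fastforce
    then show False using t(2) by fastforce
  qed
  then show ?thesis using ex t1 by blast
qed

lemma exit_props:
  fixes R :: "('a::euclidean_space \<times> real) set"
  assumes fin: "finite R" and bdd: "bounded (face R x)" and ne: "foot R x \<noteq> x"
  shows "\<exists>t h. exit R x = foot R x + t *\<^sub>R (x - foot R x) \<and> is_exit R x (foot R x) t \<and> 1 \<le> t \<and>
            h \<in> R \<and> ev h x \<noteq> 0 \<and> ev h (exit R x) = 0"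
proof -
  obtain t h where th: "is_exit R x (foot R x) t" "1 \<le> t" "h \<in> R" "ev h x \<noteq> 0"
      "ev h (foot R x + t *\<^sub>R (x - foot R x)) = 0"
    using is_exit_exists[OF fin bdd foot_in_face ne] by blast
  have "(THE t. is_exit R x (foot R x) t) = t" using th(1) is_exit_unique by (intro the_equality) auto
  then have "exit R x = foot R x + t *\<^sub>R (x - foot R x)" unfolding exit_def using ne by simp
  then show ?thesis using th by metis
qed

lemma exit_in_face:
  assumes "finite R" "bounded (face R x)"
  shows "exit R x \<in> face R x"
proof (cases "foot R x = x")
  case True then show ?thesis unfolding exit_def using self_in_face by simp
next
  case False
  then show ?thesis using exit_props[OF assms False] unfolding is_exit_def by metis
qed

lemma in_segment_exit:
  assumes "finite R" "bounded (face R x)"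
  shows "x \<in> closed_segment (foot R x) (exit R x)"
proof (cases "foot R x = x")
  case True then show ?thesis by (metis ends_in_segment(1))
next
  case False
  then obtain t where t: "exit R x = foot R x + t *\<^sub>R (x - foot R x)" "1 \<le> t" using exit_props[OF assms False] by blast
  have "x = (1 - 1/t) *\<^sub>R foot R x + (1/t) *\<^sub>R exit R x"
    unfolding t(1) using t(2) by (simp add: algebra_simps)
  then show ?thesis unfolding closed_segment_def using t(2) by (intro CollectI exI[of _ "1/t"]) auto
qed

text \<open>Hyperplanes through \<open>x\<close> contain its whole face, and the one that stops the
  ray is new. This strict growth bounds the length of the chain.\<close>

lemma zer_exit:
  assumes "finite R" "bounded (face R x)" "foot R x \<noteq> x"
  shows "zer R x \<subset> zer R (exit R x)"
proof -
  have "zer R x \<subseteq> zer R (exit R x)"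
    using exit_in_face[OF assms(1,2)] unfolding zer_def face_def side_def by blast
  moreover obtain h where "h \<in> R" "ev h x \<noteq> 0" "ev h (exit R x) = 0" using exit_props[OF assms] by blast
  ultimately show ?thesis unfolding zer_def by blast
qed

text \<open>Besides the at most \<open>d\<close> hyperplanes that fix the foot, one that stops the
  ray suffices. The other hyperplanes of \<open>Q\<close> belong to \<open>R\<close> and therefore
  stop it no earlier.\<close>

lemma exit_local:
  fixes R :: "('a::euclidean_space \<times> real) set"
  assumes fin: "finite R" and bdd: "bounded (face R x)"
  shows "\<exists>B\<subseteq>R. card B \<le> DIM('a) + 1 \<and>
    (\<forall>Q. B \<subseteq> Q \<longrightarrow> Q \<subseteq> R \<longrightarrow> foot Q x = foot R x \<and> exit Q x = exit R x)"
proof -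
  obtain B where B: "B \<subseteq> R" "card B \<le> DIM('a)" "\<And>Q. B \<subseteq> Q \<Longrightarrow> Q \<subseteq> R \<Longrightarrow> foot Q x = foot R x"
    using foot_local[OF fin] by metis
  show ?thesis
  proof (cases "foot R x = x")
    case True
    then have "foot Q x = foot R x \<and> exit Q x = exit R x" if "B \<subseteq> Q" "Q \<subseteq> R" for Q
      using B(3)[OF that] unfolding exit_def by simp
    then show ?thesis using B(1,2) by (meson le_add1 le_trans)
  next
    case False
    then obtain t h where th: "exit R x = foot R x + t *\<^sub>R (x - foot R x)" "is_exit R x (foot R x) t" "1 \<le> t"
            "h \<in> R" "ev h x \<noteq> 0" "ev h (exit R x) = 0" using exit_props[OF fin bdd False] by blast
    let ?v = "foot R x"
    \<comment> \<open>Along the ray \<open>ev h\<close> is affine in the parameter, with its zero at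
      \<open>t\<close> and a nonzero value at 1. So \<open>t > 1\<close>, and beyond
      \<open>t\<close> the sign is opposite to that at \<open>x\<close>.\<close>
    have out: "?v + s *\<^sub>R (x - ?v) \<notin> side h x" if "s > t" for s
    proof -
      let ?e = "\<lambda>s. ev h (?v + s *\<^sub>R (x - ?v))"
      have e: "ev h ?v + t * (ev h x - ev h ?v) = 0" using th(1,6) ev_line by metis
      have "t \<noteq> 1" using e th(5) by auto
      then have t1: "t > 1" using th(3) by simp
      have "?e s = (s - t) * (ev h x - ev h ?v)" unfolding ev_line using e by (simp add: algebra_simps)
      moreover have "ev h x = (1 - t) * (ev h x - ev h ?v)" using e by (simp add: algebra_simps)
      moreover from this have "ev h x - ev h ?v = ev h x / (1 - t)" using t1 by (simp add: eq_divide_eq mult.commute)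
      ultimately have "?e s = ((s - t) / (1 - t)) * ev h x" by simp
      moreover have "(s - t) / (1 - t) < 0" using that t1 by (simp add: divide_less_0_iff)
      ultimately obtain c where "c < 0" "?e s = c * ev h x" by blast
      then show ?thesis using th(5) unfolding side_def
        by (cases "ev h x" "0::real" rule: linorder_cases) (auto simp: mult_le_0_iff zero_le_mult_iff)
    qed
    have "foot Q x = foot R x \<and> exit Q x = exit R x" if Q: "insert h B \<subseteq> Q" "Q \<subseteq> R" for Q
    proof -
      have f: "foot Q x = ?v" using B(3) Q by blast
      have "is_exit Q x ?v t" unfolding is_exit_def
      proof (intro conjI allI impI)
        show "?v + t *\<^sub>R (x - ?v) \<in> face Q x" using th(2) face_mono[OF Q(2)] unfolding is_exit_def by blast
        show "?v + s *\<^sub>R (x - ?v) \<notin> face Q x" if "s > t" for s using out[OF that] Q(1) unfolding face_def by blast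
      qed
      then have "(THE t. is_exit Q x ?v t) = t" using is_exit_unique by (intro the_equality) auto
      then show ?thesis using f False th(1) unfolding exit_def[of Q] by simp
    qed
    moreover have "card (insert h B) \<le> DIM('a) + 1" using B(2) by (simp add: card_insert_le_m1 le_SucI card_insert_if finite_subset[OF B(1) fin])
    ultimately show ?thesis using B(1) th(4) by (metis insert_subset)
  qed
qed

section \<open>Chains of exit points and their simplices\<close>

lemma pt_0 [simp]: "pt R x 0 = x" and pt_Suc: "pt R x (Suc k) = exit R (pt R x k)"
  by (simp_all add: pt_def)

lemma pt_in_face:
  assumes "finite R" "bounded (face R x)"
  shows "pt R x k \<in> face R x \<and> bounded (face R (pt R x k))"
proof (induction k)
  case 0 then show ?case using assms self_in_face by simp
next
  case (Suc k)
  then have "exit R (pt R x k) \<in> face R (pt R x k)" using exit_in_face assms(1) by blast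
  then have *: "pt R x (Suc k) \<in> face R x" using face_subset Suc pt_Suc by (metis subsetD)
  then show ?case using bounded_subset[OF assms(2) face_subset[OF *]] by simp
qed

lemma pt_in_face_le:
  assumes "finite R" "bounded (face R x)" "k \<le> l"
  shows "pt R x l \<in> face R (pt R x k)"
proof -
  have "pt R x (k + n) = pt R (pt R x k) n" for n
    unfolding pt_def by (metis add.commute comp_apply funpow_add)
  then show ?thesis using pt_in_face[OF assms(1)] pt_in_face[OF assms(1,2)] assms(3)
    by (metis le_add_diff_inverse)
qed

lemma vert_in_face:
  assumes "finite R" "bounded (face R x)"
  shows "vert R x k \<in> face R x"
  unfolding vert_def using pt_in_face[OF assms] by (intro subsetD[OF face_subset foot_in_face]) simp

text \<open>Each nontrivial step gains a hyperplane through the current point; \<open>d + 1\<close>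
  such steps would make more than \<open>d\<close> hyperplanes meet.\<close>

lemma foot_pt_DIM:
  fixes R :: "('a::euclidean_space \<times> real) set"
  assumes fin: "finite R" and bdd: "bounded (face R x)" and gp: "\<And>y. card (zer R y) \<le> DIM('a)"
  shows "foot R (pt R x DIM('a)) = pt R x DIM('a)"
proof (rule ccontr)
  assume ne: "\<not> ?thesis"
  have stay: "pt R x (k + n) = pt R x k" if "foot R (pt R x k) = pt R x k" for k n
  proof (induction n)
    case (Suc n) then show ?case using that by (simp add: pt_Suc exit_def)
  qed simp
  have nek: "foot R (pt R x k) \<noteq> pt R x k" if "k \<le> DIM('a)" for k
    using stay[of k "DIM('a) - k"] ne that by auto
  have "k \<le> card (zer R (pt R x k))" if "k \<le> DIM('a) + 1" for k
    using that
  proof (induction k)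
    case (Suc k)
    have "zer R (pt R x k) \<subset> zer R (pt R x (Suc k))"
      unfolding pt_Suc using Suc.prems by (intro zer_exit fin nek) (use pt_in_face[OF fin bdd] in auto)
    moreover have "finite (zer R (pt R x (Suc k)))" using fin unfolding zer_def by simp
    ultimately have "card (zer R (pt R x k)) < card (zer R (pt R x (Suc k)))" by (rule psubset_card_mono[rotated])
    then show ?case using Suc by simp
  qed simp
  from this[of "DIM('a) + 1"] gp[of "pt R x (DIM('a) + 1)"] show False by simp
qed

text \<open>Go backwards along the chain: the last point is its own vertex, and every earlier point
  lies between its foot and the next point.\<close>

lemma in_hull_vert:
  fixes R :: "('a::euclidean_space \<times> real) set"
  assumes fin: "finite R" and bdd: "bounded (face R x)" and gp: "\<And>y. card (zer R y) \<le> DIM('a)"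
  shows "x \<in> convex hull (vert R x ` {..DIM('a)})"
proof -
  let ?C = "convex hull (vert R x ` {..DIM('a)})"
  have "pt R x (DIM('a) - n) \<in> ?C" if "n \<le> DIM('a)" for n
    using that
  proof (induction n)
    case 0
    have "vert R x DIM('a) \<in> ?C" by (rule hull_inc) auto
    then show ?case unfolding vert_def using foot_pt_DIM[OF assms] by simp
  next
    case (Suc n)
    define k where "k = DIM('a) - Suc n"
    have k: "DIM('a) - n = Suc k" "k \<le> DIM('a)" using Suc.prems unfolding k_def by auto
    have "vert R x k \<in> ?C" by (rule hull_inc) (use k in auto)
    moreover have "exit R (pt R x k) \<in> ?C" using Suc k by (simp add: pt_Suc)
    ultimately have "closed_segment (vert R x k) (exit R (pt R x k)) \<subseteq> ?C"
      by (intro closed_segment_subset convex_convex_hull)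
    moreover have "pt R x k \<in> closed_segment (vert R x k) (exit R (pt R x k))"
      unfolding vert_def using in_segment_exit[OF fin] pt_in_face[OF fin bdd] by blast
    ultimately show ?case unfolding k_def by blast
  qed
  from this[of "DIM('a)"] show ?thesis by simp
qed

lemma not_crosses_vert:
  assumes "finite R" "bounded (face R x)" "h \<in> R"
  shows "\<not> crosses h (vert R x ` S)"
proof -
  have s: "vert R x k \<in> side h x" for k using vert_in_face[OF assms(1,2), of k] assms(3) unfolding face_def by blast
  show ?thesis
  proof
    assume "crosses h (vert R x ` S)"
    then obtain k l where kl: "ev h (vert R x k) < 0" "ev h (vert R x l) > 0" unfolding crosses_def by auto
    then show False using s[of k] s[of l] unfolding side_def
      by (cases "ev h x" "0::real" rule: linorder_cases) auto
  qed
qed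

text \<open>There are \<open>d + 1\<close> levels, each decided by at most \<open>d + 1\<close>
  hyperplanes. This count of defining hyperplanes is the constant of the backward analysis.\<close>

lemma vert_local:
  fixes R :: "('a::euclidean_space \<times> real) set"
  assumes fin: "finite R" and bdd: "bounded (face R x)"
  shows "\<exists>B\<subseteq>R. card B \<le> (DIM('a) + 1)\<^sup>2 \<and> (\<forall>Q. B \<subseteq> Q \<longrightarrow> Q \<subseteq> R \<longrightarrow> (\<forall>k\<le>DIM('a). vert Q x k = vert R x k))"
proof -
  have "\<forall>k. \<exists>B\<subseteq>R. card B \<le> DIM('a) + 1 \<and>
    (\<forall>Q. B \<subseteq> Q \<longrightarrow> Q \<subseteq> R \<longrightarrow> foot Q (pt R x k) = foot R (pt R x k) \<and> exit Q (pt R x k) = exit R (pt R x k))"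
    using exit_local[OF fin] pt_in_face[OF fin bdd] by blast
  then obtain B where B: "\<And>k. B k \<subseteq> R" "\<And>k. card (B k) \<le> DIM('a) + 1"
    "\<And>k Q. B k \<subseteq> Q \<Longrightarrow> Q \<subseteq> R \<Longrightarrow> foot Q (pt R x k) = foot R (pt R x k)"
    "\<And>k Q. B k \<subseteq> Q \<Longrightarrow> Q \<subseteq> R \<Longrightarrow> exit Q (pt R x k) = exit R (pt R x k)" by metis
  let ?B = "\<Union>k\<le>DIM('a). B k"
  have "card ?B \<le> (\<Sum>k\<le>DIM('a). card (B k))" by (rule card_UN_le) auto
  also have "\<dots> \<le> (\<Sum>k\<le>DIM('a). DIM('a) + 1)" using B(2) by (rule sum_mono)
  also have "\<dots> = (DIM('a) + 1)\<^sup>2" by (simp add: power2_eq_square)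
  finally have c: "card ?B \<le> (DIM('a) + 1)\<^sup>2" .
  have "vert Q x k = vert R x k" if Q: "?B \<subseteq> Q" "Q \<subseteq> R" and k: "k \<le> DIM('a)" for Q k
  proof -
    have "pt Q x k = pt R x k" using k
    proof (induction k)
      case (Suc k)
      then have "k \<in> {..DIM('a)}" by simp
      then have "B k \<subseteq> Q" using Q(1) by blast
      then show ?case using Suc B(4)[of k Q] Q(2) by (simp add: pt_Suc)
    qed simp
    moreover have "B k \<subseteq> Q" using Q(1) k by auto
    ultimately show ?thesis unfolding vert_def using B(3)[of k Q] Q(2) by simp
  qed
  moreover have "?B \<subseteq> R" using B(1) by blast
  ultimately show ?thesis using c by metis
qed

section \<open>Random sampling of hyperplanes\<close>

lemma card_subsets_bounded:
  assumes "finite R"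
  shows "card {Z. Z \<subseteq> R \<and> card Z \<le> n} \<le> (card R + 1) ^ n"
proof (induction n)
  case 0
  have "{Z. Z \<subseteq> R \<and> card Z \<le> 0} = {{}}" using assms by (auto dest: finite_subset)
  then show ?case by simp
next
  case (Suc n)
  let ?S = "\<lambda>n. {Z. Z \<subseteq> R \<and> card Z \<le> n}"
  \<comment> \<open>\<open>None\<close> is there for the empty set; all other sets arise from a
    smaller one by an insertion.\<close>
  let ?f = "\<lambda>(z, Z). case z of None \<Rightarrow> Z | Some h \<Rightarrow> insert h Z"
  let ?D = "insert None (Some ` R) \<times> ?S n"
  have "?S (Suc n) \<subseteq> ?f ` ?D"
  proof
    fix Z assume Z: "Z \<in> ?S (Suc n)"
    show "Z \<in> ?f ` ?D"
    proof (cases "Z = {}")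
      case True
      then show ?thesis by (intro image_eqI[of _ _ "(None, {})"]) auto
    next
      case False
      then obtain h where h: "h \<in> Z" by blast
      moreover have "finite Z" using Z assms finite_subset by blast
      ultimately show ?thesis using Z
        by (intro image_eqI[of _ _ "(Some h, Z - {h})"]) (auto simp: card_Diff_singleton)
    qed
  qed
  moreover have fin: "finite ?D" using assms by auto
  ultimately have "card (?S (Suc n)) \<le> card ?D"
    by (meson card_image_le card_mono finite_imageI le_trans)
  also have "\<dots> = (card R + 1) * card (?S n)"
    using assms by (simp add: card_cartesian_product card_image)
  also have "\<dots> \<le> (card R + 1) * (card R + 1) ^ n" using Suc by (intro mult_left_mono) auto
  finally show ?case by simp
qed

lemma card_image_le_if_determines:
  assumes "finite X" "\<And>x y. x \<in> X \<Longrightarrow> y \<in> X \<Longrightarrow> g x = g y \<Longrightarrow> f x = f y"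
  shows "card (f ` X) \<le> card (g ` X)"
proof -
  have "f ` X \<subseteq> (\<lambda>c. f (SOME x. x \<in> X \<and> g x = c)) ` g ` X"
  proof
    fix z assume "z \<in> f ` X"
    then obtain x where x: "x \<in> X" "z = f x" by blast
    let ?y = "SOME y. y \<in> X \<and> g y = g x"
    have "?y \<in> X \<and> g ?y = g x" by (rule someI[of _ x]) (use x in auto)
    then have "z = f ?y" using assms(2) x by metis
    then show "z \<in> (\<lambda>c. f (SOME x. x \<in> X \<and> g x = c)) ` g ` X" using x(1) by blast
  qed
  then have "card (f ` X) \<le> card ((\<lambda>c. f (SOME x. x \<in> X \<and> g x = c)) ` g ` X)"
    using assms(1) by (intro card_mono) auto
  also have "\<dots> \<le> card (g ` X)" using assms(1) by (intro card_image_le) auto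
  finally show ?thesis .
qed

text \<open>From \<open>p\<close> one can move a little both ways along \<open>q - p\<close> inside
  the face: the hyperplanes through \<open>p\<close> contain the whole line, and the others are not
  reached. As \<open>p\<close> is nearest to the origin, the inner product can have neither
  sign.\<close>

lemma inner_zero_if_foot_self:
  fixes R :: "('a::euclidean_space \<times> real) set"
  assumes fin: "finite R" and f: "foot R p = p" and w: "\<And>h. h \<in> zer R p \<Longrightarrow> ev h q = 0"
  shows "p \<bullet> (q - p) = 0"
proof -
  let ?l = "\<lambda>t. p + t *\<^sub>R (q - p)"
  have "eventually (\<lambda>t. \<forall>h\<in>R. ?l t \<in> side h p) (nhds 0)"
  proof (rule eventually_ball_finite[OF fin], intro ballI)
    fix h assume h: "h \<in> R"
    show "eventually (\<lambda>t. ?l t \<in> side h p) (nhds 0)"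
    proof (cases "ev h p = 0")
      case True
      then have "ev h (?l t) = 0" for t using w[of h] h unfolding ev_line zer_def by simp
      then show ?thesis unfolding side_def using True by simp
    next
      case False
      have "isCont (\<lambda>t. ev h (?l t)) 0" unfolding ev_line by (intro continuous_intros)
      then have lim: "((\<lambda>t. ev h (?l t)) \<longlongrightarrow> ev h p) (nhds 0)"
        using tendsto_at_iff_tendsto_nhds[of "\<lambda>t. ev h (?l t)" 0] unfolding isCont_def by simp
      show ?thesis
      proof (cases "ev h p > 0")
        case True
        from order_tendstoD(1)[OF lim this] show ?thesis
          by (rule eventually_mono) (use True in \<open>auto simp: side_def\<close>)
      next
        case neg: False
        then have "ev h p < 0" using False by simp
        from order_tendstoD(2)[OF lim this] show ?thesis
          by (rule eventually_mono) (use neg False in \<open>auto simp: side_def\<close>)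
      qed
    qed
  qed
  then obtain e where e: "e > 0" "\<And>t. dist t 0 < e \<Longrightarrow> ?l t \<in> face R p"
    unfolding eventually_nhds_metric face_def by blast
  have le: "- p \<bullet> (?l t - p) \<le> 0" if "\<bar>t\<bar> < e" for t
    using closest_point_dot[OF convex_face closed_face e(2), of t 0] that f unfolding foot_def by simp
  have "(e/2) * (p \<bullet> (q - p)) \<ge> 0" "(-e/2) * (p \<bullet> (q - p)) \<ge> 0"
    using le[of "e/2"] le[of "-e/2"] e(1) by simp_all
  then show ?thesis using e(1) by (simp add: zero_le_mult_iff mult_le_0_iff)
qed

text \<open>A simplex is determined by its last vertex, where at most \<open>DIM('a)\<close> hyperplanes meet, and by the
  sides of these hyperplanes on which the points of the chain lie.\<close>
lemma card_vert_le:
  fixes R :: "('a::euclidean_space \<times> real) set"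
  assumes fin: "finite R" and gp: "\<And>y. card (zer R y) \<le> DIM('a)"
    and X: "finite X" and bdd: "\<And>x. x \<in> X \<Longrightarrow> bounded (face R x)"
  shows "card ((\<lambda>x. restrict (vert R x) {..DIM('a)}) ` X) \<le> (card R + 1) ^ DIM('a) * 3 ^ (DIM('a) * (DIM('a) + 1))"
proof -
  let ?d = "DIM('a)"
  define Z where "Z x = zer R (pt R x ?d)" for x
  define g where "g x = (Z x, restrict (\<lambda>k. restrict (\<lambda>h. sgn (ev h (pt R x k))) (Z x)) {..?d})" for x
  have det: "restrict (vert R x) {..?d} = restrict (vert R y) {..?d}"
    if xy: "x \<in> X" "y \<in> X" and eq: "g x = g y" for x y
  proof -
    let ?p = "pt R x ?d" and ?q = "pt R y ?d"
    have Zeq: "Z x = Z y" using eq unfolding g_def by simp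
    have sg: "sgn (ev h (pt R x k)) = sgn (ev h (pt R y k))" if "k \<le> ?d" "h \<in> Z x" for h k
    proof -
      have "restrict (\<lambda>k. restrict (\<lambda>h. sgn (ev h (pt R x k))) (Z x)) {..?d} k h
          = restrict (\<lambda>k. restrict (\<lambda>h. sgn (ev h (pt R y k))) (Z y)) {..?d} k h"
        using eq unfolding g_def by (metis snd_conv)
      then show ?thesis using that Zeq by simp
    qed
    have zq: "ev h ?q = 0" if "h \<in> zer R ?p" for h using that Zeq unfolding Z_def by (auto simp: zer_def)
    have zp: "ev h ?p = 0" if "h \<in> zer R ?q" for h using that Zeq unfolding Z_def by (auto simp: zer_def)
    \<comment> \<open>Both last points are their own feet and lie on the same hyperplanes;
      orthogonality in both directions forces them to coincide.\<close>
    have "?p \<bullet> (?q - ?p) = 0"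
      by (rule inner_zero_if_foot_self[OF fin foot_pt_DIM[OF fin bdd[OF xy(1)] gp] zq])
    moreover have "?q \<bullet> (?p - ?q) = 0"
      by (rule inner_zero_if_foot_self[OF fin foot_pt_DIM[OF fin bdd[OF xy(2)] gp] zp])
    ultimately have "(?q - ?p) \<bullet> (?q - ?p) = 0" by (simp add: inner_diff_left inner_diff_right)
    then have pq: "?p = ?q" by simp
    \<comment> \<open>Hyperplanes that miss the last point need no recorded sign: the whole chain
      lies strictly on the same side of them as that point.\<close>
    have far: "sgn (ev h (pt R z k)) = sgn (ev h (pt R z ?d))" if "z \<in> X" "k \<le> ?d" "h \<in> R" "h \<notin> Z z" for z k h
    proof -
      have "pt R z ?d \<in> side h (pt R z k)"
        using pt_in_face_le[OF fin bdd[OF that(1)] that(2)] that(3) unfolding face_def by blast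
      moreover have "ev h (pt R z ?d) \<noteq> 0" using that(3,4) unfolding Z_def zer_def by blast
      ultimately show ?thesis unfolding side_def
        by (cases "ev h (pt R z k)" "0::real" rule: linorder_cases) auto
    qed
    have all: "sgn (ev h (pt R x k)) = sgn (ev h (pt R y k))" if "k \<le> ?d" "h \<in> R" for k h
      using sg[OF that(1)] far[OF xy(1) that] far[OF xy(2) that] pq Zeq by (cases "h \<in> Z x") auto
    have "face R (pt R x k) = face R (pt R y k)" if "k \<le> ?d" for k
    proof -
      have "side h (pt R x k) = side h (pt R y k)" if "h \<in> R" for h
        using all[OF \<open>k \<le> ?d\<close> that] unfolding side_def
        by (cases "ev h (pt R x k)" "0::real" rule: linorder_cases;
            cases "ev h (pt R y k)" "0::real" rule: linorder_cases) auto
      then show ?thesis unfolding face_def by simp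
    qed
    then show ?thesis unfolding vert_def foot_def by (auto simp: restrict_def)
  qed
  let ?S = "{Z. Z \<subseteq> R \<and> card Z \<le> ?d}"
  \<comment> \<open>One of three signs for each of at most \<open>d\<close> hyperplanes, at each of
    \<open>d + 1\<close> levels.\<close>
  let ?P = "\<lambda>Z. PiE {..?d} (\<lambda>_. PiE Z (\<lambda>_. {-1, 0, 1::real}))"
  have finS: "finite ?S" using fin by simp
  have finZ: "finite Z" if "Z \<in> ?S" for Z using that fin finite_subset by blast
  have finP: "finite (?P Z)" if "Z \<in> ?S" for Z using finZ[OF that] by (intro finite_PiE) auto
  have "g ` X \<subseteq> Sigma ?S ?P"
  proof
    fix c assume "c \<in> g ` X"
    then obtain x where x: "c = g x" by blast
    have "Z x \<in> ?S" unfolding Z_def using gp by (auto simp: zer_def)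
    moreover have "sgn (ev h p) \<in> {-1, 0, 1::real}" for h and p :: 'a by (simp add: sgn_real_def)
    ultimately show "c \<in> Sigma ?S ?P" unfolding x g_def by (auto simp: PiE_iff)
  qed
  then have "card (g ` X) \<le> card (Sigma ?S ?P)" using finS finP by (intro card_mono) auto
  also have "\<dots> = (\<Sum>Z\<in>?S. card (?P Z))" using finS finP by (simp add: card_SigmaI)
  also have "\<dots> \<le> (\<Sum>Z\<in>?S. 3 ^ (?d * (?d + 1)))"
  proof (rule sum_mono)
    fix Z assume Z: "Z \<in> ?S"
    have "card (?P Z) = (3 ^ card Z) ^ (?d + 1)"
      using finZ[OF Z] by (simp add: card_PiE numeral_3_eq_3)
    also have "\<dots> \<le> (3 ^ ?d) ^ (?d + 1)" using Z by (intro power_mono power_increasing) auto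
    also have "\<dots> = 3 ^ (?d * (?d + 1))" by (rule power_mult[symmetric])
    finally show "card (?P Z) \<le> 3 ^ (?d * (?d + 1))" .
  qed
  also have "\<dots> = card ?S * 3 ^ (?d * (?d + 1))" by simp
  also have "\<dots> \<le> (card R + 1) ^ ?d * 3 ^ (?d * (?d + 1))"
    by (intro mult_right_mono card_subsets_bounded fin) simp
  finally have "card (g ` X) \<le> (card R + 1) ^ ?d * 3 ^ (?d * (?d + 1))" .
  moreover have "card ((\<lambda>x. restrict (vert R x) {..?d}) ` X) \<le> card (g ` X)"
    by (rule card_image_le_if_determines[OF X]) (rule det)
  ultimately show ?thesis by (rule le_trans[rotated])
qed

section \<open>Averaging and sampling\<close>

lemma card_filter_eq_sum: "finite A \<Longrightarrow> card {x\<in>A. P x} = (\<Sum>x\<in>A. of_bool (P x))"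
  by (simp add: of_bool_def sum.If_cases Int_def conj_commute)

lemma exists_le_average:
  fixes f :: "'b \<Rightarrow> nat"
  assumes "finite A" "A \<noteq> {}" "(\<Sum>x\<in>A. f x) \<le> b"
  shows "\<exists>x\<in>A. card A * f x \<le> b"
proof (rule ccontr)
  assume "\<not> ?thesis"
  then have "(\<Sum>x\<in>A. b) < (\<Sum>x\<in>A. card A * f x)" using assms by (intro sum_strict_mono) auto
  also have "\<dots> \<le> card A * b" using assms(3) by (simp add: sum_distrib_left[symmetric])
  finally show False by simp
qed

lemma exists_large_fibre:
  assumes "finite A" "card (f ` A) \<le> C" "A \<noteq> {}"
  shows "\<exists>x\<in>A. card A \<le> C * card {y\<in>A. f y = f x}"
proof (rule ccontr)
  assume "\<not> ?thesis"
  then have lt: "C * card {y\<in>A. f y = c} < card A" if "c \<in> f ` A" for c using that by force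
  have "(\<Sum>c\<in>f ` A. \<Sum>y\<in>{y\<in>A. f y = c}. 1) = (\<Sum>y\<in>A. 1::nat)"
    using assms(1) by (intro sum.group) auto
  then have "card A = (\<Sum>c\<in>f ` A. card {y\<in>A. f y = c})" by simp
  then have "C * card A = (\<Sum>c\<in>f ` A. C * card {y\<in>A. f y = c})" by (simp add: sum_distrib_left)
  also have "\<dots> < (\<Sum>c\<in>f ` A. card A)" using assms lt by (intro sum_strict_mono) auto
  also have "\<dots> \<le> C * card A" using assms(2) by simp
  finally show False by simp
qed

text \<open>The inequality of Markov for a mean of at most \<open>b / n\<close>, cleared of
  denominators.\<close>

lemma markov_half:
  fixes f :: "'b \<Rightarrow> nat"
  assumes "finite A" "n * (\<Sum>x\<in>A. f x) \<le> b * card A" "b > 0"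
  shows "card A \<le> 2 * card {x\<in>A. n * f x \<le> 2 * b}"
proof -
  let ?B = "{x\<in>A. \<not> n * f x \<le> 2 * b}"
  have "2 * b * card ?B = (\<Sum>x\<in>?B. 2 * b)" by simp
  also have "\<dots> \<le> (\<Sum>x\<in>?B. n * f x)" by (intro sum_mono) auto
  also have "\<dots> \<le> (\<Sum>x\<in>A. n * f x)" using assms(1) by (intro sum_mono2) auto
  also have "\<dots> \<le> b * card A" using assms(2) by (simp add: sum_distrib_left)
  finally have "2 * card ?B \<le> card A" using assms(3) by (simp add: mult.assoc mult.left_commute[of 2])
  moreover have "card A = card {x\<in>A. n * f x \<le> 2 * b} + card ?B"
    using assms(1) by (subst card_Un_disjoint[symmetric]) (auto intro: arg_cong[where f=card])
  ultimately show ?thesis by linarith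
qed

text \<open>Backward analysis: among \<open>r + 1\<close> sampled hyperplanes, only those that are needed to define the
  simplex of \<open>x\<close> can cross the simplex of \<open>x\<close> that is defined by the others.\<close>
lemma card_crossing_others_le:
  fixes G :: "('a::euclidean_space \<times> real) set" and h :: "nat \<Rightarrow> 'a \<times> real"
  assumes G: "finite G" and I: "finite I" and bdd: "bounded (face G x)"
  shows "card {i\<in>I. crosses (h i) (vert (G \<union> h ` (I - {i})) x ` {..DIM('a)})} \<le> (DIM('a) + 1)\<^sup>2"
    (is "card ?E \<le> _")
proof -
  let ?R = "G \<union> h ` I"
  have fin: "finite ?R" using G I by simp
  have bR: "bounded (face ?R x)" by (rule bounded_subset[OF bdd face_mono]) simp
  obtain B where B: "B \<subseteq> ?R" "card B \<le> (DIM('a) + 1)\<^sup>2"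
    "\<And>Q k. B \<subseteq> Q \<Longrightarrow> Q \<subseteq> ?R \<Longrightarrow> k \<le> DIM('a) \<Longrightarrow> vert Q x k = vert ?R x k"
    using vert_local[OF fin bR] by metis
  have notE: "i \<notin> ?E" if i: "i \<in> I" and sub: "B \<subseteq> G \<union> h ` (I - {i})" for i
  proof -
    have "vert (G \<union> h ` (I - {i})) x ` {..DIM('a)} = vert ?R x ` {..DIM('a)}"
      by (rule image_cong[OF refl]) (use B(3)[OF sub] in auto)
    then show ?thesis using not_crosses_vert[OF fin bR, of "h i"] i by auto
  qed
  have "h ` ?E \<subseteq> B"
  proof
    fix g assume "g \<in> h ` ?E"
    then obtain i where i: "i \<in> ?E" "g = h i" by blast
    have "?R \<subseteq> insert (h i) (G \<union> h ` (I - {i}))" by auto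
    then show "g \<in> B" using notE[of i] i B(1) by blast
  qed
  \<comment> \<open>Samples may repeat a hyperplane. If it occurs twice, leaving out one position
    does not change the arrangement, so that position is not counted.\<close>
  moreover have "inj_on h ?E"
  proof (rule inj_onI, rule ccontr)
    fix i j assume ij: "i \<in> ?E" "j \<in> ?E" "h i = h j" "i \<noteq> j"
    have "h k \<in> h ` (I - {i})" if "k \<in> I" for k
      using that ij by (cases "k = i") auto
    then have "h ` I \<subseteq> h ` (I - {i})" by blast
    then show False using notE[of i] ij(1) B(1) by blast
  qed
  moreover have "finite B" using B(1) fin finite_subset by blast
  ultimately show ?thesis using B(2) by (meson card_inj_on_le le_trans)
qed

text \<open>\<open>W\<close> with the map \<open>q\<close> is a multiset of hyperplanes, which makes
  room for integer weights; \<open>G\<close> belongs to every sample and keeps the faces bounded.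
  Both factors 2 come from Markov: half of the points have a simplex crossed at most twice as often
  as on average, and many of these share one simplex.\<close>

lemma exists_good_simplex:
  fixes H G :: "('a::euclidean_space \<times> real) set" and q :: "'w \<Rightarrow> 'a \<times> real"
  assumes H: "finite H" "G \<subseteq> H" and gp: "\<And>y. card (zer H y) \<le> DIM('a)"
    and X: "finite X" "X \<noteq> {}" and bdd: "\<And>x. x \<in> X \<Longrightarrow> bounded (face G x)"
    and W: "finite W" "W \<noteq> {}" "q ` W \<subseteq> H"
  shows "\<exists>V::nat \<Rightarrow> 'a. \<exists>Y\<subseteq>X. V ` {..DIM('a)} \<subseteq> (\<Union>x\<in>X. face G x) \<and> Y \<subseteq> convex hull (V ` {..DIM('a)}) \<and>
     card X \<le> 2 * (r + card G + 1) ^ DIM('a) * 3 ^ (DIM('a) * (DIM('a) + 1)) * card Y \<and>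
     (r + 1) * card {w\<in>W. crosses (q w) (V ` {..DIM('a)})} \<le> 2 * (DIM('a) + 1)\<^sup>2 * card W"
proof -
  let ?d = "DIM('a)"
  let ?D = "(?d + 1)\<^sup>2"
  let ?I = "{..r}"
  let ?P = "PiE ?I (\<lambda>_. W)"
  define E where "E R x w \<longleftrightarrow> crosses (q w) (vert R x ` {..?d})" for R x w
  have finG: "finite G" using H finite_subset by blast
  \<comment> \<open>Double counting over samples of length \<open>r + 1\<close>, omitted positions
    and points; backward analysis bounds the count for each sample and point.\<close>
  have "(\<Sum>i\<in>?I. \<Sum>s\<in>?P. \<Sum>x\<in>X. of_bool (E (G \<union> q ` s ` (?I - {i})) x (s i)))
      = (\<Sum>s\<in>?P. \<Sum>i\<in>?I. \<Sum>x\<in>X. of_bool (E (G \<union> q ` s ` (?I - {i})) x (s i)) :: nat)"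
    by (rule sum.swap)
  also have "\<dots> = (\<Sum>s\<in>?P. \<Sum>x\<in>X. \<Sum>i\<in>?I. of_bool (E (G \<union> q ` s ` (?I - {i})) x (s i)))"
    by (intro sum.cong refl sum.swap)
  also have "\<dots> = (\<Sum>s\<in>?P. \<Sum>x\<in>X. card {i\<in>?I. E (G \<union> q ` s ` (?I - {i})) x (s i)})"
    by (simp only: card_filter_eq_sum[OF finite_atMost])
  also have "\<dots> \<le> (\<Sum>s\<in>?P. \<Sum>x\<in>X. ?D)"
  proof (intro sum_mono)
    fix s x assume "x \<in> X"
    show "card {i\<in>?I. E (G \<union> q ` s ` (?I - {i})) x (s i)} \<le> ?D"
      using card_crossing_others_le[OF finG finite_atMost bdd[OF \<open>x \<in> X\<close>], of r "\<lambda>i. q (s i)"]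
      unfolding E_def image_image .
  qed
  finally have "(\<Sum>i\<in>?I. \<Sum>s\<in>?P. \<Sum>x\<in>X. of_bool (E (G \<union> q ` s ` (?I - {i})) x (s i))) \<le> card ?P * (card X * ?D)"
    by simp
  \<comment> \<open>With the position fixed, a sample splits into one tested hyperplane and
    \<open>r\<close> independent ones that define the arrangement.\<close>
  from exists_le_average[OF _ _ this] obtain i where i: "i \<in> ?I"
    "(r + 1) * (\<Sum>s\<in>?P. \<Sum>x\<in>X. of_bool (E (G \<union> q ` s ` (?I - {i})) x (s i))) \<le> card ?P * (card X * ?D)"
    by auto
  let ?J = "?I - {i}"
  let ?P' = "PiE ?J (\<lambda>_. W)"
  have P: "?P = (\<lambda>(w, s). s(i := w)) ` (W \<times> ?P')"
    using PiE_insert_eq[of i ?J "\<lambda>_. W"] i(1) by (simp add: insert_absorb)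
  have injP: "inj_on (\<lambda>(w, s). s(i := w)) (W \<times> ?P')"
    using inj_combinator[of i ?J "\<lambda>_. W"] by simp
  have same: "(s(i := w)) ` ?J = s ` ?J" for s :: "nat \<Rightarrow> 'w" and w by (rule image_cong) auto
  have "(\<Sum>s\<in>?P. \<Sum>x\<in>X. of_bool (E (G \<union> q ` s ` ?J) x (s i)))
     = (\<Sum>(w, s)\<in>W \<times> ?P'. \<Sum>x\<in>X. of_bool (E (G \<union> q ` s ` ?J) x w) :: nat)"
    unfolding P by (subst sum.reindex[OF injP]) (simp only: o_def case_prod_unfold same fun_upd_same)
  also have "\<dots> = (\<Sum>s\<in>?P'. \<Sum>w\<in>W. \<Sum>x\<in>X. of_bool (E (G \<union> q ` s ` ?J) x w))"
    unfolding sum.cartesian_product[symmetric] by (rule sum.swap)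
  finally have "(r + 1) * (\<Sum>s\<in>?P'. \<Sum>w\<in>W. \<Sum>x\<in>X. of_bool (E (G \<union> q ` s ` ?J) x w)) \<le> card ?P * (card X * ?D)"
    using i(2) by simp
  then have tot: "(\<Sum>s\<in>?P'. (r + 1) * (\<Sum>w\<in>W. \<Sum>x\<in>X. of_bool (E (G \<union> q ` s ` ?J) x w))) \<le> card ?P * (card X * ?D)"
    by (simp only: sum_distrib_left)
  have finP': "finite ?P'" using W(1) by (intro finite_PiE) auto
  have neP': "?P' \<noteq> {}" using W(2) by (simp add: PiE_eq_empty_iff)
  from exists_le_average[OF finP' neP' tot] obtain s where s: "s \<in> ?P'"
    "card ?P' * ((r + 1) * (\<Sum>w\<in>W. \<Sum>x\<in>X. of_bool (E (G \<union> q ` s ` ?J) x w))) \<le> card ?P * (card X * ?D)"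
    by blast
  have "card ?P = card W * card ?P'" unfolding P using injP by (simp add: card_image card_cartesian_product)
  then have "card ?P' * ((r + 1) * (\<Sum>w\<in>W. \<Sum>x\<in>X. of_bool (E (G \<union> q ` s ` ?J) x w))) \<le> card ?P' * (card W * ?D * card X)"
    using s(2) by (simp add: ac_simps)
  moreover have "card ?P' > 0" using finP' neP' by (simp add: card_gt_0_iff)
  ultimately have sum_le: "(r + 1) * (\<Sum>w\<in>W. \<Sum>x\<in>X. of_bool (E (G \<union> q ` s ` ?J) x w)) \<le> card W * ?D * card X"
    by simp
  define R where "R = G \<union> q ` s ` ?J"
  have RH: "R \<subseteq> H" using H(2) W(3) s(1) unfolding R_def by (auto simp: PiE_iff)
  have finR: "finite R" using RH H(1) finite_subset by blast
  have cardR: "card R \<le> r + card G"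
  proof -
    have "card R \<le> card G + card (q ` s ` ?J)" unfolding R_def by (rule card_Un_le)
    also have "card (q ` s ` ?J) \<le> card ?J" by (metis card_image_le finite_Diff finite_atMost image_image)
    also have "card ?J = r" using i(1) by simp
    finally show ?thesis by simp
  qed
  have gpR: "card (zer R y) \<le> ?d" for y
  proof -
    have "finite (zer H y)" using H(1) unfolding zer_def by simp
    moreover have "zer R y \<subseteq> zer H y" using RH unfolding zer_def by blast
    ultimately show ?thesis using gp[of y] card_mono[of "zer H y" "zer R y"] by simp
  qed
  have bddR: "bounded (face R x)" if "x \<in> X" for x
    by (rule bounded_subset[OF bdd[OF that] face_mono]) (simp add: R_def)
  define c where "c x = card {w\<in>W. E R x w}" for x
  have "(\<Sum>x\<in>X. c x) = (\<Sum>w\<in>W. \<Sum>x\<in>X. of_bool (E R x w))"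
    unfolding c_def card_filter_eq_sum[OF W(1)] by (rule sum.swap)
  then have "(r + 1) * (\<Sum>x\<in>X. c x) \<le> card W * ?D * card X" using sum_le unfolding R_def by simp
  then have half: "card X \<le> 2 * card {x\<in>X. (r + 1) * c x \<le> 2 * (card W * ?D)}"
    using W X(1) by (intro markov_half) (auto simp: card_gt_0_iff)
  let ?Xg = "{x\<in>X. (r + 1) * c x \<le> 2 * (card W * ?D)}"
  let ?f = "\<lambda>x. restrict (vert R x) {..?d}"
  let ?C = "(r + card G + 1) ^ ?d * 3 ^ (?d * (?d + 1))"
  have "card (?f ` ?Xg) \<le> (card R + 1) ^ ?d * 3 ^ (?d * (?d + 1))"
    by (rule card_vert_le[OF finR gpR]) (use X(1) bddR in auto)
  also have "\<dots> \<le> ?C" using cardR by (intro mult_right_mono power_mono) auto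
  finally have cf: "card (?f ` ?Xg) \<le> ?C" .
  have finXg: "finite ?Xg" using X(1) by simp
  have "card X > 0" using X by (simp add: card_gt_0_iff)
  then have "card ?Xg > 0" using half by linarith
  then have neXg: "?Xg \<noteq> {}" by (metis card.empty less_irrefl)
  from exists_large_fibre[OF finXg cf neXg]
  obtain x where x: "x \<in> ?Xg" "card ?Xg \<le> ?C * card {y\<in>?Xg. ?f y = ?f x}" by blast
  let ?Y = "{y\<in>?Xg. ?f y = ?f x}"
  let ?V = "vert R x"
  have Vy: "vert R y ` {..?d} = ?V ` {..?d}" if "y \<in> ?Y" for y
  proof -
    have "?f y = ?f x" using that by simp
    then have "vert R y k = vert R x k" if "k \<le> ?d" for k using that by (metis atMost_iff restrict_apply')
    then show ?thesis by (intro image_cong) auto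
  qed
  have YX: "?Y \<subseteq> X" by blast
  have c1: "?Y \<subseteq> convex hull (?V ` {..?d})"
  proof
    fix y assume y: "y \<in> ?Y"
    then have "y \<in> convex hull (vert R y ` {..?d})" by (intro in_hull_vert finR gpR bddR) auto
    then show "y \<in> convex hull (?V ` {..?d})" using Vy[OF y] by simp
  qed
  have c2: "?V ` {..?d} \<subseteq> (\<Union>x\<in>X. face G x)"
  proof
    fix v assume "v \<in> ?V ` {..?d}"
    then have "v \<in> face R x" using vert_in_face[OF finR bddR] x(1) by auto
    moreover have "face R x \<subseteq> face G x" by (rule face_mono) (simp add: R_def)
    ultimately show "v \<in> (\<Union>x\<in>X. face G x)" using x(1) by blast
  qed
  have c3: "card X \<le> 2 * (r + card G + 1) ^ ?d * 3 ^ (?d * (?d + 1)) * card ?Y"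
    using half x(2) by (simp add: ac_simps)
  have c4: "(r + 1) * card {w\<in>W. crosses (q w) (?V ` {..?d})} \<le> 2 * ?D * card W"
    using x(1) unfolding c_def E_def by (simp add: ac_simps)
  show ?thesis by (intro exI[of _ ?V] exI[of _ ?Y] conjI YX c1 c2 c3 c4)
qed

section \<open>Simplex families touched rarely by every hyperplane\<close>

text \<open>The weight of \<open>h\<close> doubles whenever \<open>h\<close> is crossed, while the
  total weight grows by a factor of at most \<open>1 + eps\<close> per round. After enough rounds,
  frequent crossings would make a single weight exceed the total.\<close>

lemma multiplicative_weights:
  fixes cr :: "'h \<Rightarrow> 'c \<Rightarrow> bool" and eps :: real
  assumes H: "finite H" "H \<noteq> {}" and eps: "eps > 0"
    and resp: "\<And>e :: 'h \<Rightarrow> nat. \<exists>c\<in>C. (\<Sum>h\<in>{h\<in>H. cr h c}. 2 ^ e h) \<le> eps * (\<Sum>h\<in>H. 2 ^ e h)"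
  shows "\<exists>T>0. \<exists>cs. (\<forall>t<T. cs t \<in> C) \<and> (\<forall>h\<in>H. real (card {t. t < T \<and> cr h (cs t)}) \<le> 4 * eps * real T)"
proof -
  have ex: "\<exists>cs. (\<forall>t<T. cs t \<in> C) \<and>
      (\<Sum>h\<in>H. 2 ^ card {t. t < T \<and> cr h (cs t)}) \<le> real (card H) * (1 + eps) ^ T" for T :: nat
  proof (induction T)
    case 0 show ?case by simp
  next
    case (Suc T)
    then obtain cs where cs: "\<forall>t<T. cs t \<in> C"
      "(\<Sum>h\<in>H. 2 ^ card {t. t < T \<and> cr h (cs t)}) \<le> real (card H) * (1 + eps) ^ T" by blast
    let ?e = "\<lambda>h. card {t. t < T \<and> cr h (cs t)}"
    obtain c where c: "c \<in> C" "(\<Sum>h\<in>{h\<in>H. cr h c}. 2 ^ ?e h) \<le> eps * (\<Sum>h\<in>H. 2 ^ ?e h)"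
      using resp[of ?e] by blast
    let ?cs = "cs(T := c)"
    have "2 ^ card {t. t < Suc T \<and> cr h (?cs t)} = (2::real) ^ ?e h + (if cr h c then 2 ^ ?e h else 0)" for h
    proof -
      have "{t. t < Suc T \<and> cr h (?cs t)} = {t. t < T \<and> cr h (cs t)} \<union> (if cr h c then {T} else {})"
        by (auto simp: less_Suc_eq)
      moreover have "finite {t. t < T \<and> cr h (cs t)}" by simp
      ultimately show ?thesis by simp
    qed
    then have "(\<Sum>h\<in>H. 2 ^ card {t. t < Suc T \<and> cr h (?cs t)})
      = (\<Sum>h\<in>H. 2 ^ ?e h) + (\<Sum>h\<in>H. if cr h c then (2::real) ^ ?e h else 0)"
      by (simp add: sum.distrib)
    also have "(\<Sum>h\<in>H. if cr h c then (2::real) ^ ?e h else 0) = (\<Sum>h\<in>{h\<in>H. cr h c}. 2 ^ ?e h)"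
      using H(1) by (simp add: sum.inter_filter)
    also have "(\<Sum>h\<in>H. 2 ^ ?e h) + \<dots> \<le> (1 + eps) * (\<Sum>h\<in>H. 2 ^ ?e h)" using c(2) by (simp add: algebra_simps)
    also have "\<dots> \<le> (1 + eps) * (real (card H) * (1 + eps) ^ T)" using cs(2) eps by (intro mult_left_mono) auto
    finally have "(\<Sum>h\<in>H. 2 ^ card {t. t < Suc T \<and> cr h (?cs t)}) \<le> real (card H) * (1 + eps) ^ Suc T"
      by (simp add: ac_simps)
    moreover have "\<forall>t<Suc T. ?cs t \<in> C" using cs(1) c(1) by (auto simp: less_Suc_eq)
    ultimately show ?case by blast
  qed
  \<comment> \<open>Enough rounds to absorb \<open>ln (card H)\<close> into \<open>eps * T\<close>;
    the \<open>+ 1\<close> keeps \<open>T\<close> positive when \<open>H\<close> is a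
    singleton.\<close>
  define T where "T = nat \<lceil>ln (real (card H)) / eps\<rceil> + 1"
  have cH: "real (card H) \<ge> 1" using H by (simp add: Suc_le_eq card_gt_0_iff)
  have "ln (real (card H)) / eps \<le> real T" unfolding T_def by linarith
  then have Tl: "ln (real (card H)) \<le> eps * real T" using eps by (simp add: pos_divide_le_eq mult.commute)
  obtain cs where cs: "\<forall>t<T. cs t \<in> C"
      "(\<Sum>h\<in>H. 2 ^ card {t. t < T \<and> cr h (cs t)}) \<le> real (card H) * (1 + eps) ^ T" using ex by blast
  have "real (card {t. t < T \<and> cr h (cs t)}) \<le> 4 * eps * real T" if h: "h \<in> H" for h
  proof -
    let ?n = "card {t. t < T \<and> cr h (cs t)}"
    \<comment> \<open>Comparing \<open>exp (n / 2)\<close> with the upper bound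
      \<open>exp (2 * eps * T)\<close> gives the factor 4.\<close>
    have "exp (real ?n / 2) = exp (1/2) ^ ?n" by (simp add: exp_of_nat_mult[symmetric])
    also have "\<dots> \<le> 2 ^ ?n" by (intro power_mono exp_half_le2) simp
    also have "\<dots> \<le> (\<Sum>h\<in>H. 2 ^ card {t. t < T \<and> cr h (cs t)})"
      using H(1) h by (intro member_le_sum) auto
    also have "\<dots> \<le> real (card H) * (1 + eps) ^ T" by (rule cs(2))
    also have "\<dots> \<le> real (card H) * exp eps ^ T"
      using eps by (intro mult_left_mono power_mono exp_ge_add_one_self) auto
    also have "\<dots> = exp (ln (real (card H)) + eps * real T)"
      using cH by (simp add: exp_add exp_of_nat_mult[symmetric] mult.commute)
    also have "\<dots> \<le> exp (2 * eps * real T)" using Tl by simp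
    finally have "real ?n / 2 \<le> 2 * eps * real T" by simp
    then show ?thesis by simp
  qed
  moreover have "T > 0" unfolding T_def by simp
  ultimately show ?thesis using cs(1) by blast
qed

text \<open>No hyperplane contains \<open>d + 1\<close> of the points, and by compactness of the
  sphere of normals no sufficiently thin slab does either, whatever its direction and
  offset.\<close>

lemma slab_contains_few:
  fixes u :: "nat \<Rightarrow> 'a::euclidean_space"
  assumes inj: "inj_on u {..<N}" and gen: "affine_generic (u ` {..<N})"
  shows "\<exists>b>0. \<forall>a c. norm a = 1 \<longrightarrow> card {k. k < N \<and> \<bar>a \<bullet> u k + c\<bar> \<le> b} \<le> DIM('a)"
proof -
  let ?F = "{S. S \<subseteq> {..<N} \<and> card S = DIM('a) + 1}"
  have one: "\<exists>b>0. \<forall>a c. norm a = 1 \<longrightarrow> (\<exists>k\<in>S. \<bar>a \<bullet> u k + c\<bar> > b)" if S: "S \<in> ?F" for S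
  proof -
    have "S \<noteq> {}" using S by force
    then obtain k0 where k0: "k0 \<in> S" by blast
    have finS: "finite S" using S finite_subset by blast
    \<comment> \<open>Differences to a fixed point eliminate the offset \<open>c\<close>, which
      ranges over a set that is not compact.\<close>
    let ?g = "\<lambda>a. \<Sum>k\<in>S. \<bar>a \<bullet> (u k - u k0)\<bar>"
    have "continuous_on (sphere 0 1) ?g" by (intro continuous_intros)
    moreover have "sphere (0::'a) 1 \<noteq> {}" by simp
    ultimately obtain a0 where a0: "norm a0 = 1" "\<And>a. norm a = 1 \<Longrightarrow> ?g a0 \<le> ?g a"
      using continuous_attains_inf[of "sphere (0::'a) 1" ?g] by auto
    have pos: "?g a0 > 0"
    proof (rule ccontr)
      assume "\<not> ?g a0 > 0"
      moreover have "?g a0 \<ge> 0" by (intro sum_nonneg) auto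
      ultimately have "?g a0 = 0" by linarith
      then have z: "a0 \<bullet> u k = a0 \<bullet> u k0" if "k \<in> S" for k
        using that finS by (simp add: sum_nonneg_eq_0_iff inner_diff_right)
      have c: "card (u ` S) = DIM('a) + 1"
        using S card_image[OF inj_on_subset[OF inj, of S]] by simp
      have "\<not> affine_dependent (u ` S)" using gen c S unfolding affine_generic_def by (simp add: image_mono)
      then have "aff_dim (u ` S) = int DIM('a)" using c unfolding affine_independent_iff_card by simp
      moreover have "aff_dim (u ` S) \<le> aff_dim {x. a0 \<bullet> x = a0 \<bullet> u k0}" using z by (intro aff_dim_subset) auto
      moreover have "a0 \<noteq> 0" using a0(1) by auto
      ultimately show False by (simp add: aff_dim_hyperplane)
    qed
    define b where "b = ?g a0 / (4 * real (DIM('a) + 1))"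
    have aux: "n * (2 * (x / (4 * n))) = x / 2" if "n > 0" for n x :: real using that by (simp add: field_simps)
    have "\<exists>k\<in>S. \<bar>a \<bullet> u k + c\<bar> > b" if a: "norm a = 1" for a c
    proof (rule ccontr)
      assume "\<not> ?thesis"
      then have le: "\<bar>a \<bullet> u k + c\<bar> \<le> b" if "k \<in> S" for k using that by force
      have "?g a \<le> (\<Sum>k\<in>S. 2 * b)"
      proof (rule sum_mono)
        fix k assume "k \<in> S"
        show "\<bar>a \<bullet> (u k - u k0)\<bar> \<le> 2 * b"
          using le[OF \<open>k \<in> S\<close>] le[OF k0] by (simp add: inner_diff_right)
      qed
      also have "\<dots> = real (DIM('a) + 1) * (2 * b)" using S by simp
      also have "\<dots> = ?g a0 / 2" unfolding b_def by (rule aux) simp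
      finally show False using a0(2)[OF a] pos by linarith
    qed
    then show ?thesis using pos by (intro exI[of _ b]) (auto simp: b_def)
  qed
  then have "\<forall>S\<in>?F. \<exists>b>0. \<forall>a c. norm a = 1 \<longrightarrow> (\<exists>k\<in>S. \<bar>a \<bullet> u k + c\<bar> > b)" by blast
  from bchoice[OF this] obtain b where b: "\<forall>S\<in>?F. b S > 0 \<and> (\<forall>a c. norm a = 1 \<longrightarrow> (\<exists>k\<in>S. \<bar>a \<bullet> u k + c\<bar> > b S))" ..
  have finF: "finite ?F" by simp
  \<comment> \<open>The 1 covers the case that there are fewer than \<open>d + 1\<close>
    points.\<close>
  define m where "m = Min (insert 1 (b ` ?F))"
  have m0: "m > 0" unfolding m_def using finF b by (subst Min_gr_iff) auto
  have mle: "m \<le> b S" if "S \<in> ?F" for S unfolding m_def using finF that by (intro Min_le) auto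
  have "card {k. k < N \<and> \<bar>a \<bullet> u k + c\<bar> \<le> m} \<le> DIM('a)" if a: "norm a = 1" for a c
  proof (rule ccontr)
    assume "\<not> ?thesis"
    then have "DIM('a) + 1 \<le> card {k. k < N \<and> \<bar>a \<bullet> u k + c\<bar> \<le> m}" by linarith
    then obtain S where S: "S \<subseteq> {k. k < N \<and> \<bar>a \<bullet> u k + c\<bar> \<le> m}" "card S = DIM('a) + 1"
      by (rule obtain_subset_with_card_n)
    then have SF: "S \<in> ?F" by auto
    then obtain k where "k \<in> S" "\<bar>a \<bullet> u k + c\<bar> > b S" using b a by blast
    then show False using S(1) mle[OF SF] by fastforce
  qed
  then show ?thesis using m0 by blast
qed

text \<open>Incidence with \<open>x\<close> becomes orthogonality to \<open>(x, 1)\<close>, so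
  general position of hyperplanes turns into linear algebra in dimension
  \<open>d + 1\<close>.\<close>

lemma ev_eq_inner: "ev h x = h \<bullet> (x, 1)"
  by (cases h) (simp add: ev_def)

lemma ev_diff_le: "\<bar>ev h x - ev w x\<bar> \<le> norm (h - w) * (norm x + 1)"
proof -
  have "\<bar>ev h x - ev w x\<bar> = \<bar>(h - w) \<bullet> (x, 1)\<bar>" by (simp add: ev_eq_inner inner_diff_left)
  also have "\<dots> \<le> norm (h - w) * norm (x, 1::real)" by (rule Cauchy_Schwarz_ineq2)
  also have "\<dots> \<le> norm (h - w) * (norm x + 1)"
    using norm_Pair_le[of x "1::real"] by (intro mult_left_mono) auto
  finally show ?thesis .
qed

text \<open>Perturbed to be affinely generic together with 0, any \<open>d + 1\<close> distinct ones
  form a basis of \<open>'a \<times> real\<close> and cannot all be orthogonal to the nonzero vector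
  \<open>(y, 1)\<close>.\<close>

lemma generic_hyperplanes:
  fixes Tg :: "('a::euclidean_space \<times> real) set"
  assumes "finite Tg" "rho > 0"
  shows "\<exists>f. (\<forall>w\<in>Tg. norm (f w - w) < rho) \<and> (\<forall>y. card (zer (f ` Tg) y) \<le> DIM('a))"
proof -
  have "\<exists>p. inj_on p Tg \<and> (\<forall>w\<in>Tg. p w \<in> ball w rho) \<and> p ` Tg \<inter> {0} = {} \<and> affine_generic ({0} \<union> p ` Tg)"
  proof (rule generic_points)
    show "affine_generic {0::'a \<times> real}"
      unfolding affine_generic_def by (auto dest!: subset_singletonD)
  qed (use assms in auto)
  then obtain f where f: "\<forall>w\<in>Tg. f w \<in> ball w rho" "f ` Tg \<inter> {0} = {}" "affine_generic ({0} \<union> f ` Tg)" by blast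
  have "card (zer (f ` Tg) y) \<le> DIM('a)" for y
  proof (rule ccontr)
    assume "\<not> ?thesis"
    then have "DIM('a) + 1 \<le> card (zer (f ` Tg) y)" by linarith
    then obtain S where S: "S \<subseteq> zer (f ` Tg) y" "card S = DIM('a) + 1" "finite S"
      by (rule obtain_subset_with_card_n)
    have Sf: "S \<subseteq> f ` Tg" using S(1) unfolding zer_def by blast
    then have S0: "0 \<notin> S" using f(2) by blast
    have "insert 0 S \<subseteq> {0} \<union> f ` Tg" using Sf by blast
    moreover have "card (insert 0 S) \<le> DIM('a \<times> real) + 1" using S S0 by simp
    ultimately have "\<not> affine_dependent (insert 0 S)" using f(3) unfolding affine_generic_def by blast
    moreover have "{x - 0 |x. x \<in> S} = S" by auto
    ultimately have ind: "independent S"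
      using dependent_imp_affine_dependent[of 0 S] S0 by auto
    have "span S = UNIV" using ind S(2,3) independent_card_le_dim
      by (metis DIM_prod DIM_real card_eq_dim dim_UNIV subset_UNIV top.extremum_uniqueI)
    then have "(y, 1) \<in> span S" by simp
    then have "(y, 1::real) \<in> {z. (y, 1) \<bullet> z = 0}"
    proof (rule set_rev_mp, intro span_minimal)
      show "S \<subseteq> {z. (y, 1) \<bullet> z = 0}" using S(1) unfolding zer_def ev_eq_inner by (auto simp: inner_commute)
      show "subspace {z. (y, 1::real) \<bullet> z = 0}" by (rule subspace_hyperplane)
    qed
    then have "y \<bullet> y + 1 = 0" by simp
    then show False using inner_ge_zero[of y] by linarith
  qed
  moreover have "\<forall>w\<in>Tg. norm (f w - w) < rho" using f(1) by (auto simp: dist_norm norm_minus_commute)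
  ultimately show ?thesis by blast
qed

text \<open>Multiplicative weights with \<open>exists_good_simplex\<close> as the response; the 8 is
  the 4 of the former times the 2 of the latter.\<close>

lemma exists_crossing_balanced_simplices:
  fixes H G :: "('a::euclidean_space \<times> real) set"
  assumes H: "finite H" "H \<noteq> {}" "G \<subseteq> H" and gp: "\<And>y. card (zer H y) \<le> DIM('a)"
    and X: "finite X" "X \<noteq> {}" and bdd: "\<forall>x\<in>X. bounded (face G x)"
  shows "\<exists>T>0. \<exists>(V::nat \<Rightarrow> nat \<Rightarrow> 'a) Y. (\<forall>t<T. Y t \<subseteq> X \<and> V t ` {..DIM('a)} \<subseteq> (\<Union>x\<in>X. face G x) \<and>
       Y t \<subseteq> convex hull (V t ` {..DIM('a)}) \<and>
       card X \<le> 2 * (r + card G + 1) ^ DIM('a) * 3 ^ (DIM('a) * (DIM('a) + 1)) * card (Y t)) \<and>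
     (\<forall>h\<in>H. (r + 1) * card {t. t < T \<and> crosses h (V t ` {..DIM('a)})} \<le> 8 * (DIM('a) + 1)\<^sup>2 * T)"
proof -
  let ?d = "DIM('a)"
  let ?D = "(?d + 1)\<^sup>2"
  define ok where "ok c \<longleftrightarrow> snd c \<subseteq> X \<and> fst c ` {..?d} \<subseteq> (\<Union>x\<in>X. face G x) \<and>
       snd c \<subseteq> convex hull (fst c ` {..?d}) \<and>
       card X \<le> 2 * (r + card G + 1) ^ ?d * 3 ^ (?d * (?d + 1)) * card (snd c)" for c :: "(nat \<Rightarrow> 'a) \<times> 'a set"
  define eps where "eps = 2 * real ?D / real (r + 1)"
  have eps: "eps > 0" unfolding eps_def by (intro divide_pos_pos) auto
  have resp: "\<exists>c\<in>Collect ok. (\<Sum>h\<in>{h\<in>H. crosses h (fst c ` {..?d})}. 2 ^ e h) \<le> eps * (\<Sum>h\<in>H. 2 ^ e h)"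
    for e :: "'a \<times> real \<Rightarrow> nat"
  proof -
    \<comment> \<open>A weight \<open>2 ^ e h\<close> becomes as many copies of \<open>h\<close>, so
      uniform sampling from \<open>W\<close> is weighted sampling from \<open>H\<close>.\<close>
    define W where "W = (SIGMA h:H. {..<(2::nat) ^ e h})"
    have cW: "card {w\<in>W. P (fst w)} = (\<Sum>h\<in>{h\<in>H. P h}. 2 ^ e h)" for P
    proof -
      have "{w\<in>W. P (fst w)} = (SIGMA h:{h\<in>H. P h}. {..<(2::nat) ^ e h})" unfolding W_def by auto
      then show ?thesis using H(1) by (simp add: card_SigmaI)
    qed
    have cW': "card W = (\<Sum>h\<in>H. 2 ^ e h)" unfolding W_def using H(1) by (simp add: card_SigmaI)
    obtain h0 where "h0 \<in> H" using H(2) by blast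
    then have "(h0, 0) \<in> W" unfolding W_def by simp
    then have "W \<noteq> {}" by blast
    moreover have "finite W" "fst ` W \<subseteq> H" unfolding W_def using H(1) by auto
    ultimately have W: "finite W" "W \<noteq> {}" "fst ` W \<subseteq> H" by blast+
    obtain V Y where VY: "Y \<subseteq> X" "V ` {..?d} \<subseteq> (\<Union>x\<in>X. face G x)" "Y \<subseteq> convex hull (V ` {..?d})"
     "card X \<le> 2 * (r + card G + 1) ^ ?d * 3 ^ (?d * (?d + 1)) * card Y"
     "(r + 1) * card {w\<in>W. crosses (fst w) (V ` {..?d})} \<le> 2 * ?D * card W"
      using exists_good_simplex[OF H(1,3) gp X bdd[rule_format] W, of r] by blast
    have "real ((r + 1) * (\<Sum>h\<in>{h\<in>H. crosses h (V ` {..?d})}. 2 ^ e h)) \<le> real (2 * ?D * (\<Sum>h\<in>H. 2 ^ e h))"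
      using VY(5) unfolding cW[of "\<lambda>h. crosses h (V ` {..?d})"] cW' of_nat_le_iff .
    then have "real (r + 1) * (\<Sum>h\<in>{h\<in>H. crosses h (V ` {..?d})}. 2 ^ e h) \<le> 2 * real ?D * (\<Sum>h\<in>H. 2 ^ e h)"
      by (simp only: of_nat_mult of_nat_sum of_nat_power of_nat_numeral)
    then have "(\<Sum>h\<in>{h\<in>H. crosses h (V ` {..?d})}. 2 ^ e h) \<le> eps * (\<Sum>h\<in>H. 2 ^ e h)"
      unfolding eps_def by (simp only: times_divide_eq_left) (subst pos_le_divide_eq, simp, simp only: mult.commute)
    moreover have "ok (V, Y)" unfolding ok_def using VY by simp
    ultimately show ?thesis by (intro bexI[of _ "(V, Y)"]) auto
  qed
  from multiplicative_weights[where cr = "\<lambda>h c. crosses h (fst c ` {..?d})", OF H(1,2) eps resp]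
  obtain T cs where T: "T > 0" "\<forall>t<T. ok (cs t)"
    "\<forall>h\<in>H. real (card {t. t < T \<and> crosses h (fst (cs t) ` {..?d})}) \<le> 4 * eps * real T" by blast
  have "(r + 1) * card {t. t < T \<and> crosses h (fst (cs t) ` {..?d})} \<le> 8 * ?D * T" if "h \<in> H" for h
  proof -
    let ?n = "card {t. t < T \<and> crosses h (fst (cs t) ` {..?d})}"
    have "real (r + 1) * real ?n \<le> real (r + 1) * (4 * eps * real T)" using T(3) that by (intro mult_left_mono) auto
    also have "\<dots> = 4 * (real (r + 1) * eps) * real T" by (simp only: ac_simps)
    also have "real (r + 1) * eps = 2 * real ?D" unfolding eps_def by (simp del: of_nat_add of_nat_power)
    also have "4 * (2 * real ?D) * real T = real (8 * ?D * T)" by (simp del: of_nat_power of_nat_add)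
    finally have "real ((r + 1) * ?n) \<le> real (8 * ?D * T)" by (simp only: of_nat_mult)
    then show ?thesis unfolding of_nat_le_iff .
  qed
  then show ?thesis using T(1,2) unfolding ok_def
    by (intro exI[of _ T] conjI exI[of _ "\<lambda>t. fst (cs t)"] exI[of _ "\<lambda>t. snd (cs t)"]) auto
qed

lemma touches_scale:
  assumes "c > 0"
  shows "touches (c *\<^sub>R h) V \<longleftrightarrow> touches h V"
proof -
  have "fst (c *\<^sub>R h) \<bullet> v + snd (c *\<^sub>R h) = c * (fst h \<bullet> v + snd h)" for v
    by (simp add: algebra_simps)
  then show ?thesis unfolding touches_def ev_def using assms by (simp add: zero_less_mult_iff mult_less_0_iff)
qed

text \<open>The facets of a large cube. They have to bound the faces even after a perturbation,
  whose effect at \<open>y\<close> grows with the norm of \<open>y\<close>.\<close>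

lemma bounding_box:
  fixes X :: "'a::euclidean_space set"
  assumes "finite X"
  shows "\<exists>(B :: ('a \<times> real) set) M rho0. finite B \<and> card B \<le> 2 * DIM('a) \<and> rho0 > 0 \<and>
     (\<forall>f. (\<forall>w\<in>B. norm (f w - w) < rho0) \<longrightarrow> (\<forall>x\<in>X. \<forall>y\<in>face (f ` B) x. norm y \<le> M))"
proof -
  let ?d = "real DIM('a)"
  have d1: "?d \<ge> 1" using DIM_positive[where 'a='a] by (simp add: Suc_le_eq)
  obtain M0 where M0: "M0 \<ge> 0" "\<And>x. x \<in> X \<Longrightarrow> norm x \<le> M0"
    using finite_imp_bounded[OF assms] unfolding bounded_iff by (metis norm_ge_zero order.trans linear)
  \<comment> \<open>The points of \<open>X\<close> keep a distance of at least \<open>M0 + 2\<close>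
    from the facets, more than the perturbation error of at most \<open>M0 + 1\<close>.\<close>
  define M where "M = 2 * M0 + 2"
  define B where "B = (\<lambda>(s, i). (s *\<^sub>R i, - M)) ` ({1, -1::real} \<times> (Basis :: 'a set))"
  \<comment> \<open>Summed over \<open>d\<close> coordinates the errors amount to half of
    \<open>norm y + 1\<close>, which the left-hand side absorbs.\<close>
  define rho0 where "rho0 = 1 / (2 * ?d)"
  have fin: "finite B" unfolding B_def by simp
  have "card B \<le> card ({1, -1::real} \<times> (Basis :: 'a set))" unfolding B_def by (intro card_image_le) simp
  then have cB: "card B \<le> 2 * DIM('a)" by (simp add: card_cartesian_product)
  have "2 * ?d \<ge> 1" using d1 by linarith
  then have r0: "rho0 > 0" "rho0 \<le> 1" unfolding rho0_def by auto
  have "norm y \<le> 2 * (?d * M) + 1"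
    if f: "\<forall>w\<in>B. norm (f w - w) < rho0" and x: "x \<in> X" and y: "y \<in> face (f ` B) x" for f x y
  proof -
    have comp: "s * (y \<bullet> i) \<le> M + rho0 * (norm y + 1)" if s: "s \<in> {1, -1}" and i: "i \<in> Basis" for s i
    proof -
      let ?w = "(s *\<^sub>R i, - M)"
      have w: "?w \<in> B" unfolding B_def using s i by auto
      have nf: "norm (f ?w - ?w) \<le> rho0" using f w by force
      have near: "\<bar>ev (f ?w) z - ev ?w z\<bar> \<le> rho0 * (norm z + 1)" for z
        by (rule order.trans[OF ev_diff_le]) (use nf in \<open>intro mult_right_mono; simp\<close>)
      have e: "ev ?w z = s * (z \<bullet> i) - M" for z by (simp add: ev_def inner_commute)
      have "s * (x \<bullet> i) \<le> M0"
        using s M0(2)[OF x] Basis_le_norm[OF i, of x] by auto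
      then have "ev ?w x \<le> M0 - M" by (simp add: e)
      moreover have "rho0 * (norm x + 1) \<le> M0 + 1"
        using mult_mono[of rho0 1 "norm x + 1" "M0 + 1"] r0 M0(2)[OF x] by simp
      ultimately have "ev (f ?w) x < 0" using near[of x] M_def by linarith
      then have "ev (f ?w) y \<le> 0" using y w unfolding face_def side_def by auto
      then show ?thesis using near[of y] e[of y] by linarith
    qed
    have "norm y \<le> (\<Sum>i\<in>Basis. \<bar>y \<bullet> i\<bar>)" by (rule norm_le_l1)
    also have "\<dots> \<le> (\<Sum>i\<in>(Basis::'a set). M + rho0 * (norm y + 1))"
    proof (rule sum_mono)
      fix i :: 'a assume "i \<in> Basis"
      then show "\<bar>y \<bullet> i\<bar> \<le> M + rho0 * (norm y + 1)" using comp[of 1 i] comp[of "-1" i] by simp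
    qed
    also have "\<dots> = ?d * M + (?d * rho0) * (norm y + 1)" by (simp add: algebra_simps)
    also have "?d * rho0 = 1/2" unfolding rho0_def using d1 by simp
    finally have "norm y \<le> ?d * M + 1/2 * (norm y + 1)" .
    moreover have "n \<le> q + 1/2 * (n + 1) \<Longrightarrow> n \<le> 2 * q + 1" for n q :: real by (simp add: field_simps)
    ultimately show ?thesis by blast
  qed
  then show ?thesis using fin cB r0(1) by blast
qed

text \<open>Translating the simplices by a few generic vectors turns the bound for strict crossings by a fine net
  of hyperplanes into a bound for all hyperplanes, touching included: a hyperplane that is not well
  approximated with respect to a vertex is close to that vertex, which is the case for at most
  \<open>DIM('a)\<close> of the translates.\<close>
lemma exists_simplex_family:
  fixes X :: "'a::euclidean_space set"
  assumes X: "finite X" "X \<noteq> {}" and sig: "sig > 0"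
  shows "\<exists>(I::(nat \<times> nat) set) Y (V::nat \<times> nat \<Rightarrow> nat \<Rightarrow> 'a) u. finite I \<and> I \<noteq> {} \<and>
    (\<forall>i\<in>I. Y i \<subseteq> X \<and> norm (u i) \<le> sig \<and> (\<forall>y\<in>Y i. y + u i \<in> convex hull (V i ` {..DIM('a)})) \<and>
       card X \<le> 2 * (r + 2 * DIM('a) + 1) ^ DIM('a) * 3 ^ (DIM('a) * (DIM('a) + 1)) * card (Y i)) \<and>
    (\<forall>h. fst h \<noteq> 0 \<longrightarrow> (r + 1) * card {i\<in>I. touches h (V i ` {..DIM('a)})} \<le> 9 * (DIM('a) + 1)\<^sup>2 * card I)"
proof -
  let ?d = "DIM('a)"
  let ?D = "(?d + 1)\<^sup>2"
  obtain B :: "('a \<times> real) set" and M rho0 where B: "finite B" "card B \<le> 2 * ?d" "rho0 > 0"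
    "\<And>f x y. (\<forall>w\<in>B. norm (f w - w) < rho0) \<Longrightarrow> x \<in> X \<Longrightarrow> y \<in> face (f ` B) x \<Longrightarrow> norm y \<le> M"
    using bounding_box[OF X(1)] by blast
  have M0: "M \<ge> 0"
  proof -
    obtain x where "x \<in> X" using X(2) by blast
    from B(4)[of id x x] this self_in_face[of x "id ` B"] have "norm x \<le> M" using B(3) by simp
    then show ?thesis using norm_ge_zero order.trans by blast
  qed
  \<comment> \<open>At most \<open>d\<close> of these translates are bad for a given vertex and
    hyperplane: the fraction of order \<open>1 / (r + 1)\<close> aimed at.\<close>
  define N where "N = r + 1"
  have "\<exists>u. inj_on u {..<N} \<and> (\<forall>k\<in>{..<N}. u k \<in> ball 0 (min sig 1)) \<and> u ` {..<N} \<inter> {} = {} \<and>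
      affine_generic ({} \<union> u ` {..<N} :: 'a set)"
    by (rule generic_points) (use sig in \<open>auto simp: affine_generic_def\<close>)
  then obtain u :: "nat \<Rightarrow> 'a" where u: "inj_on u {..<N}" "\<And>k. k < N \<Longrightarrow> norm (u k) < min sig 1" "affine_generic (u ` {..<N})"
    by auto
  obtain b where b: "b > 0" "\<And>a c. norm a = 1 \<Longrightarrow> card {k. k < N \<and> \<bar>a \<bullet> u k + c\<bar> \<le> b} \<le> ?d"
    using slab_contains_few[OF u(1,3)] by blast
  \<comment> \<open>A hyperplane is moved by less than \<open>rho\<close> twice, by the net and by
    the generic perturbation; at points of norm at most \<open>M\<close> its value then changes by
    at most \<open>b\<close>.\<close>
  define rho where "rho = min rho0 (b / (2 * (M + 1)))"
  have rho: "rho > 0" "rho \<le> rho0" "2 * rho * (M + 1) \<le> b"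
  proof -
    show "rho > 0" "rho \<le> rho0" unfolding rho_def using B(3) b(1) M0 by auto
    have "rho \<le> b / (2 * (M + 1))" unfolding rho_def by simp
    then show "2 * rho * (M + 1) \<le> b" using M0 by (simp add: pos_le_divide_eq mult.assoc mult.left_commute)
  qed
  \<comment> \<open>Offsets beyond \<open>M + 1\<close> touch no translated simplex, and undoing a
    translation changes the offset by at most 1.\<close>
  let ?K = "sphere (0::'a) 1 \<times> cball (0::real) (M + 2)"
  have "compact ?K" by (intro compact_Times) auto
  then obtain K where K: "finite K" "?K \<subseteq> (\<Union>w\<in>K. ball w rho)"
    using rho(1) unfolding compact_eq_totally_bounded by blast
  obtain f where f: "\<And>w. w \<in> B \<union> K \<Longrightarrow> norm (f w - w) < rho" "\<And>y. card (zer (f ` (B \<union> K)) y) \<le> ?d"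
    using generic_hyperplanes[of "B \<union> K" rho] B(1) K(1) rho(1) by blast
  let ?H = "f ` (B \<union> K)" and ?G = "f ` B"
  have fB: "\<forall>w\<in>B. norm (f w - w) < rho0" using f(1) rho(2) by force
  have bnd: "norm y \<le> M" if "x \<in> X" "y \<in> face ?G x" for x y using B(4)[OF fB that] .
  have bdd: "\<forall>x\<in>X. bounded (face ?G x)" using bnd unfolding bounded_iff by blast
  have finH: "finite ?H" using B(1) K(1) by simp
  have neH: "?H \<noteq> {}"
  proof -
    obtain i :: 'a where "i \<in> Basis" using nonempty_Basis by blast
    then have "(i, 0) \<in> ?K" using M0 by simp
    then show ?thesis using K(2) by blast
  qed
  have GH: "?G \<subseteq> ?H" by blast
  obtain T V Y where T0: "T > 0"
    and T1: "\<forall>t<T. Y t \<subseteq> X \<and> V t ` {..?d} \<subseteq> (\<Union>x\<in>X. face ?G x) \<and>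
       Y t \<subseteq> convex hull (V t ` {..?d}) \<and>
       card X \<le> 2 * (r + card ?G + 1) ^ ?d * 3 ^ (?d * (?d + 1)) * card (Y t)"
    and T2: "\<forall>h\<in>?H. (r + 1) * card {t. t < T \<and> crosses h (V t ` {..?d})} \<le> 8 * ?D * T"
    using exists_crossing_balanced_simplices[OF finH neH GH f(2) X bdd, of r] by (elim exE conjE)
  note T = T0 T1[rule_format, THEN conjunct1] T1[rule_format, THEN conjunct2, THEN conjunct1]
    T1[rule_format, THEN conjunct2, THEN conjunct2, THEN conjunct1]
    T1[rule_format, THEN conjunct2, THEN conjunct2, THEN conjunct2] T2[rule_format]
  have VM: "norm (V t j) \<le> M" if "t < T" "j \<le> ?d" for t j using T(3)[OF that(1)] that(2) bnd by blast
  define I where "I = {..<T} \<times> {..<N}"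
  define V' where "V' i j = V (fst i) j + u (snd i)" for i :: "nat \<times> nat" and j
  have cI: "card I = T * N" unfolding I_def by (simp add: card_cartesian_product)
  have unit: "(r + 1) * card {i\<in>I. touches h (V' i ` {..?d})} \<le> 9 * ?D * card I" if a1: "norm (fst h) = 1" for h
  proof (cases "\<bar>snd h\<bar> \<le> M + 1")
    case False
    have "\<not> touches h (V' i ` {..?d})" if i: "i \<in> I" for i
    proof -
      have "\<bar>fst h \<bullet> V' i j\<bar> \<le> M + 1" if "j \<le> ?d" for j
      proof -
        have "\<bar>fst h \<bullet> V' i j\<bar> \<le> norm (V' i j)" using Cauchy_Schwarz_ineq2[of "fst h" "V' i j"] a1 by simp
        also have "\<dots> \<le> norm (V (fst i) j) + norm (u (snd i))" unfolding V'_def by (rule norm_triangle_ineq)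
        also have "\<dots> \<le> M + 1" using VM[of "fst i" j] u(2)[of "snd i"] i that unfolding I_def by auto
        finally show ?thesis .
      qed
      then have lt: "\<bar>fst h \<bullet> V' i j\<bar> < \<bar>snd h\<bar>" if "j \<le> ?d" for j using False that by force
      have "(\<forall>v\<in>V' i ` {..?d}. fst h \<bullet> v + snd h > 0) \<or> (\<forall>v\<in>V' i ` {..?d}. fst h \<bullet> v + snd h < 0)"
      proof (cases "snd h > 0")
        case True
        have "fst h \<bullet> V' i j + snd h > 0" if "j \<le> ?d" for j using lt[OF that] True by linarith
        then show ?thesis by auto
      next
        case neg: False
        have "fst h \<bullet> V' i j + snd h < 0" if "j \<le> ?d" for j using lt[OF that] neg by linarith
        then show ?thesis by auto
      qed
      then show ?thesis unfolding touches_def ev_def by blast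
    qed
    then have "{i\<in>I. touches h (V' i ` {..?d})} = {}" by blast
    then show ?thesis by (simp only: card.empty mult_0_right le0)
  next
    case True
    \<comment> \<open>The hyperplane is translated back instead of the simplex forward.\<close>
    define g where "g k = (fst h, snd h + fst h \<bullet> u k)" for k
    have ev_g: "ev (g k) v = fst h \<bullet> u k + (fst h \<bullet> v + snd h)" for k v by (simp add: ev_def g_def)
    have "\<exists>w\<in>K. norm (w - g k) < rho" if "k < N" for k
    proof -
      have "\<bar>fst h \<bullet> u k\<bar> \<le> 1" using Cauchy_Schwarz_ineq2[of "fst h" "u k"] a1 u(2)[OF that] by simp
      then have "g k \<in> ?K" using True a1 unfolding g_def by auto
      then have "g k \<in> (\<Union>w\<in>K. ball w rho)" by (rule subsetD[OF K(2)])
      then show ?thesis unfolding UN_iff mem_ball dist_norm .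
    qed
    then obtain w where w: "\<And>k. k < N \<Longrightarrow> w k \<in> K" "\<And>k. k < N \<Longrightarrow> norm (w k - g k) < rho" by metis
    have near: "\<bar>ev (f (w k)) v - ev (g k) v\<bar> \<le> b" if k: "k < N" and v: "norm v \<le> M" for k v
    proof -
      have "norm (f (w k) - g k) \<le> norm (f (w k) - w k) + norm (w k - g k)"
        using norm_triangle_ineq[of "f (w k) - w k" "w k - g k"] by simp
      also have "\<dots> \<le> 2 * rho" using f(1)[of "w k"] w[OF k] by simp
      finally have "norm (f (w k) - g k) * (norm v + 1) \<le> 2 * rho * (M + 1)"
        using v rho(1) by (intro mult_mono) auto
      then show ?thesis using ev_diff_le[of "f (w k)" v "g k"] rho(3) by linarith
    qed
    have gV: "ev (g k) (V t j) = fst h \<bullet> V' (t, k) j + snd h" for k t j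
      unfolding ev_g V'_def by (simp add: inner_add_right)
    \<comment> \<open>\<open>?A\<close> collects the cases in which the approximating hyperplane
      strictly crosses the original simplex, \<open>?C\<close> those in which some vertex is too
      close for the approximation to decide its side. They contribute 8 and 1 to the constant
      9.\<close>
    let ?A = "SIGMA k:{..<N}. {t. t < T \<and> crosses (f (w k)) (V t ` {..?d})}"
    let ?C = "SIGMA t:{..<T}. \<Union>j\<in>{..?d}. {k. k < N \<and> \<bar>fst h \<bullet> u k + (fst h \<bullet> V t j + snd h)\<bar> \<le> b}"
    have sub: "{i\<in>I. touches h (V' i ` {..?d})} \<subseteq> prod.swap ` ?A \<union> ?C"
    proof
      fix i assume i: "i \<in> {i\<in>I. touches h (V' i ` {..?d})}"
      obtain t k where tk: "i = (t, k)" "t < T" "k < N" using i unfolding I_def by auto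
      show "i \<in> prod.swap ` ?A \<union> ?C"
      proof (cases "\<exists>j\<le>?d. \<bar>fst h \<bullet> u k + (fst h \<bullet> V t j + snd h)\<bar> \<le> b")
        case True
        then have "i \<in> ?C" using tk by auto
        then show ?thesis by blast
      next
        case False
        then have big: "\<bar>ev (g k) (V t j)\<bar> > b" if "j \<le> ?d" for j
          using that unfolding ev_g by force
        have "\<not> (\<forall>j\<le>?d. ev (g k) (V t j) > 0)" "\<not> (\<forall>j\<le>?d. ev (g k) (V t j) < 0)"
          using i unfolding tk(1) gV unfolding touches_def ev_def by auto
        then obtain j j' where j: "j \<le> ?d" "j' \<le> ?d" "ev (g k) (V t j) \<le> 0" "ev (g k) (V t j') \<ge> 0"
          by (auto simp: not_less)
        have "ev (f (w k)) (V t j) < 0" "ev (f (w k)) (V t j') > 0"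
          using near[OF tk(3) VM[OF tk(2) j(1)]] near[OF tk(3) VM[OF tk(2) j(2)]] big[OF j(1)] big[OF j(2)] j(3,4)
          by linarith+
        then have "crosses (f (w k)) (V t ` {..?d})" unfolding crosses_def using j(1,2) by blast
        then have "(k, t) \<in> ?A" using tk by simp
        then have "prod.swap (k, t) \<in> prod.swap ` ?A" by (rule imageI)
        then show ?thesis using tk(1) by simp
      qed
    qed
    have finA: "finite ?A" by (rule finite_SigmaI) auto
    have finC: "finite ?C" by (rule finite_SigmaI) auto
    have "card {i\<in>I. touches h (V' i ` {..?d})} \<le> card (prod.swap ` ?A \<union> ?C)"
      using sub finA finC by (intro card_mono) auto
    also have "\<dots> \<le> card (prod.swap ` ?A) + card ?C" by (rule card_Un_le)
    also have "\<dots> \<le> card ?A + card ?C" using card_image_le[OF finA] by simp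
    finally have le: "card {i\<in>I. touches h (V' i ` {..?d})} \<le> card ?A + card ?C" .
    have cA: "(r + 1) * card ?A \<le> 8 * ?D * T * N"
    proof -
      have "(r + 1) * card ?A = (\<Sum>k<N. (r + 1) * card {t. t < T \<and> crosses (f (w k)) (V t ` {..?d})})"
        by (simp add: card_SigmaI sum_distrib_left)
      also have "\<dots> \<le> (\<Sum>k<N. 8 * ?D * T)" using w(1) by (intro sum_mono T(6)) auto
      finally show ?thesis by (simp add: ac_simps)
    qed
    have cC: "card ?C \<le> ?D * T"
    proof -
      have "card ?C = (\<Sum>t<T. card (\<Union>j\<in>{..?d}. {k. k < N \<and> \<bar>fst h \<bullet> u k + (fst h \<bullet> V t j + snd h)\<bar> \<le> b}))"
        by (subst card_SigmaI) auto
      also have "\<dots> \<le> (\<Sum>t<T. \<Sum>j\<le>?d. card {k. k < N \<and> \<bar>fst h \<bullet> u k + (fst h \<bullet> V t j + snd h)\<bar> \<le> b})"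
        by (intro sum_mono card_UN_le) auto
      also have "\<dots> \<le> (\<Sum>t<T. \<Sum>j\<le>?d. ?d)" by (intro sum_mono b(2) a1)
      also have "\<dots> = ?d * (?d + 1) * T" by simp
      also have "\<dots> \<le> ?D * T" by (intro mult_right_mono) (auto simp: power2_eq_square)
      finally show ?thesis .
    qed
    have "(r + 1) * card {i\<in>I. touches h (V' i ` {..?d})} \<le> (r + 1) * (card ?A + card ?C)" by (rule mult_left_mono[OF le]) simp
    also have "\<dots> = (r + 1) * card ?A + N * card ?C" unfolding N_def by (simp add: algebra_simps)
    also have "\<dots> \<le> 8 * ?D * T * N + N * (?D * T)" by (intro add_mono cA mult_left_mono cC) simp
    also have "\<dots> = 9 * ?D * card I" unfolding cI by simp
    finally show ?thesis .
  qed
  have all: "(r + 1) * card {i\<in>I. touches h (V' i ` {..?d})} \<le> 9 * ?D * card I" if "fst h \<noteq> 0" for h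
  proof -
    let ?c = "1 / norm (fst h)"
    have "?c > 0" using that by simp
    moreover have "norm (fst (?c *\<^sub>R h)) = 1" using that by simp
    ultimately show ?thesis using unit[of "?c *\<^sub>R h"] touches_scale[of ?c h] by simp
  qed
  have cell: "Y (fst i) \<subseteq> X \<and> norm (u (snd i)) \<le> sig \<and> (\<forall>y\<in>Y (fst i). y + u (snd i) \<in> convex hull (V' i ` {..?d})) \<and>
       card X \<le> 2 * (r + 2 * ?d + 1) ^ ?d * 3 ^ (?d * (?d + 1)) * card (Y (fst i))" if i: "i \<in> I" for i
  proof (intro conjI ballI)
    have tk: "fst i < T" "snd i < N" using i unfolding I_def by auto
    show "Y (fst i) \<subseteq> X" by (rule T(2)[OF tk(1)])
    show "norm (u (snd i)) \<le> sig" using u(2)[OF tk(2)] by simp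
    have "card ?G \<le> 2 * ?d" using card_image_le[OF B(1), of f] B(2) by simp
    then have "2 * (r + card ?G + 1) ^ ?d * 3 ^ (?d * (?d + 1)) * card (Y (fst i))
       \<le> 2 * (r + 2 * ?d + 1) ^ ?d * 3 ^ (?d * (?d + 1)) * card (Y (fst i))"
      by (intro mult_right_mono mult_left_mono power_mono) auto
    then show "card X \<le> 2 * (r + 2 * ?d + 1) ^ ?d * 3 ^ (?d * (?d + 1)) * card (Y (fst i))"
      using T(5)[OF tk(1)] by (rule le_trans[rotated])
    fix y assume "y \<in> Y (fst i)"
    then have "y \<in> convex hull (V (fst i) ` {..?d})" using T(4)[OF tk(1)] by blast
    then have "u (snd i) + y \<in> (\<lambda>x. u (snd i) + x) ` (convex hull (V (fst i) ` {..?d}))" by (rule imageI)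
    moreover have "V' i ` {..?d} = (\<lambda>x. u (snd i) + x) ` V (fst i) ` {..?d}"
      unfolding V'_def image_image by (simp add: add.commute)
    ultimately show "y + u (snd i) \<in> convex hull (V' i ` {..?d})"
      unfolding convex_hull_translation by (simp only: add.commute[of y] convex_hull_translation)
  qed
  have fI: "finite I" "I \<noteq> {}" unfolding I_def N_def using T(1) by auto
  show ?thesis
    by (intro exI[of _ I] exI[of _ "\<lambda>i. Y (fst i)"] exI[of _ V'] exI[of _ "\<lambda>i. u (snd i)"]
        conjI fI ballI[OF cell] allI impI all)
qed

section \<open>Choices avoiding rare events\<close>

text \<open>Rosenfeld's counting argument, an elementary substitute for the Lovasz local lemma: adding one
  more index at least multiplies the number of admissible partial choices by half the number of its options.\<close>
lemma choice_avoiding_rare_events: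
  fixes C :: "'i \<Rightarrow> 'c set" and supp :: "'j \<Rightarrow> 'i set" and bad :: "'j \<Rightarrow> ('i \<Rightarrow> 'c) \<Rightarrow> bool" and eps :: real
  assumes A: "finite A" and C: "\<And>i. i \<in> A \<Longrightarrow> finite (C i) \<and> C i \<noteq> {}"
    and E: "finite E" "\<And>J. J \<in> E \<Longrightarrow> supp J \<subseteq> A" "\<And>J. J \<in> E \<Longrightarrow> card (supp J) = k + 1"
    and dep: "\<And>J f g. J \<in> E \<Longrightarrow> (\<And>i. i \<in> supp J \<Longrightarrow> f i = g i) \<Longrightarrow> bad J f \<longleftrightarrow> bad J g"
    and few: "\<And>J. J \<in> E \<Longrightarrow> real (card {f\<in>PiE (supp J) C. bad J f}) \<le> eps * (\<Prod>i\<in>supp J. real (card (C i)))"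
    and deg: "\<And>v. v \<in> A \<Longrightarrow> card {J\<in>E. v \<in> supp J} \<le> Deg"
    and eps: "eps \<ge> 0" "real Deg * eps * 2 ^ k \<le> 1 / 2"
  shows "\<exists>f\<in>PiE A C. \<forall>J\<in>E. \<not> bad J f"
proof -
  define Good where "Good S = {f\<in>PiE S C. \<forall>J\<in>E. supp J \<subseteq> S \<longrightarrow> \<not> bad J f}" for S
  define g where "g S = real (card (Good S))" for S
  define c where "c i = real (card (C i))" for i
  have c0: "c i > 0" if "i \<in> A" for i using C[OF that] unfolding c_def by (simp add: card_gt_0_iff)
  have finPi: "finite (PiE S C)" if "S \<subseteq> A" for S
    using that C finite_subset[OF that A] by (intro finite_PiE) auto
  have finG: "finite (Good S)" if "S \<subseteq> A" for S using finPi[OF that] unfolding Good_def by simp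
  have depr: "bad J (restrict f T) \<longleftrightarrow> bad J f" if "J \<in> E" "supp J \<subseteq> T" for J T f
    by (rule dep[OF that(1)]) (use that(2) in auto)
  \<comment> \<open>The growth bound is applied once per element of \<open>W\<close>. It is assumed
    only for sets smaller than \<open>S\<close>, so that this can be used inside the
    induction.\<close>
  have grow: "g S \<ge> (\<Prod>w\<in>W. c w / 2) * g (S - W)"
    if S: "S \<subseteq> A" and W: "finite W" "W \<subseteq> S"
      and IH: "\<And>T v. T \<subseteq> A \<Longrightarrow> card T < card S \<Longrightarrow> v \<in> A - T \<Longrightarrow> g (insert v T) \<ge> c v / 2 * g T" for S W
    using W
  proof (induction W)
    case (insert w W)
    let ?T = "S - insert w W"
    have finS: "finite S" using S A finite_subset by blast
    have eq: "insert w ?T = S - W" using insert by auto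
    have "?T \<subset> S" using insert.prems by blast
    then have "card ?T < card S" using finS psubset_card_mono by blast
    then have "c w / 2 * g ?T \<le> g (S - W)" using IH[of ?T w] eq S insert.prems by auto
    then have "(\<Prod>w\<in>W. c w / 2) * (c w / 2 * g ?T) \<le> (\<Prod>w\<in>W. c w / 2) * g (S - W)"
      by (intro mult_left_mono prod_nonneg) (auto simp: c_def)
    also have "\<dots> \<le> g S" using insert by simp
    finally show ?case using insert.hyps by (simp add: mult_ac)
  qed simp
  have step: "g (insert v S) \<ge> c v / 2 * g S" if "S \<subseteq> A" "v \<in> A - S" for S v
    using that
  proof (induction "card S" arbitrary: S v rule: less_induct)
    case less
    have S: "S \<subseteq> A" and v: "v \<in> A" "v \<notin> S" using less.prems by auto
    have vS: "insert v S \<subseteq> A" using S v by blast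
    \<comment> \<open>All extensions of admissible choices on \<open>S\<close>; one that fails
      violates an event whose support contains \<open>v\<close>.\<close>
    define Ext where "Ext = (\<lambda>(x, f). f(v := x)) ` (C v \<times> Good S)"
    have inj: "inj_on (\<lambda>(x, f). f(v := x)) (C v \<times> Good S)"
      by (rule inj_on_subset[OF inj_combinator[OF v(2), of C]]) (auto simp: Good_def)
    have cExt: "real (card Ext) = c v * g S"
      unfolding Ext_def using inj by (simp add: card_image card_cartesian_product c_def g_def)
    have ExtPi: "Ext \<subseteq> PiE (insert v S) C" unfolding Ext_def PiE_insert_eq Good_def by auto
    have ExtGood: "restrict f S \<in> Good S" if fE: "f \<in> Ext" for f
    proof -
      obtain x f' where f': "f = f'(v := x)" "f' \<in> Good S" using fE unfolding Ext_def by auto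
      have "restrict f S = f'"
        using f' v(2) unfolding Good_def by (auto simp: restrict_def PiE_iff extensional_def fun_eq_iff)
      then show ?thesis using f'(2) by simp
    qed
    let ?J = "{J\<in>E. v \<in> supp J \<and> supp J \<subseteq> insert v S}"
    let ?B = "\<lambda>J. {f\<in>Ext. bad J f}"
    have cover: "Ext \<subseteq> Good (insert v S) \<union> (\<Union>J\<in>?J. ?B J)"
    proof
      fix f assume f: "f \<in> Ext"
      show "f \<in> Good (insert v S) \<union> (\<Union>J\<in>?J. ?B J)"
      proof (cases "f \<in> Good (insert v S)")
        case False
        moreover have "f \<in> PiE (insert v S) C" by (rule subsetD[OF ExtPi f])
        ultimately obtain J where J: "J \<in> E" "supp J \<subseteq> insert v S" "bad J f"
          unfolding Good_def by blast
        have "v \<in> supp J"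
        proof (rule ccontr)
          assume "v \<notin> supp J"
          then have sub: "supp J \<subseteq> S" using J(2) by blast
          then have "bad J (restrict f S)" using J(3) depr[OF J(1) sub] by simp
          then show False using ExtGood[OF f] J(1) sub unfolding Good_def by blast
        qed
        then show ?thesis using J f by blast
      qed simp
    qed
    have cB: "real (card (?B J)) \<le> eps * 2 ^ k * (c v * g S)" if J: "J \<in> ?J" for J
    proof -
      have JE: "J \<in> E" "v \<in> supp J" "supp J \<subseteq> insert v S" using J by auto
      let ?W = "supp J - {v}"
      have finJ: "finite (supp J)" using E(2)[OF JE(1)] A finite_subset by blast
      have W: "finite ?W" "?W \<subseteq> S" "S - ?W = S - supp J" "card ?W = k"
        using JE finJ v(2) E(3)[OF JE(1)] by auto
      \<comment> \<open>A failing extension is determined by a bad choice on \<open>supp J\<close>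
        and an admissible one on the rest of \<open>S\<close>.\<close>
      let ?m = "\<lambda>f. (restrict f (supp J), restrict f (S - supp J))"
      let ?P = "{f\<in>PiE (supp J) C. bad J f} \<times> Good (S - supp J)"
      have "inj_on ?m (?B J)"
      proof (rule inj_onI)
        fix f h assume fh: "f \<in> ?B J" "h \<in> ?B J" "?m f = ?m h"
        show "f = h"
        proof (rule PiE_ext)
          show "f \<in> PiE (insert v S) C" "h \<in> PiE (insert v S) C" using fh(1,2) ExtPi by auto
          fix i assume "i \<in> insert v S"
          then have "i \<in> supp J \<or> i \<in> S - supp J" using JE(2) by blast
          moreover have "restrict f (supp J) i = restrict h (supp J) i"
            "restrict f (S - supp J) i = restrict h (S - supp J) i" using fh(3) by (metis fst_conv, metis snd_conv)
          ultimately show "f i = h i" by auto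
        qed
      qed
      moreover have "?m ` ?B J \<subseteq> ?P"
      proof
        fix q assume "q \<in> ?m ` ?B J"
        then obtain f where f: "f \<in> Ext" "bad J f" "q = ?m f" by blast
        have fPi: "f \<in> PiE (insert v S) C" using f(1) ExtPi by blast
        have "restrict f (supp J) \<in> PiE (supp J) C" using fPi JE(3) by (auto simp: PiE_iff)
        moreover have "bad J (restrict f (supp J))" using f(2) depr[OF JE(1) order_refl] by simp
        moreover have "restrict f (S - supp J) \<in> Good (S - supp J)"
          unfolding Good_def
        proof (intro CollectI conjI ballI impI)
          show "restrict f (S - supp J) \<in> PiE (S - supp J) C" using fPi by (auto simp: PiE_iff)
          fix J' assume J': "J' \<in> E" "supp J' \<subseteq> S - supp J"
          then have "\<not> bad J' (restrict f S)" using ExtGood[OF f(1)] unfolding Good_def by blast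
          moreover have "bad J' (restrict f S) \<longleftrightarrow> bad J' (restrict f (S - supp J))"
            using J'(2) depr[OF J'(1), of S f] depr[OF J'(1), of "S - supp J" f] by blast
          ultimately show "\<not> bad J' (restrict f (S - supp J))" by simp
        qed
        ultimately show "q \<in> ?P" using f(3) by auto
      qed
      moreover have "S - supp J \<subseteq> A" using S by blast
      then have "finite ?P" using finPi[OF E(2)[OF JE(1)]] finG by (intro finite_cartesian_product) auto
      ultimately have "card (?B J) \<le> card ?P" by (rule card_inj_on_le)
      then have "real (card (?B J)) \<le> real (card {f\<in>PiE (supp J) C. bad J f}) * g (S - ?W)"
        unfolding W(3) g_def card_cartesian_product of_nat_mult[symmetric] of_nat_le_iff .
      also have "\<dots> \<le> (eps * (\<Prod>i\<in>supp J. c i)) * g (S - ?W)"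
        using few[OF JE(1)] unfolding c_def by (intro mult_right_mono) (auto simp: g_def)
      \<comment> \<open>Dropping the \<open>k\<close> indices of \<open>?W\<close> from
        \<open>S\<close> costs half their numbers of options by \<open>grow\<close>; the halves
        account for the factor \<open>2 ^ k\<close>.\<close>
      also have "(\<Prod>i\<in>supp J. c i) = c v * (2 ^ k * (\<Prod>i\<in>?W. c i / 2))"
        using prod.remove[OF finJ JE(2), of c] W(4) by (simp add: prod_dividef)
      also have "(eps * (c v * (2 ^ k * (\<Prod>i\<in>?W. c i / 2)))) * g (S - ?W)
          = eps * 2 ^ k * c v * ((\<Prod>i\<in>?W. c i / 2) * g (S - ?W))" by (simp only: mult_ac)
      also have "\<dots> \<le> eps * 2 ^ k * c v * g S"
      proof (rule mult_left_mono)
        show "(\<Prod>i\<in>?W. c i / 2) * g (S - ?W) \<le> g S"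
          by (rule grow[OF S W(1,2)]) (use less.hyps in auto)
        show "0 \<le> eps * 2 ^ k * c v" using eps(1) c0[OF v(1)] by simp
      qed
      finally show ?thesis by (simp only: mult_ac)
    qed
    have finJ: "finite ?J" using E(1) by simp
    have finExt: "finite Ext" using ExtPi finPi[OF vS] finite_subset by blast
    have "card Ext \<le> card (Good (insert v S) \<union> (\<Union>J\<in>?J. ?B J))"
      using finG[OF vS] finExt finJ by (intro card_mono[OF _ cover]) auto
    also have "\<dots> \<le> card (Good (insert v S)) + card (\<Union>J\<in>?J. ?B J)" by (rule card_Un_le)
    also have "\<dots> \<le> card (Good (insert v S)) + (\<Sum>J\<in>?J. card (?B J))"
      using card_UN_le[OF finJ, of ?B] by simp
    finally have "real (card Ext) \<le> real (card (Good (insert v S)) + (\<Sum>J\<in>?J. card (?B J)))"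
      unfolding of_nat_le_iff .
    then have "c v * g S \<le> g (insert v S) + (\<Sum>J\<in>?J. real (card (?B J)))"
      unfolding cExt g_def[of "insert v S"] of_nat_add of_nat_sum .
    moreover have "(\<Sum>J\<in>?J. real (card (?B J))) \<le> 1 / 2 * (c v * g S)"
    proof -
      have "(\<Sum>J\<in>?J. real (card (?B J))) \<le> (\<Sum>J\<in>?J. eps * 2 ^ k * (c v * g S))" by (rule sum_mono[OF cB])
      also have "\<dots> = real (card ?J) * (eps * 2 ^ k * (c v * g S))" by simp
      also have "\<dots> \<le> real Deg * (eps * 2 ^ k * (c v * g S))"
      proof (rule mult_right_mono)
        have "card ?J \<le> card {J\<in>E. v \<in> supp J}" using E(1) by (intro card_mono) auto
        then show "real (card ?J) \<le> real Deg" using deg[OF v(1)] by simp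
        show "0 \<le> eps * 2 ^ k * (c v * g S)" using eps(1) by (simp add: c_def g_def)
      qed
      also have "\<dots> = (real Deg * eps * 2 ^ k) * (c v * g S)" by (simp only: mult_ac)
      also have "\<dots> \<le> 1 / 2 * (c v * g S)" using eps(2) by (intro mult_right_mono) (auto simp: c_def g_def)
      finally show ?thesis .
    qed
    ultimately show ?case by linarith
  qed
  have "g A \<ge> (\<Prod>w\<in>A. c w / 2) * g (A - A)"
    by (rule grow) (use A step in auto)
  moreover have "g (A - A) = 1"
  proof -
    have "Good {} = {\<lambda>_. undefined}" unfolding Good_def using E(3) by force
    then show ?thesis unfolding g_def by simp
  qed
  moreover have "(\<Prod>w\<in>A. c w / 2) > 0" using c0 by (intro prod_pos) auto
  ultimately have "g A > 0" by simp
  then have "Good A \<noteq> {}" unfolding g_def by auto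
  then show ?thesis unfolding Good_def using E(2) by blast
qed

section \<open>Bounds for the same-type constant\<close>

lemma sgn_tdet_stable:
  fixes y :: "'n::finite option \<Rightarrow> real^'n"
  assumes nz: "tdet y \<noteq> 0"
  shows "\<exists>s>0. \<forall>w. (\<forall>k. norm (w k - y k) \<le> s) \<longrightarrow> sgn (tdet w) = sgn (tdet y)"
proof (rule ccontr)
  assume neg: "\<not> ?thesis"
  have "\<exists>w. (\<forall>k. norm (w k - y k) \<le> inverse (real (Suc n))) \<and> sgn (tdet w) \<noteq> sgn (tdet y)" for n :: nat
  proof -
    have "inverse (real (Suc n)) > 0" by simp
    then show ?thesis using neg by blast
  qed
  then obtain w where w: "\<And>n k. norm (w n k - y k) \<le> inverse (real (Suc n))"
    "\<And>n. sgn (tdet (w n)) \<noteq> sgn (tdet y)" by metis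
  have lim: "(\<lambda>n. w n k) \<longlonglongrightarrow> y k" for k
  proof (rule LIM_zero_cancel, rule Lim_null_comparison)
    show "eventually (\<lambda>n. norm (w n k - y k) \<le> inverse (real (Suc n))) sequentially" using w(1) by simp
    show "(\<lambda>n. inverse (real (Suc n))) \<longlonglongrightarrow> 0" by (rule LIMSEQ_inverse_real_of_nat)
  qed
  have tl: "(\<lambda>n. tdet (w n)) \<longlonglongrightarrow> tdet y"
    unfolding tdet_def det_def by (auto intro!: tendsto_intros lim)
  have "eventually (\<lambda>n. sgn (tdet (w n)) = sgn (tdet y)) sequentially"
  proof (cases "tdet y > 0")
    case True
    from order_tendstoD(1)[OF tl this] show ?thesis by (rule eventually_mono) (use True in simp)
  next
    case False
    then have "tdet y < 0" using nz by simp
    from order_tendstoD(2)[OF tl this] show ?thesis by (rule eventually_mono) (use \<open>tdet y < 0\<close> in simp)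
  qed
  then show False using w(2) eventually_happens'[OF sequentially_bot] by blast
qed

text \<open>The radius limits the translation vectors of the simplex families, so that the
  orientation of translated points is that of the points themselves.\<close>

lemma sgn_tdet_uniformly_stable:
  fixes P :: "(real^'n::finite) set"
  assumes "finite P"
  shows "\<exists>s>0. \<forall>y w. (\<forall>k. y k \<in> P) \<longrightarrow> tdet y \<noteq> 0 \<longrightarrow> (\<forall>k. norm (w k - y k) \<le> s) \<longrightarrow> sgn (tdet w) = sgn (tdet y)"
proof -
  let ?F = "{y\<in>PiE (UNIV :: 'n option set) (\<lambda>_. P). tdet y \<noteq> 0}"
  have "finite (PiE (UNIV :: 'n option set) (\<lambda>_. P))" using assms by (intro finite_PiE) auto
  then have fin: "finite ?F" by simp
  have "\<forall>y\<in>?F. \<exists>s>0. \<forall>w. (\<forall>k. norm (w k - y k) \<le> s) \<longrightarrow> sgn (tdet w) = sgn (tdet y)"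
    by (intro ballI sgn_tdet_stable) simp
  from bchoice[OF this] obtain s where
    s: "\<forall>y\<in>?F. s y > 0 \<and> (\<forall>w. (\<forall>k. norm (w k - y k) \<le> s y) \<longrightarrow> sgn (tdet w) = sgn (tdet y))" ..
  define t where "t = Min (insert 1 (s ` ?F))"
  have t0: "t > 0" unfolding t_def using fin s by (subst Min_gr_iff) auto
  have tle: "t \<le> s y" if "y \<in> ?F" for y unfolding t_def using fin that by (intro Min_le) auto
  have "sgn (tdet w) = sgn (tdet y)"
    if y: "\<forall>k. y k \<in> P" "tdet y \<noteq> 0" and w: "\<forall>k. norm (w k - y k) \<le> t" for y w
  proof -
    have yF: "y \<in> ?F" using y by auto
    have "\<forall>k. norm (w k - y k) \<le> s y" using w tle[OF yF] order.trans by blast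
    then show ?thesis using s yF by blast
  qed
  then show ?thesis using t0 by blast
qed

text \<open>Count by fibres over the choice on \<open>S\<close>: for each of them \<open>P\<close>
  restricts only the value at \<open>v\<close>.\<close>

lemma card_PiE_slice_le:
  fixes C :: "'i \<Rightarrow> 'c set"
  assumes S: "finite S" "v \<notin> S" and C: "\<And>i. i \<in> insert v S \<Longrightarrow> finite (C i)"
    and slice: "\<And>f. f \<in> PiE S C \<Longrightarrow> n * card {c\<in>C v. P c f} \<le> b * card (C v)"
  shows "n * card {f\<in>PiE (insert v S) C. P (f v) (restrict f S)} \<le> b * card (PiE (insert v S) C)"
proof -
  let ?Sig = "SIGMA f:PiE S C. {c\<in>C v. P c f}"
  have finS: "finite (PiE S C)" using S C by (intro finite_PiE) auto
  have finSig: "finite ?Sig" using finS C by (intro finite_SigmaI) auto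
  have "{f\<in>PiE (insert v S) C. P (f v) (restrict f S)} \<subseteq> (\<lambda>(f, c). f(v := c)) ` ?Sig"
  proof
    fix f assume f: "f \<in> {f\<in>PiE (insert v S) C. P (f v) (restrict f S)}"
    have "restrict f S \<in> PiE S C" "f v \<in> C v" using f by (auto simp: PiE_iff)
    then have "(restrict f S, f v) \<in> ?Sig" using f by simp
    moreover have "f = (restrict f S)(v := f v)"
      using f by (auto simp: fun_eq_iff restrict_def PiE_iff extensional_def)
    ultimately show "f \<in> (\<lambda>(f, c). f(v := c)) ` ?Sig" by (intro image_eqI[of _ _ "(restrict f S, f v)"]) auto
  qed
  then have "card {f\<in>PiE (insert v S) C. P (f v) (restrict f S)} \<le> card ((\<lambda>(f, c). f(v := c)) ` ?Sig)"
    using finSig by (intro card_mono) auto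
  also have "\<dots> \<le> card ?Sig" by (rule card_image_le[OF finSig])
  also have "\<dots> = (\<Sum>f\<in>PiE S C. card {c\<in>C v. P c f})" using finS C by (intro card_SigmaI) auto
  finally have "n * card {f\<in>PiE (insert v S) C. P (f v) (restrict f S)} \<le> n * (\<Sum>f\<in>PiE S C. card {c\<in>C v. P c f})"
    by (rule mult_left_mono) simp
  also have "\<dots> = (\<Sum>f\<in>PiE S C. n * card {c\<in>C v. P c f})" by (rule sum_distrib_left)
  also have "\<dots> \<le> (\<Sum>f\<in>PiE S C. b * card (C v))" by (rule sum_mono[OF slice])
  also have "\<dots> = b * card (PiE (insert v S) C)" using S by (simp add: card_PiE)
  finally show ?thesis .
qed

lemma card_functions_through_le:
  fixes v m :: nat
  shows "card {J::'a::finite \<Rightarrow> nat. (\<forall>l. J l < m) \<and> v \<in> range J} \<le> CARD('a) * m ^ (CARD('a) - 1)"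
proof -
  let ?T = "\<lambda>k::'a. PiE UNIV (\<lambda>l. if l = k then {v} else {..<m})"
  have fin: "finite (?T k)" for k by (intro finite_PiE) auto
  have "{J::'a \<Rightarrow> nat. (\<forall>l. J l < m) \<and> v \<in> range J} \<subseteq> (\<Union>k. ?T k)" by (auto simp: PiE_iff)
  then have "card {J::'a \<Rightarrow> nat. (\<forall>l. J l < m) \<and> v \<in> range J} \<le> card (\<Union>k. ?T k)"
    using fin by (intro card_mono) auto
  also have "\<dots> \<le> (\<Sum>k\<in>UNIV. card (?T k))" by (rule card_UN_le) simp
  also have "\<dots> = (\<Sum>k\<in>(UNIV::'a set). m ^ (CARD('a) - 1))"
  proof (rule sum.cong[OF refl])
    fix k :: 'a
    have "card (?T k) = (\<Prod>l\<in>UNIV. card (if l = k then {v} else {..<m}))" by (simp add: card_PiE)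
    also have "\<dots> = (\<Prod>l\<in>UNIV - {k}. card (if l = k then {v} else {..<m}))"
      by (subst prod.remove[of _ k]) auto
    also have "\<dots> = (\<Prod>l\<in>UNIV - {k}. m)" by (intro prod.cong) auto
    also have "\<dots> = m ^ (CARD('a) - 1)" by (simp add: card_Diff_singleton)
    finally show "card (?T k) = m ^ (CARD('a) - 1)" .
  qed
  finally show ?thesis by simp
qed

text \<open>\<open>r\<close> is what the local lemma demands: \<open>(d + 1) * m ^ d\<close> events
  per index, times their rate \<open>9 * (d + 1) ^ (d + 4) / (r + 1)\<close>, times
  \<open>2 ^ d\<close>, may be at most 1/2.\<close>

lemma same_type_subfamily:
  fixes X :: "nat \<Rightarrow> (real^'n::finite) set" and m :: nat
  defines "d \<equiv> CARD('n)"
  defines "r \<equiv> 18 * 2 ^ d * (d + 1) ^ (d + 5) * m ^ d"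
  assumes fgp: "family_gen_pos m X" and ne: "\<And>i. i < m \<Longrightarrow> X i \<noteq> {}"
  shows "\<exists>Y. (\<forall>i<m. Y i \<subseteq> X i) \<and> same_type m Y \<and>
     (\<forall>i<m. card (X i) \<le> 2 * (r + 2 * d + 1) ^ d * 3 ^ (d * (d + 1)) * card (Y i))"
proof -
  have dim: "DIM(real^'n) = d" unfolding d_def by simp
  let ?D = "(d + 1)\<^sup>2"
  let ?L = "2 * (r + 2 * d + 1) ^ d * 3 ^ (d * (d + 1))"
  have finX: "\<And>i. i < m \<Longrightarrow> finite (X i)" and disj: "\<And>i j. i < m \<Longrightarrow> j < m \<Longrightarrow> i \<noteq> j \<Longrightarrow> X i \<inter> X j = {}"
    and gp: "gen_pos (\<Union>i<m. X i)" using fgp unfolding family_gen_pos_def by auto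
  have "finite (\<Union>i<m. X i)" using finX by auto
  from sgn_tdet_uniformly_stable[OF this] obtain sig where sig: "sig > 0"
    "\<And>y w. (\<forall>k. y k \<in> (\<Union>i<m. X i)) \<Longrightarrow> tdet y \<noteq> 0 \<Longrightarrow> (\<forall>k. norm (w k - y k) \<le> sig) \<Longrightarrow> sgn (tdet w) = sgn (tdet y)"
    by blast
  define ok where "ok i I Y V u \<longleftrightarrow> finite I \<and> I \<noteq> {} \<and>
    (\<forall>c\<in>I. Y c \<subseteq> X i \<and> norm (u c) \<le> sig \<and> (\<forall>y\<in>Y c. y + u c \<in> convex hull (V c ` {..d})) \<and>
       card (X i) \<le> ?L * card (Y c)) \<and>
    (\<forall>h. fst h \<noteq> 0 \<longrightarrow> (r + 1) * card {c\<in>I. touches h (V c ` {..d})} \<le> 9 * ?D * card I)"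
    for i and I :: "(nat \<times> nat) set" and Y and V :: "nat \<times> nat \<Rightarrow> nat \<Rightarrow> real^'n" and u
  have "\<exists>I Y V u. ok i I Y V u" if "i < m" for i
    unfolding ok_def by (rule exists_simplex_family[OF finX[OF that] ne[OF that] sig(1), of r, unfolded dim])
  then have "\<forall>i. \<exists>I Y V u. i < m \<longrightarrow> ok i I Y V u" by blast
  then obtain I Y V u where q: "\<And>i. i < m \<Longrightarrow> ok i (I i) (Y i) (V i) (u i)" by metis
  have I: "finite (I i)" "I i \<noteq> {}" if "i < m" for i using q[OF that] unfolding ok_def by auto
  have Y: "Y i c \<subseteq> X i" "norm (u i c) \<le> sig" "\<And>y. y \<in> Y i c \<Longrightarrow> y + u i c \<in> convex hull (V i c ` {..d})"
    "card (X i) \<le> ?L * card (Y i c)" if "i < m" "c \<in> I i" for i c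
    using q[OF that(1)] that(2) unfolding ok_def by auto
  have T: "(r + 1) * card {c\<in>I i. touches h (V i c ` {..d})} \<le> 9 * ?D * card (I i)" if "i < m" "fst h \<noteq> 0" for i h
    using q[OF that(1)] that(2) unfolding ok_def by blast
  define E where "E = {J::'n option \<Rightarrow> nat. inj J \<and> range J \<subseteq> {..<m}}"
  \<comment> \<open>\<open>nu\<close> selects one vertex of the chosen simplex in each slot.\<close>
  define vtx where "vtx J f nu l = V (J l) (f (J l)) (nu l)" for J :: "'n option \<Rightarrow> nat" and f and nu :: "'n option \<Rightarrow> nat" and l
  define hit where "hit J f k nu \<longleftrightarrow> touches (opp_hyp k (vtx J f nu)) (V (J k) (f (J k)) ` {..d})" for J f k nu
  define Nu where "Nu = PiE (UNIV::'n option set) (\<lambda>_. {..d})"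
  define bad where "bad J f \<longleftrightarrow> (\<exists>k. \<exists>nu\<in>Nu. hit J f k nu)" for J f
  have finNu: "finite Nu" unfolding Nu_def by (intro finite_PiE) auto
  have cNu: "card Nu = (d + 1) ^ (d + 1)" unfolding Nu_def d_def by (simp add: card_PiE)
  have finE: "finite E"
  proof (rule finite_subset)
    show "E \<subseteq> PiE UNIV (\<lambda>_. {..<m})" unfolding E_def by auto
    show "finite (PiE (UNIV::'n option set) (\<lambda>_. {..<m}))" by (intro finite_PiE) auto
  qed
  have cJ: "card (range J) = d + 1" if "J \<in> E" for J
    using that unfolding E_def d_def by (simp add: card_image)
  \<comment> \<open>A union bound over \<open>d + 1\<close> slots and
    \<open>(d + 1) ^ (d + 1)\<close> vertex selections, each with rate
    \<open>9 * (d + 1)\<^sup>2 / (r + 1)\<close>.\<close>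
  define eps where "eps = 9 * real (d + 1) ^ (d + 4) / real (r + 1)"
  have few: "real (card {f\<in>PiE (range J) I. bad J f}) \<le> eps * (\<Prod>i\<in>range J. real (card (I i)))" if J: "J \<in> E" for J
  proof -
    have Jm: "J l < m" for l using J unfolding E_def by auto
    have injJ: "inj J" using J unfolding E_def by simp
    let ?P = "PiE (range J) I"
    have one: "(r + 1) * card {f\<in>?P. hit J f k nu} \<le> 9 * ?D * card ?P" for k nu
    proof -
      let ?S = "range J - {J k}"
      have ins: "insert (J k) ?S = range J" by auto
      have "(r + 1) * card {f\<in>PiE (insert (J k) ?S) I. touches (opp_hyp k (vtx J (restrict f ?S) nu)) (V (J k) (f (J k)) ` {..d})}
         \<le> 9 * ?D * card (PiE (insert (J k) ?S) I)"
      proof (rule card_PiE_slice_le[where P = "\<lambda>c f. touches (opp_hyp k (vtx J f nu)) (V (J k) c ` {..d})"])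
        show "finite (I i)" if "i \<in> insert (J k) ?S" for i using that I(1) Jm by auto
        show "(r + 1) * card {c\<in>I (J k). touches (opp_hyp k (vtx J f nu)) (V (J k) c ` {..d})} \<le> 9 * ?D * card (I (J k))" for f
          by (rule T[OF Jm opp_hyp(1)])
      qed auto
      \<comment> \<open>As \<open>J\<close> is injective, the slots other than \<open>k\<close> read
        \<open>f\<close> only on \<open>?S\<close>, and the hyperplane ignores slot
        \<open>k\<close>.\<close>
      moreover have "opp_hyp k (vtx J (restrict f ?S) nu) = opp_hyp k (vtx J f nu)" for f
      proof -
        have "vtx J (restrict f ?S) nu l = vtx J f nu l" if "l \<noteq> k" for l
          using that injJ unfolding vtx_def by (simp add: inj_eq)
        then have "vtx J (restrict f ?S) nu = (vtx J f nu)(k := vtx J (restrict f ?S) nu k)" by auto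
        then show ?thesis by (metis opp_hyp_upd)
      qed
      ultimately show ?thesis unfolding ins hit_def by simp
    qed
    have "{f\<in>?P. bad J f} = (\<Union>(k, nu)\<in>UNIV \<times> Nu. {f\<in>?P. hit J f k nu})" unfolding bad_def by auto
    then have "card {f\<in>?P. bad J f} \<le> (\<Sum>(k, nu)\<in>UNIV \<times> Nu. card {f\<in>?P. hit J f k nu})"
      using card_UN_le[of "UNIV \<times> Nu" "\<lambda>(k, nu). {f\<in>?P. hit J f k nu}"] finNu by (simp add: case_prod_unfold)
    then have "(r + 1) * card {f\<in>?P. bad J f} \<le> (r + 1) * (\<Sum>(k, nu)\<in>UNIV \<times> Nu. card {f\<in>?P. hit J f k nu})"
      by (rule mult_left_mono) simp
    also have "\<dots> = (\<Sum>(k, nu)\<in>UNIV \<times> Nu. (r + 1) * card {f\<in>?P. hit J f k nu})"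
      unfolding sum_distrib_left case_prod_unfold by simp
    also have "\<dots> \<le> (\<Sum>(k::'n option, nu)\<in>UNIV \<times> Nu. 9 * ?D * card ?P)"
      unfolding case_prod_unfold by (rule sum_mono[OF one])
    also have "\<dots> = (d + 1) * (d + 1) ^ (d + 1) * (9 * ?D * card ?P)"
      unfolding case_prod_unfold by (simp add: card_cartesian_product cNu d_def)
    also have "\<dots> = 9 * (d + 1) ^ (d + 4) * card ?P"
    proof -
      have "a ^ (k + 4) = a * a ^ (k + 1) * a\<^sup>2" for a k :: nat
        by (simp add: power_add power2_eq_square power4_eq_xxxx mult_ac)
      then show ?thesis by (simp only: mult_ac)
    qed
    finally have "real ((r + 1) * card {f\<in>?P. bad J f}) \<le> real (9 * (d + 1) ^ (d + 4) * card ?P)"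
      unfolding of_nat_le_iff .
    moreover have "real (card ?P) = (\<Prod>i\<in>range J. real (card (I i)))" by (simp add: card_PiE)
    ultimately have le: "real (r + 1) * real (card {f\<in>?P. bad J f}) \<le> 9 * real (d + 1) ^ (d + 4) * (\<Prod>i\<in>range J. real (card (I i)))"
      by (simp only: of_nat_mult of_nat_power of_nat_numeral)
    have aux: "R * x \<le> y \<Longrightarrow> R > 0 \<Longrightarrow> x \<le> y / R" for R x y :: real by (simp add: field_simps)
    show ?thesis unfolding eps_def times_divide_eq_left by (rule aux[OF le]) simp
  qed
  have deg: "card {J\<in>E. v \<in> range J} \<le> (d + 1) * m ^ d" for v
  proof -
    have fin: "finite {J::'n option \<Rightarrow> nat. (\<forall>l. J l < m) \<and> v \<in> range J}"
    proof (rule finite_subset)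
      show "{J::'n option \<Rightarrow> nat. (\<forall>l. J l < m) \<and> v \<in> range J} \<subseteq> PiE UNIV (\<lambda>_. {..<m})" by auto
      show "finite (PiE (UNIV::'n option set) (\<lambda>_. {..<m}))" by (intro finite_PiE) auto
    qed
    have "card {J\<in>E. v \<in> range J} \<le> card {J::'n option \<Rightarrow> nat. (\<forall>l. J l < m) \<and> v \<in> range J}"
      unfolding E_def by (intro card_mono[OF fin]) auto
    then show ?thesis using card_functions_through_le[where 'a="'n option", of m v] by (simp add: d_def)
  qed
  have small: "real ((d + 1) * m ^ d) * eps * 2 ^ d \<le> 1 / 2"
  proof -
    have aux: "18 * e * (a * c) * b = 2 * ((a * b) * (9 * c) * e)" for a b c e :: real by simp
    have aux2: "2 * Q \<le> R \<Longrightarrow> R > 0 \<Longrightarrow> Q / R \<le> 1 / 2" for Q R :: real by (simp add: field_simps)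
    let ?Q = "real ((d + 1) * m ^ d) * (9 * real (d + 1) ^ (d + 4)) * 2 ^ d"
    have "real r = 18 * 2 ^ d * real (d + 1) ^ (d + 5) * real m ^ d"
      unfolding r_def by (simp only: of_nat_mult of_nat_power of_nat_numeral)
    moreover have "d + 5 = Suc (d + 4)" by simp
    ultimately have "real r = 18 * 2 ^ d * (real (d + 1) * real (d + 1) ^ (d + 4)) * real m ^ d"
      by (simp only: power_Suc)
    also have "\<dots> = 2 * ?Q" unfolding of_nat_mult of_nat_power by (rule aux)
    finally have le: "2 * ?Q \<le> real (r + 1)" by linarith
    have "?Q / real (r + 1) \<le> 1 / 2" by (rule aux2[OF le]) simp
    then show ?thesis unfolding eps_def by (simp only: times_divide_eq_left times_divide_eq_right)
  qed
  have "\<exists>f\<in>PiE {..<m} I. \<forall>J\<in>E. \<not> bad J f"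
  proof (rule choice_avoiding_rare_events[where supp = range and k = d and eps = eps and Deg = "(d + 1) * m ^ d"])
    show "finite (I i) \<and> I i \<noteq> {}" if "i \<in> {..<m}" for i using I that by auto
    show "range J \<subseteq> {..<m}" if "J \<in> E" for J using that unfolding E_def by blast
    show "bad J f \<longleftrightarrow> bad J g" if "\<And>i. i \<in> range J \<Longrightarrow> f i = g i" for J f g
    proof -
      have "f (J l) = g (J l)" for l using that by simp
      then have "hit J f k nu = hit J g k nu" for k nu unfolding hit_def vtx_def by simp
      then show ?thesis unfolding bad_def by simp
    qed
    show "0 \<le> eps" unfolding eps_def by simp
  qed (use finE cJ few deg small in auto)
  then obtain f where f: "\<And>i. i < m \<Longrightarrow> f i \<in> I i" "\<And>J. J \<in> E \<Longrightarrow> \<not> bad J f" by (auto simp: PiE_iff)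
  define Z where "Z i = Y i (f i)" for i
  have ZX: "Z i \<subseteq> X i" if "i < m" for i using Y(1)[OF that f(1)[OF that]] unfolding Z_def .
  have "same_type m Z"
    unfolding same_type_iff
  proof (intro allI impI, elim conjE)
    fix J :: "'n option \<Rightarrow> nat" and y z
    assume J: "inj J" "range J \<subseteq> {..<m}" and y: "\<forall>k. y k \<in> Z (J k)" and z: "\<forall>k. z k \<in> Z (J k)"
    have JE: "J \<in> E" using J unfolding E_def by simp
    have Jm: "J k < m" for k using J(2) by auto
    define W where "W k = V (J k) (f (J k)) ` {..d}" for k
    have nt: "\<not> touches (opp_hyp k p) (W k)" if p: "\<And>l. p l \<in> W l" for k p
    proof -
      have "\<forall>l. \<exists>j. j \<le> d \<and> p l = V (J l) (f (J l)) j" using p unfolding W_def by blast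
      then obtain nu where nu: "\<And>l. nu l \<le> d" "\<And>l. p l = V (J l) (f (J l)) (nu l)" by metis
      have "nu \<in> Nu" unfolding Nu_def using nu(1) by auto
      then have "\<not> hit J f k nu" using f(2)[OF JE] unfolding bad_def by blast
      moreover have "p = vtx J f nu" unfolding vtx_def using nu(2) by auto
      ultimately show ?thesis unfolding hit_def W_def by simp
    qed
    define v0 where "v0 k = V (J k) (f (J k)) 0" for k
    have v0: "v0 k \<in> W k" for k unfolding v0_def W_def by simp
    have vs: "sgn (tdet p) = sgn (tdet v0)" if "\<And>k. p k \<in> W k" for p
      by (rule const_sgn_tdet_if_not_touches[of W]) (use nt that v0 in auto)
    have main: "sgn (tdet p) = sgn (tdet v0)" if p: "\<forall>k. p k \<in> Z (J k)" for p
    proof -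
      have pX: "p k \<in> X (J k)" for k using p ZX[OF Jm] by blast
      have "inj p"
      proof (rule injI)
        fix k l assume "p k = p l"
        then have "X (J k) \<inter> X (J l) \<noteq> {}" using pX[of k] pX[of l] by auto
        then have "J k = J l" using disj[OF Jm Jm] by blast
        then show "k = l" using J(1) by (simp add: inj_eq)
      qed
      moreover have pU: "\<forall>k. p k \<in> (\<Union>i<m. X i)" using pX Jm by blast
      ultimately have nz: "tdet p \<noteq> 0" by (intro gen_pos_tdet_nz[OF gp]) auto
      \<comment> \<open>Only the translated points lie in the simplices; the orientation is
        determined there and carried back to \<open>p\<close> by stability.\<close>
      define w where "w k = p k + u (J k) (f (J k))" for k
      have wW: "w k \<in> convex hull W k" for k
        using Y(3)[OF Jm f(1)[OF Jm]] p unfolding w_def W_def Z_def by blast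
      have "sgn (tdet w) = sgn (tdet v0)" by (rule sgn_tdet_convex_hull[OF vs wW])
      moreover have "sgn (tdet w) = sgn (tdet p)"
        by (rule sig(2)[OF pU nz]) (use Y(2)[OF Jm f(1)[OF Jm]] in \<open>simp add: w_def\<close>)
      ultimately show ?thesis by simp
    qed
    show "sgn (tdet y) = sgn (tdet z)" using main[OF y] main[OF z] by simp
  qed
  moreover have "\<forall>i<m. card (X i) \<le> ?L * card (Z i)" unfolding Z_def using Y(4) f(1) by blast
  ultimately show ?thesis using ZX by blast
qed

text \<open>Every numerical factor is turned into a power of \<open>d\<close>, using
  \<open>18 \<le> d ^ 5\<close> and \<open>d + 1 \<le> d\<^sup>2\<close>. The resulting exponent
  \<open>5 * d\<^sup>2 + 18 * d + 1\<close> is only quadratic, so \<open>50 * d ^ 3\<close> is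
  generous.\<close>

lemma subfamily_constant_le:
  fixes d m :: nat
  assumes d: "d \<ge> 2" and m: "m \<ge> 1"
  defines "r \<equiv> 18 * 2 ^ d * (d + 1) ^ (d + 5) * m ^ d"
  shows "2 * (r + 2 * d + 1) ^ d * 3 ^ (d * (d + 1)) \<le> d ^ (50 * d ^ 3) * m ^ (d ^ 2)"
proof -
  have "2 * d \<le> d * d" using d by (rule mult_le_mono1)
  then have sq: "d + 1 \<le> d ^ 2" "3 \<le> d ^ 2" unfolding power2_eq_square using d by linarith+
  have "(18::nat) \<le> 2 ^ 5" by simp
  also have "\<dots> \<le> d ^ 5" using d by (intro power_mono) auto
  finally have h18: "18 \<le> d ^ 5" .
  have h2: "2 ^ d \<le> d ^ d" using d by (intro power_mono) auto
  have "(d + 1) ^ (d + 5) \<le> (d ^ 2) ^ (d + 5)" using sq by (intro power_mono) auto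
  then have hd: "(d + 1) ^ (d + 5) \<le> d ^ (2 * (d + 5))" by (simp only: power_mult)
  have "r \<le> d ^ 5 * d ^ d * d ^ (2 * (d + 5)) * m ^ d"
    unfolding r_def by (intro mult_le_mono h18 h2 hd order_refl)
  also have "\<dots> = d ^ (3 * d + 15) * m ^ d" by (simp flip: power_add)
  finally have hr: "r \<le> d ^ (3 * d + 15) * m ^ d" .
  have "2 * d + 1 \<le> r"
  proof -
    have "2 * d + 1 \<le> 2 * (d + 1) ^ 1" by simp
    also have "\<dots> \<le> 2 * (d + 1) ^ (d + 5)" by (intro mult_le_mono2 power_increasing) auto
    also have "\<dots> \<le> (18 * 2 ^ d) * (d + 1) ^ (d + 5)" by (intro mult_le_mono1) (simp add: trans_le_add1 Suc_le_eq)
    also have "\<dots> \<le> (18 * 2 ^ d) * (d + 1) ^ (d + 5) * m ^ d" using m by simp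
    finally show ?thesis unfolding r_def .
  qed
  then have "r + 2 * d + 1 \<le> 2 * r" by simp
  also have "\<dots> \<le> d * (d ^ (3 * d + 15) * m ^ d)" using d hr by (intro mult_le_mono)
  also have "\<dots> = d ^ Suc (3 * d + 15) * m ^ d" by (simp only: power_Suc mult.assoc)
  also have "Suc (3 * d + 15) = 3 * d + 16" by simp
  finally have "(r + 2 * d + 1) ^ d \<le> (d ^ (3 * d + 16) * m ^ d) ^ d" by (intro power_mono) auto
  also have "\<dots> = d ^ ((3 * d + 16) * d) * m ^ (d ^ 2)"
    by (simp only: power_mult_distrib power2_eq_square flip: power_mult)
  finally have h1: "(r + 2 * d + 1) ^ d \<le> d ^ ((3 * d + 16) * d) * m ^ (d ^ 2)" .
  have "3 ^ (d * (d + 1)) \<le> (d ^ 2) ^ (d * (d + 1))" using sq by (intro power_mono) auto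
  then have h3: "3 ^ (d * (d + 1)) \<le> d ^ (2 * (d * (d + 1)))" by (simp only: power_mult)
  have "2 * (r + 2 * d + 1) ^ d * 3 ^ (d * (d + 1))
      \<le> d ^ 1 * (d ^ ((3 * d + 16) * d) * m ^ (d ^ 2)) * d ^ (2 * (d * (d + 1)))"
    using d by (intro mult_le_mono h1 h3) auto
  also have "\<dots> = d ^ (1 + (3 * d + 16) * d + 2 * (d * (d + 1))) * m ^ (d ^ 2)"
    by (simp only: power_add mult_ac)
  also have "\<dots> \<le> d ^ (50 * d ^ 3) * m ^ (d ^ 2)"
  proof (intro mult_le_mono1 power_increasing)
    have e1: "d * d \<le> d ^ 3" using d by (simp add: power3_eq_cube)
    have e2: "d \<le> d * d" using d by simp
    have "1 + (3 * d + 16) * d + 2 * (d * (d + 1)) = 1 + 5 * (d * d) + 18 * d" by (simp add: algebra_simps)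
    also have "\<dots> \<le> 50 * d ^ 3" using e1 e2 d by linarith
    finally show "1 + (3 * d + 16) * d + 2 * (d * (d + 1)) \<le> 50 * d ^ 3" .
    show "1 \<le> d" using d by simp
  qed
  finally show ?thesis .
qed

theorem theorem1:
  fixes m d :: nat
  assumes "d = CARD('n::finite)" and "d \<ge> 2" and "m \<ge> d"
  shows "1 / (real d ^ (50 * d ^ 3) * real m ^ (d ^ 2)) \<le> c_md m TYPE('n)
         \<and> c_md m TYPE('n) \<le> real d ^ d / real m ^ d"
proof -
  have m1: "m \<ge> 1" using assms by simp
  define c0 where "c0 = 1 / (real d ^ (50 * d ^ 3) * real m ^ (d ^ 2))"
  let ?C = "\<lambda>X :: nat \<Rightarrow> (real^'n) set. {c. \<exists>Y. (\<forall>i<m. Y i \<subseteq> X i) \<and> same_type m Y \<and>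
                         (\<forall>i<m. real (card (Y i)) \<ge> c * real (card (X i)))}"
  let ?adm = "\<lambda>X :: nat \<Rightarrow> (real^'n) set. family_gen_pos m X \<and> (\<forall>i<m. X i \<noteq> {})"
  have c0_in: "c0 \<in> ?C X" if X: "?adm X" for X
  proof -
    obtain Y where Y: "\<forall>i<m. Y i \<subseteq> X i" "same_type m Y"
      "\<forall>i<m. card (X i) \<le> 2 * (18 * 2 ^ d * (d + 1) ^ (d + 5) * m ^ d + 2 * d + 1) ^ d * 3 ^ (d * (d + 1)) * card (Y i)"
      using same_type_subfamily[of m X, folded assms(1)] X by blast
    have "real (card (Y i)) \<ge> c0 * real (card (X i))" if i: "i < m" for i
    proof -
      have "card (X i) \<le> 2 * (18 * 2 ^ d * (d + 1) ^ (d + 5) * m ^ d + 2 * d + 1) ^ d * 3 ^ (d * (d + 1)) * card (Y i)"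
        using Y(3) i by blast
      also have "\<dots> \<le> d ^ (50 * d ^ 3) * m ^ (d ^ 2) * card (Y i)"
        by (intro mult_le_mono1 subfamily_constant_le assms(2) m1)
      finally have "real (card (X i)) \<le> real (d ^ (50 * d ^ 3) * m ^ (d ^ 2) * card (Y i))"
        unfolding of_nat_le_iff .
      then have le: "real (card (X i)) \<le> (real d ^ (50 * d ^ 3) * real m ^ (d ^ 2)) * real (card (Y i))"
        by (simp only: of_nat_mult of_nat_power)
      have aux: "x \<le> K * y \<Longrightarrow> K > 0 \<Longrightarrow> 1 / K * x \<le> y" for x y K :: real by (simp add: field_simps)
      show ?thesis unfolding c0_def by (rule aux[OF le]) (use assms m1 in auto)
    qed
    then show ?thesis using Y(1,2) by blast
  qed
  \<comment> \<open>\<open>Sup\<close> needs an upper bound to be informative; index 0, available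
    because \<open>m \<ge> 1\<close>, gives the bound 1.\<close>
  have bdd: "bdd_above (?C X)" if X: "?adm X" for X
  proof (rule bdd_aboveI)
    fix c assume "c \<in> ?C X"
    then obtain Y where Y: "\<forall>i<m. Y i \<subseteq> X i" "\<forall>i<m. real (card (Y i)) \<ge> c * real (card (X i))" by blast
    have fin: "finite (X 0)" "X 0 \<noteq> {}" using X m1 unfolding family_gen_pos_def by auto
    then have "card (Y 0) \<le> card (X 0)" using Y(1) m1 by (intro card_mono) auto
    moreover have "c * real (card (X 0)) \<le> real (card (Y 0))" using Y(2) m1 by auto
    ultimately have "c * real (card (X 0)) \<le> 1 * real (card (X 0))" by linarith
    moreover have "real (card (X 0)) > 0" using fin by (simp add: card_gt_0_iff)
    ultimately show "c \<le> 1" by (rule mult_right_le_imp_le)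
  qed
  have lower: "c0 \<le> c_fam m X" if "?adm X" for X
    unfolding c_fam_def by (rule cSup_upper[OF c0_in[OF that] bdd[OF that]])
  let ?F = "{c_fam m X | X :: nat \<Rightarrow> (real^'n) set. ?adm X}"
  have grid: "\<exists>X. ?adm X \<and> c_fam m X \<le> (real d / real m + 1 / real N) ^ d" if N: "N \<ge> 1" for N
  proof -
    let ?A = "{a::'n \<Rightarrow> nat. \<forall>j. a j < N}"
    obtain p :: "nat \<Rightarrow> ('n \<Rightarrow> nat) \<Rightarrow> real^'n" where p: "\<forall>i<m. inj_on (p i) ?A"
      "\<forall>i<m. \<forall>a. (\<forall>j. a j < N) \<longrightarrow> (\<forall>j. real (a j) < p i a $ j \<and> p i a $ j < real (a j) + 1)"
      "family_gen_pos m (\<lambda>i. p i ` ?A)" using grid_family_exists[of m N] by blast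
    let ?X = "\<lambda>i. p i ` ?A"
    have "\<exists>a::'n \<Rightarrow> nat. \<forall>j. a j < N" by (rule exI[of _ "\<lambda>_. 0"]) (use N in simp)
    then have "?A \<noteq> {}" by blast
    then have adm: "?adm ?X" using p(3) by simp
    have "c \<le> (real CARD('n) / real m + 1 / real N) ^ CARD('n)" if "c \<in> ?C ?X" for c
    proof -
      obtain Y where Y: "\<forall>i<m. Y i \<subseteq> ?X i" "same_type m Y" "\<forall>i<m. real (card (Y i)) \<ge> c * real (card (?X i))"
        using \<open>c \<in> ?C ?X\<close> by blast
      show ?thesis
        by (rule grid_family_bound[of m p N Y c]) (use p Y N m1 in auto)
    qed
    then have "c_fam m ?X \<le> (real d / real m + 1 / real N) ^ d"
      unfolding c_fam_def assms(1) using c0_in[OF adm] by (intro cSup_least) auto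
    then show ?thesis using adm by blast
  qed
  have ne: "?F \<noteq> {}" using grid[of 1] by auto
  have "c0 \<le> c_md m TYPE('n)" unfolding c_md_def by (rule cInf_greatest[OF ne]) (use lower in blast)
  \<comment> \<open>The infimum lies below the bound of every grid, and refining the grid removes
    the term \<open>1 / N\<close>.\<close>
  moreover have "c_md m TYPE('n) \<le> (real d / real m) ^ d"
  proof (rule LIMSEQ_le_const)
    show "(\<lambda>n. (real d / real m + 1 / real (Suc n)) ^ d) \<longlonglongrightarrow> (real d / real m) ^ d"
    proof -
      have "(\<lambda>n. (real d / real m + 1 / real (Suc n)) ^ d) \<longlonglongrightarrow> (real d / real m + 0) ^ d"
        by (intro tendsto_intros LIMSEQ_Suc[OF lim_1_over_n])
      then show ?thesis by simp
    qed
    have "c_md m TYPE('n) \<le> (real d / real m + 1 / real (Suc n)) ^ d" for n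
    proof -
      obtain X where X: "?adm X" "c_fam m X \<le> (real d / real m + 1 / real (Suc n)) ^ d" using grid[of "Suc n"] by auto
      have "c_md m TYPE('n) \<le> c_fam m X" unfolding c_md_def
        by (rule cInf_lower) (use X(1) lower in \<open>auto intro!: bdd_belowI[of _ c0]\<close>)
      then show ?thesis using X(2) by linarith
    qed
    then show "\<exists>N. \<forall>n\<ge>N. c_md m TYPE('n) \<le> (real d / real m + 1 / real (Suc n)) ^ d" by blast
  qed
  ultimately show ?thesis unfolding c0_def power_divide by blast
qed

end
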